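(* Consider the one-component two-dimensional sinusoidal model $$y(t,s) = A^0\cos(\lambda^0 t+\mu^0 s)+B^0\sin(\lambda^0 t+\mu^0 s)+\epsilon(t,s),\qquad t\in\{1,\dots,T\},\ s\in\{1,\dots,S\},$$ with true parameter $\theta_0=(A^0,B^0,\lambda^0,\mu^0)$. Assume: (1) The parameter space is $\Theta=K\times K\times[0,\pi]\times[0,\pi]$, where $K$ is a compact subset of $\mathbb{R}$, and $\theta_0$ is an interior point of $\Theta$. (2) The $\epsilon(t,s)$ are independent and identically distributed random variables with common distribution function $G$ and continuous probability density function $g$, such that $G$ has unique median at $0$, i.e. $G(0)=\tfrac12$; the derivative $g'$ exists and is bounded; and $\mathbb{E}[\epsilon(t,s)^2]<\infty$ for all $t,s$. Let $\hat\theta_{T,S}=(\hat A_{T,S},\hat B_{T,S},\hat\lambda_{T,S},\hat\mu_{T,S})$ be the least absolute deviation (LAD) estimator of $\theta_0$. Then, as $\min\{T,S\}\to\infty$, $$\Big(\sqrt{TS}\,(\hat A_{T,S}-A^0),\ \sqrt{TS}\,(\hat B_{T,S}-B^0),\ T^{3/2}S^{1/2}(\hat\lambda_{T,S}-\lambda^0),\ S^{3/2}T^{1/2}(\hat\mu_{T,S}-\mu^0)\Big)$$ converges in distribution to $N_4\!\left(0,\frac{1}{4g^2(0)}\Sigma^{-1}\right)$, where $$\Sigma=\begin{pmatrix} \frac12 & 0 & \frac{B^0}{4} & \frac{B^0}{4}\\ 0 & \frac12 & -\frac{A^0}{4} & -\frac{A^0}{4}\\ \frac{B^0}{4} & -\frac{A^0}{4}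 & \frac{(A^0)^2+(B^0)^2}{6} & \frac{(A^0)^2+(B^0)^2}{8}\\ \frac{B^0}{4} & -\frac{A^0}{4} & \frac{(A^0)^2+(B^0)^2}{8} & \frac{(A^0)^2+(B^0)^2}{6} \end{pmatrix}.$$
   Context: The LAD estimator $\hat\theta_{T,S}=(\hat A_{T,S},\hat B_{T,S},\hat\lambda_{T,S},\hat\mu_{T,S})$ is obtained by minimizing, over $\theta=(A,B,\lambda,\mu)\in\Theta$, the objective function $$Q_{T,S}(\theta)=\frac{1}{TS}\sum_{t=1}^{T}\sum_{s=1}^{S}\Big|y(t,s)-A\cos(\lambda t+\mu s)-B\sin(\lambda t+\mu s)\Big|,$$ i.e. $\hat\theta_{T,S}=\arg\min_{\theta\in\Theta}Q_{T,S}(\theta)$. Here $N_d(0,V)$ denotes the $d$-dimensional normal distribution with mean $0$ and covariance matrix $V$, and $g^2(0)=(g(0))^2$.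
   Formalization: It is additionally assumed that g(0) is nonzero and that Σ is invertible (equivalently, A⁰ and B⁰ are not both zero), since otherwise the limit covariance Σ⁻¹/(4g²(0)) is undefined. *)

theory Defs
  imports "HOL-Probability.Probability"
begin

text \<open>The parameter is the tuple (amplitudes, then frequencies) \<open>(A, B, \<lambda>, \<mu>)\<close>; the frequencies
  \<open>\<lambda>\<close> and \<open>\<mu>\<close> are called \<open>l\<close> and \<open>m\<close>.\<close>

definition lad_objective ::
    "(nat \<Rightarrow> nat \<Rightarrow> real) \<Rightarrow> nat \<Rightarrow> nat \<Rightarrow> real \<times> real \<times> real \<times> real \<Rightarrow> real"
  where "lad_objective y T S = (\<lambda>(A, B, l, m).
    (1 / (real T * real S)) *
      (\<Sum>t = 1..T. \<Sum>s = 1..S.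
        \<bar>y t s - A * cos (l * real t + m * real s) - B * sin (l * real t + m * real s)\<bar>))"

text \<open>\<open>lad_Sigma A B\<close> is the limit of the averages over \<open>{1..T} \<times> {1..S}\<close> of \<open>d d\<^sup>T\<close>, where
  \<open>0 < l, m < pi\<close> and \<open>d\<close> is the gradient of \<open>A cos (l t + m s) + B sin (l t + m s)\<close> in \<open>(A, B, l, m)\<close>, its last two
  components divided by \<open>T\<close> and \<open>S\<close>. It is singular iff \<open>A = B = 0\<close>.\<close>

definition lad_Sigma :: "real \<Rightarrow> real \<Rightarrow> real ^ 4 ^ 4"
  where "lad_Sigma A B = vector
    [vector [1 / 2, 0,       B / 4,                B / 4],
     vector [0,     1 / 2,   - A / 4,              - A / 4],
     vector [B / 4, - A / 4, (A\<^sup>2 + B\<^sup>2) / 6, (A\<^sup>2 + B\<^sup>2) / 8],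
     vector [B / 4, - A / 4, (A\<^sup>2 + B\<^sup>2) / 8, (A\<^sup>2 + B\<^sup>2) / 6]]"

text \<open>The normal distribution with mean \<open>m\<close> and covariance matrix \<open>V\<close>, given by its density.
  This is meaningful for symmetric positive definite \<open>V\<close> only: degenerate normal
  distributions are not covered.\<close>

definition multivariate_normal :: "real ^ 'n \<Rightarrow> real ^ 'n ^ 'n \<Rightarrow> (real ^ 'n) measure"
  where "multivariate_normal m V = density lborel (\<lambda>x. ennreal
    (exp (- ((x - m) \<bullet> (matrix_inv V *v (x - m))) / 2) / sqrt ((2 * pi) ^ CARD('n) * det V)))"

text \<open>The library's notion of weak convergence is confined to sequences of measures on the real
  line. The version below tests against bounded continuous functions, works on any topological
  space and along any filter.\<close>

definition converges_weakly ::
    "('i \<Rightarrow> 'b::topological_space measure) \<Rightarrow> 'b measure \<Rightarrow> 'i filter \<Rightarrow> bool"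
  where "converges_weakly N L F \<longleftrightarrow>
    (\<forall>f :: 'b \<Rightarrow> real. continuous_on UNIV f \<and> bounded (range f) \<longrightarrow>
      ((\<lambda>i. integral\<^sup>L (N i) f) \<longlongrightarrow> integral\<^sup>L L f) F)"

definition (in prob_space) converges_in_distribution ::
    "('i \<Rightarrow> 'a \<Rightarrow> 'b::topological_space) \<Rightarrow> 'b measure \<Rightarrow> 'i filter \<Rightarrow> bool"
  where "converges_in_distribution X L F \<longleftrightarrow>
    (\<forall>i. random_variable borel (X i)) \<and>
    converges_weakly (\<lambda>i. distr M borel (X i)) L F"

end

theory Submission
  imports Defs
begin

text \<open>Write \<open>w\<close> for the parameter increment, its frequency components multiplied by \<open>T\<close> and \<open>S\<close>; in
  these coordinates the regression function has bounded gradients \<open>d\<close>, whose Gram matrix averages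
  to \<open>\<Sigma>\<close>. Up to a remainder, the LAD criterion minus its value at \<open>w = 0\<close> is the linear form
  \<open>- \<Sum> sgn \<epsilon> (d \<bullet> w)\<close> plus its curvature \<open>g(0) \<Sum> (d \<bullet> w)\<^sup>2\<close>. Second moments and a net whose size
  does not depend on the radius control the remainder on balls. With consistency, a peeling over dyadic
  balls shows that the estimation error is \<open>O(1 / sqrt (T S))\<close>; on that scale the criterion is a
  quadratic up to \<open>o(1)\<close>, so the error is close to the minimizer of the quadratic, a linear image of the
  score \<open>\<Sum> sgn \<epsilon> d / sqrt (T S)\<close>. The signs are independent and centred, hence the cosine averages of
  the score are asymptotically those of \<open>N(0, \<Sigma>)\<close>, and together with tightness they determine the limit.

  For consistency, a Hoeffding bound over a net of polynomially many parameters makes the criterion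
  uniformly close to its mean. That mean is bounded below by a positive constant wherever the mean
  square of the regression difference is, and exponential sums bound the latter away from zero
  unless the amplitude errors and \<open>T \<bar>\<lambda> - \<lambda>\<^sup>0\<bar>\<close>, \<open>S \<bar>\<mu> - \<mu>\<^sup>0\<bar>\<close> are all small.\<close>

section \<open>Weak convergence from cosine averages\<close>

text \<open>The criterion is not convex in the frequencies, so pointwise convergence of convex
  functions, the usual route for LAD estimators, is closed: every expansion must hold uniformly over
  balls. What makes this affordable is a cubic. On a ball of radius \<open>r\<close> a summand of
  the remainder has second moment \<open>O(r^3)\<close>, because the kink of the absolute value
  matters only for noise of size \<open>O(r)\<close>. Against an error budget of order
  \<open>card I * r^2\<close>, Chebyshev fails with probability \<open>O(1 / (card I * r))\<close>,
  which is summable over dyadic radii down to \<open>1 / sqrt (card I)\<close>. Consistency of the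
  frequencies alone would be too weak a start: the expansion lives in coordinates where
  \<open>\<lambda> - \<lambda>0\<close> is multiplied by \<open>T\<close>, so
  \<open>T * \<bar>\<lambda> - \<lambda>0\<bar>\<close> has to be made small. The same factor, times
  \<open>sqrt (T * S)\<close>, gives the rate \<open>T^(3/2) * S^(1/2)\<close>. The limiting
  quadratic is \<open>g 0 * (norm (L v))^2 - score \<bullet> v\<close>; its minimizer is the inverse
  of \<open>\<Sigma>\<close> applied to \<open>score / (2 * g 0)\<close>, whence the factor
  \<open>1 / (4 * (g 0)^2)\<close>.\<close>

inductive trig_polynomial :: "(real ^ 'n \<Rightarrow> real) \<Rightarrow> bool" where
  cos: "trig_polynomial (\<lambda>x. a * cos (u \<bullet> x + b))"
| add: "trig_polynomial f \<Longrightarrow> trig_polynomial g \<Longrightarrow> trig_polynomial (\<lambda>x. f x + g x)"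

lemma trig_polynomial_const: "trig_polynomial (\<lambda>x. c)"
  using trig_polynomial.cos[of c 0 0] by simp

lemma trig_polynomial_sin: "trig_polynomial (\<lambda>x. a * sin ((u :: real ^ 'n) \<bullet> x))"
proof -
  have "a * sin (u \<bullet> x) = a * cos (u \<bullet> x + - pi / 2)" for x :: "real ^ 'n"
    by (simp add: cos_diff)
  then show ?thesis
    using trig_polynomial.cos[of a u "- pi / 2"] by (simp only:)
qed

text \<open>Product-to-sum formulas turn a product of two cosines into two cosines with frequencies
  \<open>u - u'\<close> and \<open>u + u'\<close>; arbitrary phases \<open>b\<close> keep the class
  closed without complex exponentials.\<close>

lemma trig_polynomial_mult:
  assumes "trig_polynomial f" "trig_polynomial g"
  shows "trig_polynomial (\<lambda>x. f x * g x)"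
  using assms(1)
proof (induction rule: trig_polynomial.induct)
  case (cos a u b)
  show ?case
    using assms(2)
  proof (induction rule: trig_polynomial.induct)
    case (cos a' u' b')
    have "a * cos (u \<bullet> x + b) * (a' * cos (u' \<bullet> x + b')) =
        (a * a' / 2) * cos ((u - u') \<bullet> x + (b - b')) + (a * a' / 2) * cos ((u + u') \<bullet> x + (b + b'))" for x
    proof -
      have e: "(u - u') \<bullet> x + (b - b') = (u \<bullet> x + b) - (u' \<bullet> x + b')"
        "(u + u') \<bullet> x + (b + b') = (u \<bullet> x + b) + (u' \<bullet> x + b')"
        by (simp_all add: inner_diff_left inner_add_left)
      show ?thesis
        unfolding e cos_diff[of "u \<bullet> x + b"] cos_add[of "u \<bullet> x + b"] by (simp add: algebra_simps)
    qed
    then show ?case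
      using trig_polynomial.add[OF trig_polynomial.cos[of "a * a' / 2" "u - u'" "b - b'"] trig_polynomial.cos[of "a * a' / 2" "u + u'" "b + b'"]]
      by simp
  next
    case (add f g)
    then show ?case by (simp add: distrib_left trig_polynomial.add)
  qed
next
  case (add f h)
  then show ?case by (simp add: distrib_right trig_polynomial.add)
qed

lemma trig_polynomial_sum:
  assumes "finite S" "\<And>k. k \<in> S \<Longrightarrow> trig_polynomial (f k)"
  shows "trig_polynomial (\<lambda>x. \<Sum>k\<in>S. f k x)"
  using assms by (induction S) (auto intro: trig_polynomial_const trig_polynomial.add)

text \<open>Coordinate functions become single sines, and sums and products stay in the class, so
  the induction follows the construction of real polynomials. The linear case expands
  \<open>f\<close> along the axes.\<close>

lemma trig_polynomial_compose_sin:
  fixes p :: "real ^ 'n \<Rightarrow> real"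
  assumes "real_polynomial_function p"
  shows "trig_polynomial (\<lambda>x. p (\<chi> i. sin (c * x $ i)))"
  using assms
proof (induction rule: real_polynomial_function.induct)
  case (linear f)
  interpret bounded_linear f by fact
  have "f (\<chi> i. sin (c * x $ i)) = (\<Sum>k\<in>UNIV. f (axis k 1) * sin ((c *\<^sub>R axis k 1) \<bullet> x))" for x :: "real ^ 'n"
  proof -
    have "(\<chi> i. sin (c * x $ i)) = (\<Sum>k\<in>UNIV. sin (c * x $ k) *\<^sub>R axis k 1)"
      by (simp add: vec_eq_iff axis_def if_distrib[of "\<lambda>a. _ * a"] cong: if_cong)
    then have "f (\<chi> i. sin (c * x $ i)) = (\<Sum>k\<in>UNIV. sin (c * x $ k) * f (axis k 1))"
      by (simp add: sum scaleR)
    then show ?thesis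
      by (simp add: inner_axis' mult.commute)
  qed
  then show ?case
    by (simp only:) (intro trig_polynomial_sum trig_polynomial_sin finite)
qed (auto intro: trig_polynomial_const trig_polynomial.add trig_polynomial_mult)

lemma trig_polynomial_continuous: "trig_polynomial f \<Longrightarrow> continuous_on A f"
  by (induction rule: trig_polynomial.induct) (auto intro!: continuous_intros)

lemma trig_polynomial_bounded: "trig_polynomial f \<Longrightarrow> \<exists>B. \<forall>x. \<bar>f x\<bar> \<le> B"
proof (induction rule: trig_polynomial.induct)
  case (cos a u b)
  then show ?case
    by (intro exI[of _ "\<bar>a\<bar>"]) (simp add: abs_mult mult_left_le)
next
  case (add f g)
  then obtain B1 B2 where "\<forall>x. \<bar>f x\<bar> \<le> B1" "\<forall>x. \<bar>g x\<bar> \<le> B2" by blast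
  then show ?case
    by (intro exI[of _ "B1 + B2"] allI order_trans[OF abs_triangle_ineq] add_mono) auto
qed

lemma trig_polynomial_integrable:
  assumes "trig_polynomial f" "prob_space M" "X \<in> borel_measurable M"
  shows "integrable M (\<lambda>\<omega>. f (X \<omega>))"
proof -
  interpret prob_space M by fact
  obtain B where B: "\<And>x. \<bar>f x\<bar> \<le> B" using trig_polynomial_bounded[OF assms(1)] by blast
  have [measurable]: "f \<in> borel_measurable borel"
    by (intro borel_measurable_continuous_onI trig_polynomial_continuous assms)
  show ?thesis
    using assms(3) B by (intro integrable_const_bound[where B = B]) auto
qed

text \<open>A polynomial in \<open>sin (x\<^sub>i / R)\<close> that approximates
  \<open>f (R arcsin z\<^sub>1, \<dots>, R arcsin z\<^sub>n)\<close> on \<open>[-1, 1]\<^sup>n\<close> is close to \<open>f\<close> on the cube of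
  side \<open>2 R\<close> and, unlike a general trigonometric polynomial, stays bounded outside of it.\<close>

lemma trig_polynomial_approx:
  fixes f :: "real ^ 'n \<Rightarrow> real"
  assumes f: "continuous_on UNIV f" "\<And>x. \<bar>f x\<bar> \<le> B" and "0 < R" "0 < e"
  obtains p where "trig_polynomial p" "\<And>x. \<bar>p x\<bar> \<le> B + e"
    "\<And>x. norm x \<le> R \<Longrightarrow> \<bar>f x - p x\<bar> \<le> e"
proof -
  define S :: "(real ^ 'n) set" where "S = cbox (\<chi> i. -1) (\<chi> i. 1)"
  define F where "F = (\<lambda>z. f (\<chi> i. R * arcsin (z $ i)))"
  have S: "z \<in> S \<longleftrightarrow> (\<forall>i. -1 \<le> z $ i \<and> z $ i \<le> 1)" for z
    by (simp add: S_def mem_box_cart)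
  have "continuous_on S (\<lambda>z. \<chi> i. R * arcsin (z $ i))"
    by (intro continuous_intros) (auto simp: S)
  then have "continuous_on S F"
    unfolding F_def by (intro continuous_on_compose2[OF f(1)]) auto
  moreover have "compact S" by (simp add: S_def)
  ultimately obtain q where q: "real_polynomial_function q" "\<And>z. z \<in> S \<Longrightarrow> \<bar>F z - q z\<bar> < e"
    using Stone_Weierstrass_real_polynomial_function[of S F e] \<open>0 < e\<close> by blast
  define p where "p = (\<lambda>x. q (\<chi> i. sin (1 / R * x $ i)))"
  have sS: "(\<chi> i. sin (1 / R * x $ i)) \<in> S" for x :: "real ^ 'n" by (simp add: S)
  show thesis
  proof
    show "trig_polynomial p" unfolding p_def by (rule trig_polynomial_compose_sin) fact
    \<comment> \<open>At every \<open>x\<close>, \<open>p x\<close> is a value of \<open>q\<close>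
      on the cube, where \<open>q\<close> is \<open>e\<close>-close to \<open>F\<close>, and
      \<open>F\<close> takes only values of \<open>f\<close>.\<close>
    show "\<bar>p x\<bar> \<le> B + e" for x
      using q(2)[OF sS[of x]] f(2)[of "(\<chi> i. R * arcsin ((\<chi> i. sin (1 / R * x $ i)) $ i))"]
      unfolding p_def F_def by linarith
    show "\<bar>f x - p x\<bar> \<le> e" if "norm x \<le> R" for x
    proof -
      have "arcsin (sin (1 / R * x $ i)) = 1 / R * x $ i" for i
      proof (rule arcsin_sin)
        have "\<bar>x $ i\<bar> \<le> R" using component_le_norm_cart[of x i] that by linarith
        \<comment> \<open>Inside the ball the argument stays in \<open>[-1, 1]\<close>, which lies
          in \<open>[-pi/2, pi/2]\<close>, where \<open>arcsin\<close> undoes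
          \<open>sin\<close>.\<close>
        then have "\<bar>1 / R * x $ i\<bar> \<le> 1" using \<open>0 < R\<close> by (simp add: abs_mult)
        then show "- (pi / 2) \<le> 1 / R * x $ i" "1 / R * x $ i \<le> pi / 2"
          unfolding abs_le_iff using pi_gt3 by linarith+
      qed
      then have "F (\<chi> i. sin (1 / R * x $ i)) = f x"
        using \<open>0 < R\<close> by (simp add: F_def)
      then show ?thesis using q(2)[OF sS[of x]] by (simp add: p_def)
    qed
  qed
qed

text \<open>Inside the ball of radius \<open>R\<close> the integrands differ by at most
  \<open>e\<close>; outside they differ by at most \<open>2 * B + e\<close>, on an event of
  probability at most \<open>q\<close>. Keeping \<open>p\<close> bounded off the ball is what makes
  the second part small.\<close>

lemma integral_diff_le_of_tight:
  fixes X :: "'a \<Rightarrow> 'b::real_normed_vector"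
  assumes "prob_space M" and [measurable]: "X \<in> borel_measurable M"
    and "integrable M (\<lambda>\<omega>. f (X \<omega>))" "integrable M (\<lambda>\<omega>. p (X \<omega>))"
    and close: "\<And>x. norm x \<le> R \<Longrightarrow> \<bar>f x - p x\<bar> \<le> e"
    and bd: "\<And>x. \<bar>f x\<bar> \<le> B" "\<And>x. \<bar>p x\<bar> \<le> B + e" and "0 \<le> e"
    and tail: "measure M {\<omega> \<in> space M. R < norm (X \<omega>)} \<le> q"
  shows "\<bar>(\<integral>\<omega>. f (X \<omega>) \<partial>M) - (\<integral>\<omega>. p (X \<omega>) \<partial>M)\<bar> \<le> e + (2 * B + e) * (q :: real)"
proof -
  interpret prob_space M by fact
  have B: "0 \<le> B" using bd(1)[of undefined] by linarith
  let ?Z = "{\<omega> \<in> space M. R < norm (X \<omega>)}"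
  have Z[measurable]: "?Z \<in> sets M" by measurable
  have "\<bar>(\<integral>\<omega>. f (X \<omega>) \<partial>M) - (\<integral>\<omega>. p (X \<omega>) \<partial>M)\<bar> = \<bar>\<integral>\<omega>. f (X \<omega>) - p (X \<omega>) \<partial>M\<bar>"
    using assms by simp
  also have "\<dots> \<le> (\<integral>\<omega>. \<bar>f (X \<omega>) - p (X \<omega>)\<bar> \<partial>M)" by (rule integral_abs_bound)
  also have "\<dots> \<le> (\<integral>\<omega>. e + (2 * B + e) * indicator ?Z \<omega> \<partial>M)"
  proof (rule integral_mono)
    show "integrable M (\<lambda>\<omega>. \<bar>f (X \<omega>) - p (X \<omega>)\<bar>)" using assms by simp
    show "integrable M (\<lambda>\<omega>. e + (2 * B + e) * indicator ?Z \<omega>)"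
      by (auto intro!: integrable_const_bound[where B = "e + \<bar>2 * B + e\<bar>"] simp: indicator_def \<open>0 \<le> e\<close> B)
    fix \<omega> assume "\<omega> \<in> space M"
    then show "\<bar>f (X \<omega>) - p (X \<omega>)\<bar> \<le> e + (2 * B + e) * indicator ?Z \<omega>"
      using close[of "X \<omega>"] bd[of "X \<omega>"] \<open>0 \<le> e\<close> by (auto simp: indicator_def)
  qed
  also have "\<dots> = e + (2 * B + e) * prob ?Z"
    by (subst Bochner_Integration.integral_add) (auto simp: prob_space Int_absorb2 sets.sets_into_space[OF Z] intro!: integrable_mult_right integrable_const_bound[where B = 1])
  also have "\<dots> \<le> e + (2 * B + e) * q"
    using tail B \<open>0 \<le> e\<close> by (intro add_left_mono mult_left_mono) auto
  finally show ?thesis .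
qed

lemma tight_finite_measure:
  fixes L :: "'b::real_normed_vector measure"
  assumes "prob_space L" and sets: "sets L = sets borel" and "0 < q"
  shows "\<exists>R0::real. \<forall>R\<ge>R0. measure L {x \<in> space L. R < norm x} \<le> q"
proof -
  interpret prob_space L by fact
  have [measurable]: "norm \<in> borel_measurable L" by (simp add: measurable_cong_sets[OF sets refl])
  have "(\<lambda>n. measure L {x \<in> space L. real n < norm x}) \<longlonglongrightarrow> measure L (\<Inter>n::nat. {x \<in> space L. real n < norm x})"
    by (intro finite_Lim_measure_decseq) (auto simp: decseq_def)
  moreover have "(\<Inter>n::nat. {x \<in> space L. real n < norm x}) = {}"
  proof (intro equalityI subsetI)
    fix x assume "x \<in> (\<Inter>n::nat. {x \<in> space L. real n < norm x})"
    moreover obtain n :: nat where "norm x \<le> real n" using real_arch_simple by blast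
    ultimately show "x \<in> {}" by (auto simp: not_less[symmetric])
  qed simp
  ultimately have "(\<lambda>n. measure L {x \<in> space L. real n < norm x}) \<longlonglongrightarrow> 0" by simp
  then have "\<forall>\<^sub>F n in sequentially. measure L {x \<in> space L. real n < norm x} < q"
    using \<open>0 < q\<close> by (rule order_tendstoD)
  then obtain n :: nat where n: "measure L {x \<in> space L. real n < norm x} < q"
    by (auto dest: eventually_happens)
  have "measure L {x \<in> space L. R < norm x} \<le> q" if "real n \<le> R" for R
  proof -
    have "measure L {x \<in> space L. R < norm x} \<le> measure L {x \<in> space L. real n < norm x}"
      using that by (intro finite_measure_mono) auto
    then show ?thesis using n by simp
  qed
  then show ?thesis by blast
qed

text \<open>Linearity carries the convergence from cosines to trigonometric polynomials. Tightness
  lets a bounded continuous \<open>f\<close> be exchanged for such a polynomial at a cost that is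
  eventually uniform in \<open>i\<close>, and likewise under the limit \<open>L\<close>.\<close>

theorem weak_convergence_of_cos:
  fixes X :: "'i \<Rightarrow> 'a \<Rightarrow> real ^ 'n"
  assumes "prob_space M" "prob_space L" and sets_L: "sets L = sets borel"
    and X: "\<And>i. X i \<in> borel_measurable M"
    and tight: "\<And>q. 0 < q \<Longrightarrow> \<exists>R. \<forall>\<^sub>F i in F. measure M {\<omega> \<in> space M. R < norm (X i \<omega>)} \<le> q"
    and conv: "\<And>u b. ((\<lambda>i. \<integral>\<omega>. cos (u \<bullet> X i \<omega> + b) \<partial>M) \<longlongrightarrow> (\<integral>x. cos (u \<bullet> x + b) \<partial>L)) F"
  shows "prob_space.converges_in_distribution M X L F"
proof -
  interpret M: prob_space M by fact
  interpret L: prob_space L by fact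
  have idL: "(\<lambda>x. x) \<in> borel_measurable L"
    by (simp add: measurable_cong_sets[OF sets_L refl])
  have trig: "((\<lambda>i. \<integral>\<omega>. p (X i \<omega>) \<partial>M) \<longlongrightarrow> (\<integral>x. p x \<partial>L)) F" if "trig_polynomial p" for p
    using that
  proof (induction rule: trig_polynomial.induct)
    case (cos a u b)
    then show ?case by (simp add: tendsto_mult_left conv)
  next
    case (add f g)
    then show ?case
      using trig_polynomial_integrable[OF _ \<open>prob_space M\<close> X]
        trig_polynomial_integrable[OF _ \<open>prob_space L\<close> idL]
      by (simp add: tendsto_add)
  qed
  have main: "((\<lambda>i. \<integral>\<omega>. f (X i \<omega>) \<partial>M) \<longlongrightarrow> (\<integral>x. f x \<partial>L)) F"
    if f: "continuous_on UNIV f" and "bounded (range f)" for f :: "real ^ 'n \<Rightarrow> real"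
  proof -
    obtain B where B: "\<And>x. \<bar>f x\<bar> \<le> B" using \<open>bounded (range f)\<close> by (auto simp: bounded_iff)
    have B0: "0 \<le> B" using order_trans[OF abs_ge_zero B] by simp
    have mf[measurable]: "f \<in> borel_measurable borel"
      using f by (rule borel_measurable_continuous_onI)
    have intM: "integrable M (\<lambda>\<omega>. f (X i \<omega>))" for i
      using X B by (intro M.integrable_const_bound[where B = B]) auto
    have intL: "integrable L f"
      using idL B by (intro L.integrable_const_bound[where B = B]) (auto simp: measurable_cong_sets[OF sets_L refl])
    show ?thesis
    proof (rule tendstoI)
      fix \<epsilon> :: real assume "0 < \<epsilon>"
      \<comment> \<open>Each exchange costs at most \<open>e + (2 * B + e) * q\<close>, and
        \<open>e\<close>, \<open>q\<close> make this at most \<open>\<epsilon> / 4\<close>; the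
        convergence of the polynomial averages takes another quarter. \<open>e \<le> 1\<close> lets
        \<open>q\<close> be chosen without reference to \<open>e\<close>.\<close>
      define e where "e = min 1 (\<epsilon> / 8)"
      define q where "q = \<epsilon> / (8 * (2 * B + 1))"
      have e: "0 < e" "e \<le> 1" "e \<le> \<epsilon> / 8" using \<open>0 < \<epsilon>\<close> by (auto simp: e_def)
      have q: "0 < q" using \<open>0 < \<epsilon>\<close> B0 by (simp add: q_def)
      have qe: "e + (2 * B + e) * q \<le> \<epsilon> / 4"
      proof -
        have "(2 * B + e) * q \<le> (2 * B + 1) * q" using e q by (intro mult_right_mono) auto
        also have "\<dots> = \<epsilon> / 8" using B0 by (simp add: q_def field_simps add_nonneg_eq_0_iff)
        finally show ?thesis using e by simp
      qed
      obtain R1 where R1: "\<forall>\<^sub>F i in F. measure M {\<omega> \<in> space M. R1 < norm (X i \<omega>)} \<le> q"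
        using tight[OF q] by blast
      obtain R2 where R2: "\<And>R. R \<ge> R2 \<Longrightarrow> measure L {x \<in> space L. R < norm x} \<le> q"
        using tight_finite_measure[OF \<open>prob_space L\<close> sets_L q] by blast
      define R where "R = max 1 (max R1 R2)"
      have R: "0 < R" "R1 \<le> R" "R2 \<le> R" by (auto simp: R_def)
      obtain p where p: "trig_polynomial p" "\<And>x. \<bar>p x\<bar> \<le> B + e"
        "\<And>x. norm x \<le> R \<Longrightarrow> \<bar>f x - p x\<bar> \<le> e"
        using trig_polynomial_approx[OF f B R(1) e(1)] by blast
      have dL: "\<bar>(\<integral>x. f x \<partial>L) - (\<integral>x. p x \<partial>L)\<bar> \<le> \<epsilon> / 4"
        using integral_diff_le_of_tight[OF \<open>prob_space L\<close> idL intL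
            trig_polynomial_integrable[OF p(1) \<open>prob_space L\<close> idL] p(3) B p(2) _ R2[OF R(3)]] e qe
        by simp
      have "\<forall>\<^sub>F i in F. dist (\<integral>\<omega>. p (X i \<omega>) \<partial>M) (\<integral>x. p x \<partial>L) < \<epsilon> / 4"
        using trig[OF p(1)] \<open>0 < \<epsilon>\<close> by (auto dest: tendstoD[where e = "\<epsilon> / 4"])
      with R1 show "\<forall>\<^sub>F i in F. dist (\<integral>\<omega>. f (X i \<omega>) \<partial>M) (\<integral>x. f x \<partial>L) < \<epsilon>"
      proof eventually_elim
        case (elim i)
        have [measurable]: "X i \<in> borel_measurable M" by (rule X)
        have "measure M {\<omega> \<in> space M. R < norm (X i \<omega>)} \<le> measure M {\<omega> \<in> space M. R1 < norm (X i \<omega>)}"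
          using R by (intro M.finite_measure_mono) auto
        then have "measure M {\<omega> \<in> space M. R < norm (X i \<omega>)} \<le> q" using elim by simp
        then have "\<bar>(\<integral>\<omega>. f (X i \<omega>) \<partial>M) - (\<integral>\<omega>. p (X i \<omega>) \<partial>M)\<bar> \<le> \<epsilon> / 4"
          using integral_diff_le_of_tight[OF \<open>prob_space M\<close> X[of i] intM
              trig_polynomial_integrable[OF p(1) \<open>prob_space M\<close> X] p(3) B p(2), where q = q and R = R] e qe
          by simp
        then show ?case using dL elim(2) \<open>0 < \<epsilon>\<close> unfolding dist_real_def by linarith
      qed
    qed
  qed
  show ?thesis
    unfolding M.converges_in_distribution_def converges_weakly_def
  proof (intro conjI allI impI)
    fix f :: "real ^ 'n \<Rightarrow> real" assume f: "continuous_on UNIV f \<and> bounded (range f)"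
    then have "f \<in> borel_measurable borel" using borel_measurable_continuous_onI by blast
    then have "integral\<^sup>L (distr M borel (X i)) f = (\<integral>\<omega>. f (X i \<omega>) \<partial>M)" for i
      using X by (intro integral_distr) auto
    then show "((\<lambda>i. integral\<^sup>L (distr M borel (X i)) f) \<longlongrightarrow> integral\<^sup>L L f) F"
      using main f by simp
  qed (use X in simp)
qed

section \<open>The normal distribution\<close>

lemma matrix_inv_mult:
  fixes A :: "real ^ 'n ^ 'n"
  assumes "invertible A"
  shows "A ** matrix_inv A = mat 1" "matrix_inv A ** A = mat 1"
proof -
  have "A ** matrix_inv A = mat 1 \<and> matrix_inv A ** A = mat 1"
    unfolding matrix_inv_def by (rule someI_ex) (use assms in \<open>simp add: invertible_def\<close>)
  then show "A ** matrix_inv A = mat 1" "matrix_inv A ** A = mat 1" by simp_all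
qed

lemma matrix_inv_unique:
  fixes A B :: "real ^ 'n ^ 'n"
  assumes "B ** A = mat 1"
  shows "matrix_inv A = B"
proof -
  have "invertible A" using assms invertible_left_inverse by blast
  then have "B ** (A ** matrix_inv A) = B" by (simp add: matrix_inv_mult)
  then show ?thesis using assms by (simp add: matrix_mul_assoc)
qed

text \<open>Change of variables by an invertible matrix, as an identity of measures, so that
  integrals of complex functions can be rewritten with it. It is checked on boxes: the preimage of a
  box is its image under the inverse \<open>P\<close>, with measure scaled by
  \<open>\<bar>det P\<bar>\<close>.\<close>

lemma lborel_linear_image:
  fixes A :: "real ^ 'n::{finite, wellorder} ^ 'n::_"
  assumes "det A \<noteq> 0"
  shows "(lborel :: (real ^ 'n::_) measure) = density (distr lborel borel ((*v) A)) (\<lambda>_. ennreal \<bar>det A\<bar>)"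
proof (rule lborel_eqI)
  have "invertible A" using assms by (simp add: invertible_det_nz)
  define P where "P = matrix_inv A"
  have PA: "P ** A = mat 1" "A ** P = mat 1"
    using \<open>invertible A\<close> by (simp_all add: P_def matrix_inv_mult)
  have detP: "\<bar>det A\<bar> * \<bar>det P\<bar> = 1"
    using PA(2) by (metis abs_mult abs_one det_I det_mul)
  have cont: "continuous_on UNIV ((*v) A)" 
    by (intro linear_continuous_on linear_linear[THEN iffD2] matrix_vector_mul_linear)
  then have [measurable]: "(*v) A \<in> borel \<rightarrow>\<^sub>M borel" by (rule borel_measurable_continuous_onI)
  show "sets (density (distr lborel borel ((*v) A)) (\<lambda>_. ennreal \<bar>det A\<bar>)) = sets borel" by simp
  fix l u :: "real ^ 'n::_" assume lu: "\<And>b. b \<in> Basis \<Longrightarrow> l \<bullet> b \<le> u \<bullet> b"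
  have vim: "(*v) A -` box l u = (*v) P ` box l u"
  proof (intro equalityI subsetI)
    fix x assume "x \<in> (*v) A -` box l u"
    then have "A *v x \<in> box l u" "x = P *v (A *v x)"
      by (simp_all add: matrix_vector_mul_assoc PA)
    then show "x \<in> (*v) P ` box l u" by blast
  next
    fix x assume "x \<in> (*v) P ` box l u"
    then obtain z where "z \<in> box l u" "x = P *v z" by blast
    then show "x \<in> (*v) A -` box l u" by (simp add: matrix_vector_mul_assoc PA)
  qed
  have meas: "(*v) P ` box l u \<in> lmeasurable"
    by (intro measurable_linear_image) auto
  have "emeasure (density (distr lborel borel ((*v) A)) (\<lambda>_. ennreal \<bar>det A\<bar>)) (box l u)
      = ennreal \<bar>det A\<bar> * emeasure lborel ((*v) A -` box l u)"
    by (simp add: emeasure_density nn_integral_cmult_indicator emeasure_distr)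
  also have "emeasure lborel ((*v) A -` box l u) = emeasure lebesgue ((*v) P ` box l u)"
  proof -
    have "(*v) A -` box l u \<in> sets lborel"
      using measurable_sets[of "(*v) A" borel borel "box l u"] by simp
    then show ?thesis unfolding vim[symmetric] by simp
  qed
  also have "\<dots> = ennreal (measure lebesgue ((*v) P ` box l u))"
    using meas by (rule emeasure_eq_measure2)
  also have "measure lebesgue ((*v) P ` box l u) = \<bar>det P\<bar> * measure lebesgue (box l u)"
    by (subst measure_linear_image) auto
  also have "ennreal \<bar>det A\<bar> * ennreal \<dots> = ennreal (\<bar>det A\<bar> * \<bar>det P\<bar> * measure lebesgue (box l u))"
    by (simp add: ennreal_mult mult.assoc)
  also have "\<dots> = ennreal (\<Prod>b\<in>Basis. (u - l) \<bullet> b)"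
    using lu by (simp add: detP)
  finally show "emeasure (density (distr lborel borel ((*v) A)) (\<lambda>_. ennreal \<bar>det A\<bar>)) (box l u)
    = ennreal (\<Prod>b\<in>Basis. (u - l) \<bullet> b)" .
qed

text \<open>Lebesgue measure is the image of the product of one-dimensional ones under the
  coordinate expansion, so the integral of a product of functions of single coordinates
  factors.\<close>

lemma integral_lborel_prod:
  fixes f :: "'b::euclidean_space \<Rightarrow> real \<Rightarrow> complex"
  assumes int: "\<And>b. b \<in> Basis \<Longrightarrow> integrable lborel (f b)"
  shows "(\<integral>x. (\<Prod>b\<in>Basis. f b (x \<bullet> b)) \<partial>lborel) = (\<Prod>b\<in>Basis. \<integral>x. f b x \<partial>lborel)"
proof -
  interpret product_sigma_finite "\<lambda>_. lborel :: real measure" ..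
  have [measurable]: "f b \<in> borel_measurable borel" if "b \<in> Basis" for b
    using int[OF that] by auto
  have "(\<integral>x. (\<Prod>b\<in>Basis. f b (x \<bullet> b)) \<partial>lborel)
      = (\<integral>x. (\<Prod>b\<in>Basis. f b ((\<Sum>b\<in>Basis. x b *\<^sub>R b) \<bullet> b)) \<partial>(\<Pi>\<^sub>M b\<in>Basis. lborel))"
    by (subst lborel_eq, subst integral_distr) auto
  also have "\<dots> = (\<integral>x. (\<Prod>b\<in>Basis. f b (x b)) \<partial>(\<Pi>\<^sub>M b\<in>Basis. lborel))"
    by (intro Bochner_Integration.integral_cong prod.cong) auto
  also have "\<dots> = (\<Prod>b\<in>Basis. \<integral>x. f b x \<partial>lborel)"
    using int by (intro product_integral_prod) auto
  finally show ?thesis .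
qed

lemma std_normal_char_integral:
  "(\<integral>x. complex_of_real (std_normal_density x) * cis (t * x) \<partial>lborel) = of_real (exp (- t\<^sup>2 / 2))"
  "integrable lborel (\<lambda>x. complex_of_real (std_normal_density x) * cis (t * x))"
proof -
  have "(\<integral>x. complex_of_real (std_normal_density x) * cis (t * x) \<partial>lborel) = char std_normal_distribution t"
    unfolding char_def
    by (subst integral_density) (auto simp: cis_conv_exp scaleR_conv_of_real)
  then show "(\<integral>x. complex_of_real (std_normal_density x) * cis (t * x) \<partial>lborel) = of_real (exp (- t\<^sup>2 / 2))"
    by (simp add: char_std_normal_distribution)
  show "integrable lborel (\<lambda>x. complex_of_real (std_normal_density x) * cis (t * x))"
    by (rule Bochner_Integration.integrable_bound[of _ "\<lambda>x. std_normal_density x"])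
       (auto simp: norm_mult integrable_normal_density cis_conv_exp)
qed

lemma std_normal_char_integral_Basis:
  fixes u :: "'b::euclidean_space"
  shows "(\<integral>x. complex_of_real (\<Prod>b\<in>Basis. std_normal_density (x \<bullet> b)) * cis (u \<bullet> x) \<partial>lborel)
    = of_real (exp (- (norm u)\<^sup>2 / 2))"
proof -
  have cis_sum: "cis (\<Sum>b\<in>B. h b) = (\<Prod>b\<in>B. cis (h b))" if "finite B" for h and B :: "'b set"
    using that by (induction B) (auto simp: cis_mult[symmetric])
  have "complex_of_real (\<Prod>b\<in>Basis. std_normal_density (x \<bullet> b)) * cis (u \<bullet> x)
    = (\<Prod>b\<in>Basis. complex_of_real (std_normal_density (x \<bullet> b)) * cis ((u \<bullet> b) * (x \<bullet> b)))" for x :: 'b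
    by (subst euclidean_inner) (simp add: cis_sum prod.distrib)
  then have "(\<integral>x. complex_of_real (\<Prod>b\<in>Basis. std_normal_density (x \<bullet> b)) * cis (u \<bullet> x) \<partial>lborel)
    = (\<Prod>b\<in>Basis. complex_of_real (exp (- (u \<bullet> b)\<^sup>2 / 2)))"
    by (simp only:) (subst integral_lborel_prod, auto simp only: std_normal_char_integral)
  also have "\<dots> = of_real (exp (\<Sum>b\<in>Basis. - (u \<bullet> b)\<^sup>2 / 2))"
    by (simp only: exp_sum[OF finite_Basis] of_real_prod)
  also have "(\<Sum>b\<in>Basis. - (u \<bullet> b)\<^sup>2 / 2) = - (norm u)\<^sup>2 / 2"
    unfolding power2_norm_eq_inner euclidean_inner[of u u]
    by (simp add: sum_divide_distrib[symmetric] sum_negf power2_eq_square)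
  finally show ?thesis .
qed

text \<open>The covariance is given through a square root \<open>Q\<close> of its inverse.\<close>

lemma multivariate_normal_char:
  fixes V Q P :: "real ^ 'n::{finite, wellorder} ^ 'n::_"
  assumes V: "matrix_inv V = transpose Q ** Q" "det V = 1 / (det Q)\<^sup>2" and PQ: "P ** Q = mat 1"
  shows "(\<integral>x. cis (u \<bullet> x) \<partial>multivariate_normal 0 V) = of_real (exp (- (norm (transpose P *v u))\<^sup>2 / 2))"
proof -
  have QP: "Q ** P = mat 1" using PQ matrix_left_right_inverse by blast
  have dets: "det P * det Q = 1" using PQ by (metis det_I det_mul)
  then have nz: "det P \<noteq> 0" "det Q \<noteq> 0" by auto
  let ?s = "\<lambda>x::real^'n::{finite, wellorder}. \<Prod>b\<in>Basis. std_normal_density (x \<bullet> b)"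
  have s: "?s z = exp (- (z \<bullet> z) / 2) / sqrt ((2 * pi) ^ CARD('n))" for z
  proof -
    have "?s z = (1 / sqrt (2 * pi)) ^ CARD('n) * exp (\<Sum>b\<in>Basis. - (z \<bullet> b)\<^sup>2 / 2)"
      unfolding std_normal_density_def prod.distrib exp_sum[OF finite_Basis] by simp
    also have "(\<Sum>b\<in>Basis. - (z \<bullet> b)\<^sup>2 / 2) = - (z \<bullet> z) / 2"
      unfolding euclidean_inner[of z z]
      by (simp add: sum_divide_distrib[symmetric] sum_negf power2_eq_square)
    also have "(1 / sqrt (2 * pi)) ^ CARD('n) = 1 / sqrt ((2 * pi) ^ CARD('n))"
      by (simp only: real_sqrt_power power_divide power_one)
    finally show ?thesis by simp
  qed
  \<comment> \<open>The normal density is the standard one pulled back along \<open>Q\<close>: the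
    quadratic form in the exponent is \<open>(norm (Q *v x))^2\<close>, and the determinant supplies
    the Jacobian \<open>\<bar>det Q\<bar>\<close>.\<close>
  have dens: "exp (- ((x - 0) \<bullet> (matrix_inv V *v (x - 0))) / 2) / sqrt ((2 * pi) ^ CARD('n) * det V)
      = \<bar>det Q\<bar> * ?s (Q *v x)" for x
  proof -
    have "x \<bullet> (matrix_inv V *v x) = (Q *v x) \<bullet> (Q *v x)"
    proof -
      have "x \<bullet> (matrix_inv V *v x) = x \<bullet> ((Q *v x) v* Q)"
        by (simp only: V(1) matrix_vector_mul_assoc[symmetric] transpose_matrix_vector)
      also have "\<dots> = ((Q *v x) v* Q) \<bullet> x" by (rule inner_commute)
      also have "\<dots> = (Q *v x) \<bullet> (Q *v x)" by (rule dot_lmul_matrix)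
      finally show ?thesis .
    qed
    moreover have "sqrt ((2 * pi) ^ CARD('n) * det V) = sqrt ((2 * pi) ^ CARD('n)) / \<bar>det Q\<bar>"
      by (simp add: V(2) real_sqrt_divide)
    ultimately show ?thesis by (simp add: s)
  qed
  have contQ: "(*v) Q \<in> borel_measurable borel" and contP[measurable]: "(*v) P \<in> borel_measurable borel"
    by (intro borel_measurable_continuous_onI linear_continuous_on linear_linear[THEN iffD2] matrix_vector_mul_linear)+
  have [measurable]: "(\<lambda>x. ?s (Q *v x)) \<in> borel_measurable borel"
    by (rule measurable_compose[OF contQ]) measurable
  have [measurable]: "(\<lambda>x. cis (u \<bullet> x)) \<in> borel_measurable borel"
    by (intro borel_measurable_continuous_onI continuous_intros)
  have snn: "0 \<le> ?s x" for x by (intro prod_nonneg) simp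
  have "(\<integral>x. cis (u \<bullet> x) \<partial>multivariate_normal 0 V) = (\<integral>x. (\<bar>det Q\<bar> * ?s (Q *v x)) *\<^sub>R cis (u \<bullet> x) \<partial>lborel)"
    unfolding multivariate_normal_def dens by (intro integral_density) (use snn in auto)
  \<comment> \<open>Substituting \<open>P *v x\<close> for \<open>x\<close> undoes \<open>Q\<close>;
    the Jacobians cancel since \<open>det P * det Q = 1\<close>, and \<open>P\<close> moves over to
    \<open>u\<close> as a transpose.\<close>
  also have "\<dots> = \<bar>det P\<bar> *\<^sub>R (\<integral>x. (\<bar>det Q\<bar> * ?s (Q *v (P *v x))) *\<^sub>R cis (u \<bullet> (P *v x)) \<partial>lborel)"
    by (subst lborel_linear_image[OF nz(1)], subst integral_density, simp, simp, simp,
        subst integral_distr, simp, simp, rule Bochner_Integration.integral_scaleR_right)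
  also have "\<dots> = (\<bar>det P\<bar> * \<bar>det Q\<bar>) *\<^sub>R (\<integral>x. of_real (?s x) * cis ((transpose P *v u) \<bullet> x) \<partial>lborel)"
  proof -
    have "u \<bullet> (P *v x) = (transpose P *v u) \<bullet> x" for x
      unfolding transpose_matrix_vector by (rule dot_lmul_matrix[symmetric])
    moreover have "Q *v (P *v x) = x" for x by (simp add: matrix_vector_mul_assoc QP)
    ultimately show ?thesis by (simp add: scaleR_conv_of_real mult.assoc)
  qed
  also have "\<dots> = of_real (exp (- (norm (transpose P *v u))\<^sup>2 / 2))"
    using dets by (simp add: abs_mult[symmetric] std_normal_char_integral_Basis del: of_real_prod)
  finally show ?thesis .
qed

text \<open>The total mass is the characteristic function at \<open>u = 0\<close>. It is read off as
  a \<open>measure\<close>, and \<open>emeasure\<close> follows because an infinite mass would have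
  \<open>measure\<close> zero.\<close>

lemma prob_space_multivariate_normal:
  fixes V Q P :: "real ^ 'n::{finite, wellorder} ^ 'n::_"
  assumes V: "matrix_inv V = transpose Q ** Q" "det V = 1 / (det Q)\<^sup>2" and PQ: "P ** Q = mat 1"
  shows "prob_space (multivariate_normal 0 V)"
proof -
  let ?N = "multivariate_normal 0 V"
  have "(\<integral>x. 1 \<partial>?N) = (1 :: complex)"
    using multivariate_normal_char[OF assms, of 0] by simp
  then have "measure ?N (space ?N) = 1"
    by (simp add: scaleR_conv_of_real)
  then have "emeasure ?N (space ?N) = 1"
    by (cases "emeasure ?N (space ?N)" rule: ennreal_cases) (auto simp: measure_def)
  then show ?thesis by (rule prob_spaceI)
qed

lemma multivariate_normal_cos:
  fixes V Q P :: "real ^ 'n::{finite, wellorder} ^ 'n::_"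
  assumes V: "matrix_inv V = transpose Q ** Q" "det V = 1 / (det Q)\<^sup>2" and PQ: "P ** Q = mat 1"
  shows "(\<integral>x. cos (u \<bullet> x + b) \<partial>multivariate_normal 0 V) = cos b * exp (- (norm (transpose P *v u))\<^sup>2 / 2)"
proof -
  let ?N = "multivariate_normal 0 V"
  interpret prob_space ?N by (rule prob_space_multivariate_normal) fact+
  have meas: "(\<lambda>x. cis (u \<bullet> x)) \<in> borel_measurable ?N"
    unfolding multivariate_normal_def measurable_cong_sets[OF sets_density refl] measurable_lborel2 measurable_lborel1
    by (intro borel_measurable_continuous_onI continuous_intros)
  have "cos (u \<bullet> x + b) = Re (cis b * cis (u \<bullet> x))" for x by (simp add: cis_mult add.commute)
  then have "(\<integral>x. cos (u \<bullet> x + b) \<partial>?N) = Re (\<integral>x. cis b * cis (u \<bullet> x) \<partial>?N)"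
    using meas by (simp only:) (intro integral_Re integrable_const_bound[where B = 1], auto simp: norm_mult)
  also have "\<dots> = cos b * exp (- (norm (transpose P *v u))\<^sup>2 / 2)"
    using multivariate_normal_char[OF assms, of u] by simp
  finally show ?thesis .
qed

section \<open>Least absolute deviations under median-zero noise\<close>

lemma abs_cos_diff_le: "\<bar>cos x - cos y\<bar> \<le> \<bar>x - y :: real\<bar>"
proof -
  have "\<bar>cos x - cos y\<bar> = 2 * (\<bar>sin ((x + y) / 2)\<bar> * \<bar>sin ((y - x) / 2)\<bar>)"
    by (simp add: cos_diff_cos abs_mult)
  also have "\<dots> \<le> 2 * (1 * \<bar>(y - x) / 2\<bar>)"
    by (intro mult_left_mono mult_mono abs_sin_x_le_abs_x) auto
  finally show ?thesis by simp
qed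

lemma abs_sin_diff_le: "\<bar>sin x - sin y\<bar> \<le> \<bar>x - y :: real\<bar>"
  using abs_cos_diff_le[of "pi / 2 - x" "pi / 2 - y"] by (simp add: cos_diff)

text \<open>Chebyshev with the variance of a sum of independent variables, in which the mixed
  products of centred terms vanish. The bound is in terms of second moments, as these can be
  estimated from the small support of the summands; a bound through \<open>B\<close> would lose the
  powers of the radius.\<close>

lemma (in prob_space) indep_sum_deviation:
  fixes Y :: "'i \<Rightarrow> 'a \<Rightarrow> real"
  assumes "finite I" and indep: "indep_vars (\<lambda>_. borel) Y I"
    and bd: "\<And>p \<omega>. p \<in> I \<Longrightarrow> \<bar>Y p \<omega>\<bar> \<le> B" and "0 < a"
  shows "prob {\<omega> \<in> space M. a \<le> \<bar>(\<Sum>p\<in>I. Y p \<omega>) - (\<Sum>p\<in>I. expectation (Y p))\<bar>}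
    \<le> (\<Sum>p\<in>I. expectation (\<lambda>\<omega>. (Y p \<omega>)\<^sup>2)) / a\<^sup>2"
proof -
  have Y[measurable]: "Y p \<in> borel_measurable M" if "p \<in> I" for p
    using indep that by (auto simp: indep_vars_def)
  define Z where "Z = (\<lambda>p \<omega>. Y p \<omega> - expectation (Y p))"
  have intY: "integrable M (Y p)" if "p \<in> I" for p
    using that bd by (intro integrable_const_bound[where B = B]) auto
  have absE: "\<bar>expectation (Y p)\<bar> \<le> B" if "p \<in> I" for p
  proof -
    have "\<bar>expectation (Y p)\<bar> \<le> expectation (\<lambda>\<omega>. \<bar>Y p \<omega>\<bar>)" by (rule integral_abs_bound)
    also have "\<dots> \<le> expectation (\<lambda>_. B)"
      using that bd intY by (intro integral_mono) auto
    finally show ?thesis by (simp add: prob_space)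
  qed
  have Zm[measurable]: "Z p \<in> borel_measurable M" if "p \<in> I" for p
    using that by (simp add: Z_def)
  have bdZ: "\<bar>Z p \<omega>\<bar> \<le> 2 * B" if "p \<in> I" for p \<omega>
    using bd[OF that, of \<omega>] absE[OF that] unfolding Z_def by linarith
  have intZ: "integrable M (Z p)" if "p \<in> I" for p
    using that bdZ by (intro integrable_const_bound[where B = "2 * B"]) auto
  have EZ: "expectation (Z p) = 0" if "p \<in> I" for p
    using intY[OF that] by (simp add: Z_def prob_space)
  have bdZZ: "\<bar>Z p \<omega> * Z q \<omega>\<bar> \<le> (2 * B) * (2 * B)" if "p \<in> I" "q \<in> I" for p q \<omega>
    unfolding abs_mult using bdZ[OF that(1), of \<omega>] bdZ[OF that(2), of \<omega>] by (intro mult_mono) auto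
  have intZZ: "integrable M (\<lambda>\<omega>. Z p \<omega> * Z q \<omega>)" if "p \<in> I" "q \<in> I" for p q
    using that bdZZ by (intro integrable_const_bound[where B = "(2 * B) * (2 * B)"]) auto
  have indepZ: "indep_vars (\<lambda>_. borel) Z I"
    unfolding Z_def by (rule indep_vars_compose2[OF indep]) measurable
  have EZZ: "expectation (\<lambda>\<omega>. Z p \<omega> * Z q \<omega>) = 0" if "p \<in> I" "q \<in> I" "p \<noteq> q" for p q
  proof -
    have "expectation (\<lambda>\<omega>. \<Prod>i\<in>{p, q}. Z i \<omega>) = (\<Prod>i\<in>{p, q}. expectation (Z i))"
      using that intZ by (intro indep_vars_lebesgue_integral indep_vars_subset[OF indepZ]) auto
    then show ?thesis using that EZ by simp
  qed
  have sq: "(\<Sum>p\<in>I. Z p \<omega>)\<^sup>2 = (\<Sum>p\<in>I. \<Sum>q\<in>I. Z p \<omega> * Z q \<omega>)" for \<omega>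
    by (simp add: power2_eq_square sum_product)
  have "expectation (\<lambda>\<omega>. (\<Sum>p\<in>I. Z p \<omega>)\<^sup>2) = (\<Sum>p\<in>I. \<Sum>q\<in>I. expectation (\<lambda>\<omega>. Z p \<omega> * Z q \<omega>))"
    unfolding sq using intZZ by simp
  also have "\<dots> = (\<Sum>p\<in>I. \<Sum>q\<in>I. if q = p then expectation (\<lambda>\<omega>. Z p \<omega> * Z p \<omega>) else 0)"
    using EZZ by (intro sum.cong) auto
  also have "\<dots> = (\<Sum>p\<in>I. expectation (\<lambda>\<omega>. Z p \<omega> * Z p \<omega>))"
    using \<open>finite I\<close> by simp
  also have "\<dots> \<le> (\<Sum>p\<in>I. expectation (\<lambda>\<omega>. (Y p \<omega>)\<^sup>2))"
  proof (rule sum_mono)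
    fix p assume p: "p \<in> I"
    have sqY: "integrable M (\<lambda>\<omega>. (Y p \<omega>)\<^sup>2)"
      using p bd[OF p] by (intro integrable_const_bound[where B = "B\<^sup>2"])
        (auto simp: power2_le_iff_abs_le order_trans[OF abs_ge_zero bd[OF p]] intro!: AE_I2 power2_le_iff_abs_le[THEN iffD2])
    have "expectation (\<lambda>\<omega>. Z p \<omega> * Z p \<omega>) = variance (Y p)"
      by (simp add: Z_def power2_eq_square)
    also have "\<dots> = expectation (\<lambda>\<omega>. (Y p \<omega>)\<^sup>2) - (expectation (Y p))\<^sup>2"
      using p intY sqY by (intro variance_eq) auto
    finally show "expectation (\<lambda>\<omega>. Z p \<omega> * Z p \<omega>) \<le> expectation (\<lambda>\<omega>. (Y p \<omega>)\<^sup>2)" by simp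
  qed
  finally have var: "expectation (\<lambda>\<omega>. (\<Sum>p\<in>I. Z p \<omega>)\<^sup>2) \<le> (\<Sum>p\<in>I. expectation (\<lambda>\<omega>. (Y p \<omega>)\<^sup>2))" .
  have ES: "expectation (\<lambda>\<omega>. \<Sum>p\<in>I. Z p \<omega>) = 0"
    using intZ EZ by simp
  have "prob {\<omega> \<in> space M. a \<le> \<bar>(\<Sum>p\<in>I. Z p \<omega>) - expectation (\<lambda>\<omega>. \<Sum>p\<in>I. Z p \<omega>)\<bar>}
    \<le> expectation (\<lambda>\<omega>. ((\<Sum>p\<in>I. Z p \<omega>) - expectation (\<lambda>\<omega>. \<Sum>p\<in>I. Z p \<omega>))\<^sup>2) / a\<^sup>2"
    using \<open>0 < a\<close> intZZ by (intro Chebyshev_inequality) (auto simp: sq)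
  also have "\<dots> \<le> (\<Sum>p\<in>I. expectation (\<lambda>\<omega>. (Y p \<omega>)\<^sup>2)) / a\<^sup>2"
    unfolding ES using var by (simp add: divide_right_mono)
  finally show ?thesis unfolding ES by (simp add: Z_def sum_subtractf)
qed

text \<open>The gap between \<open>\<bar>e - h\<bar>\<close> and its tangent at
  \<open>h = 0\<close>: it equals \<open>2 * (\<bar>h\<bar> - \<bar>e\<bar>)\<close> when
  \<open>e\<close> lies strictly between \<open>0\<close> and \<open>h\<close>,
  \<open>\<bar>h\<bar>\<close> at \<open>e = 0\<close>, and \<open>0\<close> otherwise.\<close>

definition lad_excess :: "real \<Rightarrow> real \<Rightarrow> real"
  where "lad_excess e h = \<bar>e - h\<bar> - \<bar>e\<bar> + h * sgn e"

lemma lad_excess_nonneg: "0 \<le> lad_excess e h"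
  by (auto simp: lad_excess_def abs_if sgn_if)

lemma lad_excess_le: "lad_excess e h \<le> 2 * \<bar>h\<bar>"
  by (auto simp: lad_excess_def abs_if sgn_if)

lemma lad_excess_lipschitz: "\<bar>lad_excess e h - lad_excess e h'\<bar> \<le> 2 * \<bar>h - h'\<bar>"
  by (auto simp: lad_excess_def abs_if sgn_if)

text \<open>The kink at \<open>h = e\<close> is not passed, so the tangent is exact. This confines
  the excess to noise no larger than the increment, the source of the cubic bounds below.\<close>

lemma lad_excess_eq_0: "\<bar>h\<bar> \<le> \<bar>e\<bar> \<Longrightarrow> lad_excess e h = 0"
  by (auto simp: lad_excess_def abs_if sgn_if split: if_splits)

text \<open>An instance of convexity in \<open>h\<close> with minimum \<open>0\<close> at
  \<open>0\<close>; it later extends the quadratic lower bound for the mean criterion from small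
  increments to bounded ones.\<close>

lemma lad_excess_mono:
  assumes "0 \<le> h \<and> h \<le> h' \<or> h' \<le> h \<and> h \<le> 0"
  shows "lad_excess e h \<le> lad_excess e h'"
  using assms by (auto simp: lad_excess_def abs_if sgn_if split: if_splits)

lemma lad_excess_measurable[measurable]: "(\<lambda>e. lad_excess e h) \<in> borel_measurable borel"
  unfolding lad_excess_def by measurable

text \<open>What is retained of the noise. In the application \<open>\<gamma>\<close> is the density
  at the median: the mean excess is about \<open>\<gamma> * h^2\<close> since a triangle of height
  \<open>2 * \<bar>h\<bar>\<close> over the interval from \<open>0\<close> to \<open>h\<close> has
  area \<open>h^2\<close>, and a Lipschitz density gives the cubic error.\<close>

locale median_noise = prob_space M for M :: "'a measure" +
  fixes eps :: "'p \<Rightarrow> 'a \<Rightarrow> real" and J :: "'p set" and C \<gamma> :: real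
  assumes indep: "indep_vars (\<lambda>_. borel) eps J"
    and sgn_mean: "p \<in> J \<Longrightarrow> expectation (\<lambda>\<omega>. sgn (eps p \<omega>)) = 0"
    and nonzero: "p \<in> J \<Longrightarrow> AE \<omega> in M. eps p \<omega> \<noteq> 0"
    and small_ball: "p \<in> J \<Longrightarrow> 0 \<le> x \<Longrightarrow> prob {\<omega> \<in> space M. \<bar>eps p \<omega>\<bar> \<le> x} \<le> C * x"
    and curvature: "p \<in> J \<Longrightarrow>
      \<bar>expectation (\<lambda>\<omega>. lad_excess (eps p \<omega>) h) - \<gamma> * h\<^sup>2\<bar> \<le> C * \<bar>h\<bar> ^ 3"
    and C_pos: "0 < C" and \<gamma>_pos: "0 < \<gamma>"
begin

lemma eps_measurable[measurable]: "p \<in> J \<Longrightarrow> eps p \<in> borel_measurable M"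
  using indep by (auto simp: indep_vars_def)

lemma integrable_lad_excess: "p \<in> J \<Longrightarrow> integrable M (\<lambda>\<omega>. lad_excess (eps p \<omega>) h)"
  using lad_excess_le lad_excess_nonneg
  by (intro integrable_const_bound[where B = "2 * \<bar>h\<bar>"]) (auto intro: measurable_compose[OF eps_measurable])

lemma integrable_sgn: "p \<in> J \<Longrightarrow> integrable M (\<lambda>\<omega>. sgn (eps p \<omega>))"
  by (intro integrable_const_bound[where B = 1]) (auto simp: sgn_if)

text \<open>The excess is at most \<open>2 * \<bar>h\<bar>\<close> and vanishes unless
  \<open>\<bar>eps p\<bar> \<le> \<bar>h\<bar>\<close>, an event of probability at most
  \<open>C * \<bar>h\<bar>\<close>: two powers come from the size, one from the support.\<close>

lemma lad_excess_square_mean: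
  assumes p: "p \<in> J"
  shows "expectation (\<lambda>\<omega>. (lad_excess (eps p \<omega>) h)\<^sup>2) \<le> 4 * C * \<bar>h\<bar> ^ 3"
proof -
  let ?Z = "{\<omega> \<in> space M. \<bar>eps p \<omega>\<bar> \<le> \<bar>h\<bar>}"
  have Z[measurable]: "?Z \<in> events" using p by measurable
  have sq: "(lad_excess e h)\<^sup>2 \<le> 4 * h\<^sup>2" for e
    using power_mono[OF lad_excess_le lad_excess_nonneg, of e h 2] by (simp add: power_mult_distrib)
  have "expectation (\<lambda>\<omega>. (lad_excess (eps p \<omega>) h)\<^sup>2) \<le> expectation (\<lambda>\<omega>. 4 * h\<^sup>2 * indicator ?Z \<omega>)"
  proof (rule integral_mono)
    show "integrable M (\<lambda>\<omega>. (lad_excess (eps p \<omega>) h)\<^sup>2)"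
      using sq p by (intro integrable_const_bound[where B = "4 * h\<^sup>2"])
        (auto intro!: borel_measurable_power measurable_compose[OF eps_measurable])
    show "integrable M (\<lambda>\<omega>. 4 * h\<^sup>2 * indicator ?Z \<omega>)"
      by (intro integrable_mult_right integrable_const_bound[where B = 1]) auto
    show "(lad_excess (eps p \<omega>) h)\<^sup>2 \<le> 4 * h\<^sup>2 * indicator ?Z \<omega>" if "\<omega> \<in> space M" for \<omega>
      using that sq lad_excess_eq_0[of h "eps p \<omega>"] by (auto simp: indicator_def)
  qed
  also have "\<dots> = 4 * h\<^sup>2 * prob ?Z"
    by (simp add: Int_absorb2 sets.sets_into_space[OF Z])
  also have "\<dots> \<le> 4 * h\<^sup>2 * (C * \<bar>h\<bar>)"
    using small_ball[OF p, of "\<bar>h\<bar>"] by (intro mult_left_mono) auto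
  also have "\<dots> = 4 * C * \<bar>h\<bar> ^ 3" by (simp add: power3_eq_cube power2_eq_square)
  finally show ?thesis .
qed

end

text \<open>Here \<open>h p w\<close> is the increment of the regression function at design point \<open>p\<close> for the
  parameter increment \<open>w\<close>, and \<open>d p\<close> is its gradient at \<open>0\<close>.\<close>

definition smooth_design :: "real \<Rightarrow> 'p set \<Rightarrow> ('p \<Rightarrow> 'b::euclidean_space) \<Rightarrow> ('p \<Rightarrow> 'b \<Rightarrow> real) \<Rightarrow> bool"
  where "smooth_design H I d h \<longleftrightarrow> (\<forall>p\<in>I. norm (d p) \<le> H \<and> h p 0 = 0 \<and>
    (\<forall>r w w'. r \<le> 1 \<longrightarrow> norm w \<le> r \<longrightarrow> norm w' \<le> r \<longrightarrow>
      \<bar>h p w - h p w' - d p \<bullet> (w - w')\<bar> \<le> H * r * norm (w - w')))"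

context
  fixes H :: real and I :: "'p set" and d :: "'p \<Rightarrow> 'b::euclidean_space" and h
  assumes sd: "smooth_design H I d h" and H: "1 \<le> H"
begin

lemma smooth_designD:
  assumes p: "p \<in> I"
  shows "norm (d p) \<le> H" "h p 0 = 0"
    "r \<le> 1 \<Longrightarrow> norm w \<le> r \<Longrightarrow> norm w' \<le> r \<Longrightarrow> \<bar>h p w - h p w' - d p \<bullet> (w - w')\<bar> \<le> H * r * norm (w - w')"
    "\<bar>d p \<bullet> w\<bar> \<le> H * norm w"
    "r \<le> 1 \<Longrightarrow> norm w \<le> r \<Longrightarrow> norm w' \<le> r \<Longrightarrow> \<bar>h p w - h p w'\<bar> \<le> 2 * H * norm (w - w')"
    "norm w \<le> 1 \<Longrightarrow> \<bar>h p w\<bar> \<le> 2 * H * norm w"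
    "norm w \<le> 1 \<Longrightarrow> \<bar>h p w - d p \<bullet> w\<bar> \<le> H * (norm w)\<^sup>2"
proof -
  show 1: "norm (d p) \<le> H" and 2: "h p 0 = 0" using sd p unfolding smooth_design_def by blast+
  have 3: "\<bar>h p w - h p w' - d p \<bullet> (w - w')\<bar> \<le> H * r * norm (w - w')"
    if "r \<le> 1" "norm w \<le> r" "norm w' \<le> r" for r w w'
    using sd p that unfolding smooth_design_def by blast
  then show "\<bar>h p w - h p w' - d p \<bullet> (w - w')\<bar> \<le> H * r * norm (w - w')"
    if "r \<le> 1" "norm w \<le> r" "norm w' \<le> r" using that by blast
  have 4: "\<bar>d p \<bullet> w\<bar> \<le> H * norm w" for w
    using Cauchy_Schwarz_ineq2[of "d p" w] mult_right_mono[OF 1, of "norm w"] by simp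
  then show "\<bar>d p \<bullet> w\<bar> \<le> H * norm w" .
  have 5: "\<bar>h p w - h p w'\<bar> \<le> 2 * H * norm (w - w')" if "r \<le> 1" "norm w \<le> r" "norm w' \<le> r" for r w w'
  proof -
    have "H * r * norm (w - w') \<le> H * 1 * norm (w - w')"
      using that H by (intro mult_right_mono mult_left_mono) auto
    then show ?thesis using 3[OF that] 4[of "w - w'"] by linarith
  qed
  then show "\<bar>h p w - h p w'\<bar> \<le> 2 * H * norm (w - w')" if "r \<le> 1" "norm w \<le> r" "norm w' \<le> r"
    using that by blast
  show "\<bar>h p w\<bar> \<le> 2 * H * norm w" if "norm w \<le> 1"
    using 5[of 1 w 0] that 2 by simp
  show "\<bar>h p w - d p \<bullet> w\<bar> \<le> H * (norm w)\<^sup>2" if "norm w \<le> 1"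
    using 3[of "norm w" w 0] that 2 by (simp add: power2_eq_square mult.assoc)
qed

end

context median_noise
begin

text \<open>What is left of the criterion once the linear form in the gradient \<open>d p\<close> is
  taken out: the excess of the absolute value, minus the nonlinearity of the regression function
  times the sign. The second part is centred and of size \<open>O((norm w)^2)\<close>, so it affects
  only the fluctuation.\<close>

definition lad_remainder :: "('p \<Rightarrow> 'b::euclidean_space) \<Rightarrow> ('p \<Rightarrow> 'b \<Rightarrow> real) \<Rightarrow> 'p \<Rightarrow> 'b \<Rightarrow> 'a \<Rightarrow> real"
  where "lad_remainder d h p w \<omega> = lad_excess (eps p \<omega>) (h p w) - (h p w - d p \<bullet> w) * sgn (eps p \<omega>)"

lemma lad_decomposition:
  "(\<Sum>p\<in>I. \<bar>eps p \<omega> - h p w\<bar> - \<bar>eps p \<omega>\<bar>)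
    = (\<Sum>p\<in>I. lad_remainder d h p w \<omega>) - (\<Sum>p\<in>I. sgn (eps p \<omega>) *\<^sub>R d p) \<bullet> w"
  by (simp add: lad_remainder_def lad_excess_def inner_sum_left sum_subtractf[symmetric] algebra_simps)

context
  fixes H :: real and I :: "'p set" and d :: "'p \<Rightarrow> 'b::euclidean_space" and h
  assumes sd: "smooth_design H I d h" and H: "1 \<le> H" and IJ: "I \<subseteq> J" and fin: "finite I"
begin

lemma lad_remainder_measurable[measurable]: "p \<in> I \<Longrightarrow> lad_remainder d h p w \<in> borel_measurable M"
  unfolding lad_remainder_def using IJ
  by (intro borel_measurable_diff borel_measurable_times borel_measurable_const measurable_compose[OF eps_measurable]) auto

lemma lad_remainder_bound:
  "p \<in> I \<Longrightarrow> norm w \<le> 1 \<Longrightarrow> \<bar>lad_remainder d h p w \<omega>\<bar> \<le> 5 * H"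
proof -
  assume p: "p \<in> I" and w: "norm w \<le> 1"
  note D = smooth_designD[OF sd H p]
  have a: "\<bar>h p w\<bar> \<le> 2 * H" using order_trans[OF D(6)[OF w] mult_left_mono[OF w, of "2 * H"]] H by simp
  have "(norm w)\<^sup>2 \<le> 1" using w by (simp add: power_le_one)
  then have "H * (norm w)\<^sup>2 \<le> H * 1" using H by (intro mult_left_mono) auto
  then have b: "\<bar>h p w - d p \<bullet> w\<bar> \<le> H" using D(7)[OF w] by simp
  have "\<bar>(h p w - d p \<bullet> w) * sgn (eps p \<omega>)\<bar> \<le> H * 1"
    unfolding abs_mult using b H by (intro mult_mono) (auto simp: sgn_if)
  then show ?thesis
    using a lad_excess_le[of "eps p \<omega>" "h p w"] lad_excess_nonneg[of "eps p \<omega>" "h p w"]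
    unfolding lad_remainder_def by linarith
qed

text \<open>The sign part has mean zero, so only the mean excess at \<open>h p w\<close> remains.
  Its curvature error contributes \<open>8 * C * H^3\<close> through
  \<open>\<bar>h p w\<bar> \<le> 2 * H * r\<close>; exchanging \<open>h p w\<close> for
  \<open>d p \<bullet> w\<close> in the square contributes \<open>3 * \<gamma> * H^2\<close>, from a
  difference \<open>H * r^2\<close> times a sum \<open>3 * H * r\<close>.\<close>

lemma lad_remainder_mean:
  assumes p: "p \<in> I" and w: "norm w \<le> r" and r: "r \<le> 1"
  shows "\<bar>expectation (lad_remainder d h p w) - \<gamma> * (d p \<bullet> w)\<^sup>2\<bar> \<le> (8 * C * H ^ 3 + 3 * \<gamma> * H\<^sup>2) * r ^ 3"
proof -
  have pJ: "p \<in> J" using p IJ by blast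
  note D = smooth_designD[OF sd H p]
  have w1: "norm w \<le> 1" using w r by simp
  have E: "expectation (lad_remainder d h p w) = expectation (\<lambda>\<omega>. lad_excess (eps p \<omega>) (h p w))"
    unfolding lad_remainder_def using integrable_lad_excess[OF pJ] integrable_sgn[OF pJ] sgn_mean[OF pJ] by simp
  have hr: "\<bar>h p w\<bar> \<le> 2 * H * r" using order_trans[OF D(6)[OF w1] mult_left_mono[OF w, of "2 * H"]] H by simp
  have dr: "\<bar>d p \<bullet> w\<bar> \<le> H * r" using order_trans[OF D(4) mult_left_mono[OF w, of H]] H by simp
  have r0: "0 \<le> r" using w norm_ge_zero order_trans by blast
  have "\<bar>h p w\<bar> ^ 3 \<le> (2 * H * r) ^ 3" using hr by (intro power_mono) auto
  then have 1: "C * \<bar>h p w\<bar> ^ 3 \<le> 8 * C * H ^ 3 * r ^ 3"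
    using C_pos mult_left_mono[of "\<bar>h p w\<bar> ^ 3" "(2 * H * r) ^ 3" C] by (simp add: power_mult_distrib)
  have "H * (norm w)\<^sup>2 \<le> H * r\<^sup>2" using w H by (intro mult_left_mono power_mono) auto
  then have a: "\<bar>h p w - d p \<bullet> w\<bar> \<le> H * r\<^sup>2" using D(7)[OF w1] by simp
  have b: "\<bar>h p w + d p \<bullet> w\<bar> \<le> 3 * H * r" using hr dr by linarith
  have "\<bar>(h p w)\<^sup>2 - (d p \<bullet> w)\<^sup>2\<bar> = \<bar>h p w - d p \<bullet> w\<bar> * \<bar>h p w + d p \<bullet> w\<bar>"
    by (simp add: abs_mult[symmetric] power2_eq_square algebra_simps)
  also have "\<dots> \<le> (H * r\<^sup>2) * (3 * H * r)" using a b H r0 by (intro mult_mono) auto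
  also have "\<dots> = 3 * H\<^sup>2 * r ^ 3" by (simp add: power2_eq_square power3_eq_cube)
  finally have 2: "\<gamma> * \<bar>(h p w)\<^sup>2 - (d p \<bullet> w)\<^sup>2\<bar> \<le> 3 * \<gamma> * H\<^sup>2 * r ^ 3"
    using \<gamma>_pos mult_left_mono[of "\<bar>(h p w)\<^sup>2 - (d p \<bullet> w)\<^sup>2\<bar>" "3 * H\<^sup>2 * r ^ 3" \<gamma>] by (simp add: mult_ac)
  have "\<bar>\<gamma> * (h p w)\<^sup>2 - \<gamma> * (d p \<bullet> w)\<^sup>2\<bar> \<le> 3 * \<gamma> * H\<^sup>2 * r ^ 3"
    using 2 \<gamma>_pos by (simp add: abs_mult right_diff_distrib[symmetric])
  then show ?thesis
    unfolding E using curvature[OF pJ, of "h p w"] 1 by (simp add: algebra_simps)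
qed

text \<open>The excess supplies the order \<open>r^3\<close>; the sign part is squared to
  \<open>r^4\<close>, which is absorbed because \<open>r \<le> 1\<close>. The factor
  \<open>64\<close> is \<open>2 * 4 * 2^3\<close>: the square of a difference, the second moment of
  the excess, the bound \<open>2 * H * r\<close> for the increment.\<close>

lemma lad_remainder_square_mean:
  assumes p: "p \<in> I" and w: "norm w \<le> r" and r: "r \<le> 1"
  shows "expectation (\<lambda>\<omega>. (lad_remainder d h p w \<omega>)\<^sup>2) \<le> (64 * C * H ^ 3 + 2 * H\<^sup>2) * r ^ 3"
proof -
  have pJ: "p \<in> J" using p IJ by blast
  note D = smooth_designD[OF sd H p]
  have w1: "norm w \<le> 1" using w r by simp
  have r0: "0 \<le> r" using w norm_ge_zero order_trans by blast
  have hr: "\<bar>h p w\<bar> \<le> 2 * H * r" using order_trans[OF D(6)[OF w1] mult_left_mono[OF w, of "2 * H"]] H by simp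
  have "\<bar>h p w\<bar> ^ 3 \<le> (2 * H * r) ^ 3" using hr by (intro power_mono) auto
  then have 1: "8 * C * \<bar>h p w\<bar> ^ 3 \<le> 64 * C * H ^ 3 * r ^ 3"
    using C_pos mult_left_mono[of "\<bar>h p w\<bar> ^ 3" "(2 * H * r) ^ 3" C] by (simp add: power_mult_distrib)
  have "\<bar>h p w - d p \<bullet> w\<bar> \<le> H * (norm w)\<^sup>2" by (rule D(7)[OF w1])
  also have "\<dots> \<le> H * r\<^sup>2" using w H by (intro mult_left_mono power_mono) auto
  finally have "(h p w - d p \<bullet> w)\<^sup>2 \<le> (H * r\<^sup>2)\<^sup>2"
    using power_mono[of "\<bar>h p w - d p \<bullet> w\<bar>" "H * r\<^sup>2" 2] by simp
  also have "\<dots> = H\<^sup>2 * r ^ 4" by (simp add: power_mult_distrib)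
  also have "\<dots> \<le> H\<^sup>2 * r ^ 3" using r r0 by (intro mult_left_mono power_decreasing) auto
  finally have 2: "2 * (h p w - d p \<bullet> w)\<^sup>2 \<le> 2 * H\<^sup>2 * r ^ 3" by simp
  have sq: "integrable M (\<lambda>\<omega>. (lad_excess (eps p \<omega>) (h p w))\<^sup>2)"
  proof (rule integrable_const_bound[where B = "(2 * \<bar>h p w\<bar>)\<^sup>2"])
    show "AE \<omega> in M. norm ((lad_excess (eps p \<omega>) (h p w))\<^sup>2) \<le> (2 * \<bar>h p w\<bar>)\<^sup>2"
      using power_mono[OF lad_excess_le lad_excess_nonneg, where n = 2] by (intro AE_I2) simp
  qed (intro borel_measurable_power measurable_compose[OF eps_measurable[OF pJ]] lad_excess_measurable)
  have "expectation (\<lambda>\<omega>. (lad_remainder d h p w \<omega>)\<^sup>2)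
    \<le> expectation (\<lambda>\<omega>. 2 * (lad_excess (eps p \<omega>) (h p w))\<^sup>2 + 2 * (h p w - d p \<bullet> w)\<^sup>2)"
  proof (rule integral_mono)
    show "integrable M (\<lambda>\<omega>. (lad_remainder d h p w \<omega>)\<^sup>2)"
    proof (rule integrable_const_bound[where B = "(5 * H)\<^sup>2"])
      show "AE \<omega> in M. norm ((lad_remainder d h p w \<omega>)\<^sup>2) \<le> (5 * H)\<^sup>2"
        using power_mono[OF lad_remainder_bound[OF p w1] abs_ge_zero, where n = 2] by (intro AE_I2) simp
    qed (use p in measurable)
    show "integrable M (\<lambda>\<omega>. 2 * (lad_excess (eps p \<omega>) (h p w))\<^sup>2 + 2 * (h p w - d p \<bullet> w)\<^sup>2)"
      using sq by simp
    fix \<omega>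
    have s: "(a - b * c)\<^sup>2 \<le> 2 * a\<^sup>2 + 2 * b\<^sup>2" if "\<bar>c\<bar> \<le> 1" for a b c :: real
    proof -
      have "(a - b * c)\<^sup>2 \<le> 2 * a\<^sup>2 + 2 * (b * c)\<^sup>2"
        using zero_le_power2[of "a + b * c"] by (simp add: power2_eq_square algebra_simps)
      moreover have "(b * c)\<^sup>2 \<le> b\<^sup>2 * 1"
        unfolding power_mult_distrib using that by (intro mult_left_mono) (auto simp: abs_square_le_1)
      ultimately show ?thesis by simp
    qed
    show "(lad_remainder d h p w \<omega>)\<^sup>2 \<le> 2 * (lad_excess (eps p \<omega>) (h p w))\<^sup>2 + 2 * (h p w - d p \<bullet> w)\<^sup>2"
      unfolding lad_remainder_def by (rule s) (simp add: sgn_if)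
  qed
  also have "\<dots> = 2 * expectation (\<lambda>\<omega>. (lad_excess (eps p \<omega>) (h p w))\<^sup>2) + 2 * (h p w - d p \<bullet> w)\<^sup>2"
    using sq by (simp add: prob_space)
  also have "\<dots> \<le> (64 * C * H ^ 3 + 2 * H\<^sup>2) * r ^ 3"
    using lad_excess_square_mean[OF pJ, of "h p w"] 1 2 by (simp add: algebra_simps)
  finally show ?thesis .
qed

lemma lad_remainder_deviation:
  assumes w: "norm w \<le> r" and r: "r \<le> 1" and "0 < a"
  shows "prob {\<omega> \<in> space M. a \<le> \<bar>(\<Sum>p\<in>I. lad_remainder d h p w \<omega>) - (\<Sum>p\<in>I. expectation (lad_remainder d h p w))\<bar>}
    \<le> card I * ((64 * C * H ^ 3 + 2 * H\<^sup>2) * r ^ 3) / a\<^sup>2"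
proof -
  have "indep_vars (\<lambda>_. borel) (\<lambda>p. lad_remainder d h p w) I"
    unfolding lad_remainder_def using IJ
    by (intro indep_vars_compose2[OF indep_vars_subset[OF indep], of I "\<lambda>p e. lad_excess e (h p w) - (h p w - d p \<bullet> w) * sgn e"])
      (auto intro!: borel_measurable_diff)
  then have "prob {\<omega> \<in> space M. a \<le> \<bar>(\<Sum>p\<in>I. lad_remainder d h p w \<omega>) - (\<Sum>p\<in>I. expectation (lad_remainder d h p w))\<bar>}
    \<le> (\<Sum>p\<in>I. expectation (\<lambda>\<omega>. (lad_remainder d h p w \<omega>)\<^sup>2)) / a\<^sup>2"
    using lad_remainder_bound[of _ w] w r \<open>0 < a\<close> fin by (intro indep_sum_deviation[where B = "5 * H"]) auto
  also have "(\<Sum>p\<in>I. expectation (\<lambda>\<omega>. (lad_remainder d h p w \<omega>)\<^sup>2)) \<le> (\<Sum>p\<in>I. (64 * C * H ^ 3 + 2 * H\<^sup>2) * r ^ 3)"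
    using lad_remainder_square_mean w r by (intro sum_mono) auto
  finally show ?thesis by (simp add: divide_right_mono)
qed

text \<open>For noise larger than \<open>2 * H * r\<close> both excesses vanish, so the coarse
  constant \<open>4 * H\<close> is paid only at the few design points with smaller noise; elsewhere
  the modulus is of order \<open>r\<close>, from the varying tangent error of the regression
  function.\<close>

lemma lad_remainder_lipschitz:
  assumes p: "p \<in> I" and w: "norm w \<le> r" "norm w' \<le> r" and r: "r \<le> 1"
  shows "\<bar>lad_remainder d h p w \<omega> - lad_remainder d h p w' \<omega>\<bar>
    \<le> norm (w - w') * (H * r + 4 * H * of_bool (\<bar>eps p \<omega>\<bar> \<le> 2 * H * r))"
proof -
  note D = smooth_designD[OF sd H p]
  have w1: "norm w \<le> 1" "norm w' \<le> 1" using w r by auto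
  have hr: "\<bar>h p w\<bar> \<le> 2 * H * r" "\<bar>h p w'\<bar> \<le> 2 * H * r"
    using order_trans[OF D(6)[OF w1(1)] mult_left_mono[OF w(1), of "2 * H"]]
      order_trans[OF D(6)[OF w1(2)] mult_left_mono[OF w(2), of "2 * H"]] H by simp_all
  have 1: "\<bar>lad_excess (eps p \<omega>) (h p w) - lad_excess (eps p \<omega>) (h p w')\<bar>
    \<le> norm (w - w') * (4 * H * of_bool (\<bar>eps p \<omega>\<bar> \<le> 2 * H * r))"
  proof (cases "\<bar>eps p \<omega>\<bar> \<le> 2 * H * r")
    case True
    then show ?thesis
      using lad_excess_lipschitz[of "eps p \<omega>" "h p w" "h p w'"] D(5)[OF r w] by (simp add: mult_ac)
  next
    case False
    then show ?thesis using hr by (simp add: lad_excess_eq_0)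
  qed
  have "\<bar>(h p w - d p \<bullet> w) - (h p w' - d p \<bullet> w')\<bar> \<le> H * r * norm (w - w')"
    using D(3)[OF r w] by (simp add: inner_diff_right algebra_simps)
  moreover have "\<bar>((h p w - d p \<bullet> w) - (h p w' - d p \<bullet> w')) * sgn (eps p \<omega>)\<bar> \<le> \<bar>(h p w - d p \<bullet> w) - (h p w' - d p \<bullet> w')\<bar> * 1"
    unfolding abs_mult by (intro mult_left_mono) (auto simp: sgn_if)
  ultimately have 2: "\<bar>((h p w - d p \<bullet> w) - (h p w' - d p \<bullet> w')) * sgn (eps p \<omega>)\<bar> \<le> norm (w - w') * (H * r)"
    by (simp add: mult_ac)
  have eq: "lad_remainder d h p w \<omega> - lad_remainder d h p w' \<omega>
    = (lad_excess (eps p \<omega>) (h p w) - lad_excess (eps p \<omega>) (h p w'))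
      - ((h p w - d p \<bullet> w) - (h p w' - d p \<bullet> w')) * sgn (eps p \<omega>)"
    unfolding lad_remainder_def by (simp add: algebra_simps)
  show ?thesis unfolding eq distrib_left using 1 2 by linarith
qed

end

text \<open>The expected count is at most \<open>a = C * x * card I\<close>, and an indicator is its
  own square, so reaching twice that value is a deviation by \<open>a\<close>, of probability at
  most \<open>a / a^2\<close>.\<close>

lemma small_noise_count:
  assumes IJ: "I \<subseteq> J" and fin: "finite I" and I: "I \<noteq> {}" and x: "0 < x"
  shows "prob {\<omega> \<in> space M. 2 * (C * x * card I) \<le> (\<Sum>p\<in>I. of_bool (\<bar>eps p \<omega>\<bar> \<le> x))} \<le> 1 / (C * x * card I)"
proof -
  let ?Y = "\<lambda>p \<omega>. of_bool (\<bar>eps p \<omega>\<bar> \<le> x) :: real"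
  let ?a = "C * x * card I"
  have a: "0 < ?a" using C_pos x I fin by (simp add: card_gt_0_iff)
  have E: "expectation (?Y p) \<le> C * x" if p: "p \<in> I" for p
  proof -
    have pJ[measurable]: "eps p \<in> borel_measurable M" using p IJ by auto
    have "expectation (?Y p) = expectation (indicator {\<omega> \<in> space M. \<bar>eps p \<omega>\<bar> \<le> x})"
      by (intro Bochner_Integration.integral_cong) (auto simp: indicator_def)
    also have "\<dots> = prob {\<omega> \<in> space M. \<bar>eps p \<omega>\<bar> \<le> x}"
      by (simp add: Int_absorb2 Collect_restrict)
    finally show ?thesis using small_ball[of p x] p IJ x by auto
  qed
  then have ES: "(\<Sum>p\<in>I. expectation (?Y p)) \<le> ?a"
    using sum_mono[of I "\<lambda>p. expectation (?Y p)" "\<lambda>_. C * x"] by (simp add: mult_ac)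
  have "indep_vars (\<lambda>_. borel) ?Y I"
    using IJ by (intro indep_vars_compose2[OF indep_vars_subset[OF indep], of I "\<lambda>_ e. of_bool (\<bar>e\<bar> \<le> x)"]) auto
  then have "prob {\<omega> \<in> space M. ?a \<le> \<bar>(\<Sum>p\<in>I. ?Y p \<omega>) - (\<Sum>p\<in>I. expectation (?Y p))\<bar>}
    \<le> (\<Sum>p\<in>I. expectation (\<lambda>\<omega>. (?Y p \<omega>)\<^sup>2)) / ?a\<^sup>2"
    using a fin by (intro indep_sum_deviation[where B = 1]) auto
  also have "\<dots> \<le> ?a / ?a\<^sup>2"
  proof -
    have "(of_bool b :: real)\<^sup>2 = of_bool b" for b by (cases b) auto
    then show ?thesis using ES by (intro divide_right_mono) (auto simp only: zero_le_power2)
  qed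
  also have "\<dots> = 1 / ?a" using a by (simp add: power2_eq_square)
  finally have 1: "prob {\<omega> \<in> space M. ?a \<le> \<bar>(\<Sum>p\<in>I. ?Y p \<omega>) - (\<Sum>p\<in>I. expectation (?Y p))\<bar>} \<le> 1 / ?a" .
  have m: "?Y p \<in> borel_measurable M" if "p \<in> I" for p
    using that IJ by (intro measurable_compose[OF eps_measurable]) auto
  have "prob {\<omega> \<in> space M. 2 * ?a \<le> (\<Sum>p\<in>I. ?Y p \<omega>)}
    \<le> prob {\<omega> \<in> space M. ?a \<le> \<bar>(\<Sum>p\<in>I. ?Y p \<omega>) - (\<Sum>p\<in>I. expectation (?Y p))\<bar>}"
  proof (rule finite_measure_mono)
    show "{\<omega> \<in> space M. 2 * ?a \<le> (\<Sum>p\<in>I. ?Y p \<omega>)} \<subseteq> {\<omega> \<in> space M. ?a \<le> \<bar>(\<Sum>p\<in>I. ?Y p \<omega>) - (\<Sum>p\<in>I. expectation (?Y p))\<bar>}"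
      using ES by auto
    have "(\<lambda>\<omega>. \<Sum>p\<in>I. ?Y p \<omega>) \<in> borel_measurable M" using m by (rule borel_measurable_sum)
    then show "{\<omega> \<in> space M. ?a \<le> \<bar>(\<Sum>p\<in>I. ?Y p \<omega>) - (\<Sum>p\<in>I. expectation (?Y p))\<bar>} \<in> events"
      by measurable
  qed
  then show ?thesis using 1 by simp
qed

end

context median_noise
begin

text \<open>The remainder is controlled on a ball of radius \<open>r\<close> through a net of size independent of \<open>r\<close>,
  since its modulus of continuity there is \<open>O(card I * r)\<close>: \<open>lad_excess (eps p) (h p w)\<close> can only
  vary where \<open>\<bar>eps p\<bar> = O(r)\<close>.\<close>

lemma lad_remainder_uniform:
  fixes H \<kappa> :: real
  assumes H: "1 \<le> H" and \<kappa>: "0 < \<kappa>"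
  obtains K2 where "0 < K2"
    "\<And>(I :: 'p set) (d :: 'p \<Rightarrow> 'b::euclidean_space) h (r :: real). smooth_design H I d h \<Longrightarrow> I \<subseteq> J \<Longrightarrow> finite I \<Longrightarrow> I \<noteq> {} \<Longrightarrow> 0 < r \<Longrightarrow> r \<le> 1 \<Longrightarrow>
      \<exists>E\<in>events. 1 - K2 / (card I * r) \<le> prob E \<and>
        (\<forall>\<omega>\<in>E. \<forall>w. norm w \<le> r \<longrightarrow>
          \<bar>(\<Sum>p\<in>I. lad_remainder d h p w \<omega>) - \<gamma> * (\<Sum>p\<in>I. (d p \<bullet> w)\<^sup>2)\<bar>
            \<le> \<kappa> * card I * r\<^sup>2 + (8 * C * H ^ 3 + 3 * \<gamma> * H\<^sup>2) * card I * r ^ 3)"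
proof -
  \<comment> \<open>Moving \<open>w\<close> to a net point at distance \<open>r * \<eta>\<close>
    changes the remainder by at most \<open>\<eta> * card I * r^2\<close> times
    \<open>H + 16 * C * H^2\<close>, the count of small noise being at most twice the bound for its
    mean, and the quadratic form by the same times \<open>2 * \<gamma> * H^2\<close>.
    \<open>\<eta>\<close> makes the total half of the budget
    \<open>\<kappa> * card I * r^2\<close>.\<close>
  define L where "L = H + 16 * C * H\<^sup>2 + 2 * \<gamma> * H\<^sup>2"
  have L: "0 < L" using H C_pos \<gamma>_pos by (simp add: L_def add_pos_pos)
  define \<eta> where "\<eta> = \<kappa> / (2 * L)"
  have \<eta>: "0 < \<eta>" using \<kappa> L by (simp add: \<eta>_def)
  obtain F where F: "finite F" "F \<subseteq> cball (0 :: 'b) 1" "cball 0 1 \<subseteq> (\<Union>z\<in>F. ball z \<eta>)"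
    using compactE_image[OF compact_cball, of "cball (0 :: 'b) 1" "\<lambda>z. ball z \<eta>" 0 1] \<eta> by force
  define C1 where "C1 = 64 * C * H ^ 3 + 2 * H\<^sup>2"
  have C1: "0 < C1" using H C_pos by (simp add: C1_def add_pos_pos)
  define K2 where "K2 = card F * (4 * C1 / \<kappa>\<^sup>2) + 1 / (2 * C * H)"
  have K2: "0 < K2" using H C_pos C1 \<kappa> by (simp add: K2_def add_nonneg_pos)
  show thesis
  proof (rule that[OF K2])
    fix I :: "'p set" and d :: "'p \<Rightarrow> 'b" and h and r :: real
    assume sd: "smooth_design H I d h" and IJ: "I \<subseteq> J" and fin: "finite I" and ne: "I \<noteq> {}" and r: "0 < r" "r \<le> 1"
    let ?N = "real (card I)"
    have N: "0 < ?N" using fin ne by (simp add: card_gt_0_iff)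
    define a where "a = \<kappa> * ?N * r\<^sup>2 / 2"
    have a: "0 < a" using \<kappa> N r by (simp add: a_def)
    let ?R = "\<lambda>w \<omega>. \<Sum>p\<in>I. lad_remainder d h p w \<omega>"
    let ?ER = "\<lambda>w. \<Sum>p\<in>I. expectation (lad_remainder d h p w)"
    let ?bad = "\<lambda>z. {\<omega> \<in> space M. a \<le> \<bar>?R (r *\<^sub>R z) \<omega> - ?ER (r *\<^sub>R z)\<bar>}"
    let ?cnt = "\<lambda>\<omega>. \<Sum>p\<in>I. of_bool (\<bar>eps p \<omega>\<bar> \<le> 2 * H * r) :: real"
    let ?badc = "{\<omega> \<in> space M. 2 * (C * (2 * H * r) * ?N) \<le> ?cnt \<omega>}"
    have Rm[measurable]: "?R w \<in> borel_measurable M" for w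
      by (intro borel_measurable_sum lad_remainder_measurable[OF sd H IJ fin])
    have cm[measurable]: "?cnt \<in> borel_measurable M"
      using IJ by (intro borel_measurable_sum measurable_compose[OF eps_measurable]) auto
    have badm: "?bad z \<in> events" for z by measurable
    have badcm: "?badc \<in> events" by measurable
    define B where "B = (\<Union>z\<in>F. ?bad z) \<union> ?badc"
    have Bm: "B \<in> events" unfolding B_def using F(1) badm badcm by (intro sets.Un sets.finite_UN) auto
    have nz: "norm (r *\<^sub>R z) \<le> r" if "norm z \<le> 1" for z :: 'b
      using that r by (simp add: mult_left_le)
    have "prob (?bad z) \<le> 4 * C1 / \<kappa>\<^sup>2 / (?N * r)" if "z \<in> F" for z
    proof -
      have "norm z \<le> 1" using that F(2) by auto
      then have "prob (?bad z) \<le> ?N * (C1 * r ^ 3) / a\<^sup>2"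
        unfolding C1_def by (intro lad_remainder_deviation[OF sd H IJ fin nz r(2) a])
      \<comment> \<open>Second moments of order \<open>r^3\<close> meet a squared budget of order
        \<open>(card I)^2 * r^4\<close>, leaving \<open>1 / (card I * r)\<close>, the same order as
        for the count of small noise.\<close>
      also have "\<dots> = 4 * C1 / \<kappa>\<^sup>2 / (?N * r)"
        using N r \<kappa> by (simp add: a_def power2_eq_square power3_eq_cube field_simps)
      finally show ?thesis .
    qed
    then have "prob (\<Union>z\<in>F. ?bad z) \<le> (\<Sum>z\<in>F. 4 * C1 / \<kappa>\<^sup>2 / (?N * r))"
      using F(1) badm by (intro order_trans[OF finite_measure_subadditive_finite] sum_mono) auto
    moreover have "prob ?badc \<le> 1 / (C * (2 * H * r) * ?N)"
      using H r by (intro small_noise_count[OF IJ fin ne]) auto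
    moreover have "prob B \<le> prob (\<Union>z\<in>F. ?bad z) + prob ?badc"
      unfolding B_def using F(1) badm badcm by (intro measure_Un_le sets.finite_UN) auto
    moreover have "(\<Sum>z\<in>F. 4 * C1 / \<kappa>\<^sup>2 / (?N * r)) + 1 / (C * (2 * H * r) * ?N) = K2 / (?N * r)"
      using H by (simp add: K2_def add_divide_distrib mult_ac)
    ultimately have "prob B \<le> K2 / (?N * r)" by linarith
    then have pE: "1 - K2 / (?N * r) \<le> prob (space M - B)" using prob_compl[OF Bm] by simp
    have main: "\<bar>?R w \<omega> - \<gamma> * (\<Sum>p\<in>I. (d p \<bullet> w)\<^sup>2)\<bar> \<le> \<kappa> * ?N * r\<^sup>2 + (8 * C * H ^ 3 + 3 * \<gamma> * H\<^sup>2) * ?N * r ^ 3"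
      if \<omega>: "\<omega> \<in> space M - B" and w: "norm w \<le> r" for \<omega> w
    proof -
      have "(1 / r) *\<^sub>R w \<in> cball 0 1" using w r by (simp add: divide_le_eq)
      then obtain z where z: "z \<in> F" "(1 / r) *\<^sub>R w \<in> ball z \<eta>" using F(3) by blast
      define w' where "w' = r *\<^sub>R z"
      have w': "norm w' \<le> r" unfolding w'_def using z(1) F(2) by (intro nz) auto
      have "norm (w - w') = r * norm ((1 / r) *\<^sub>R w - z)"
      proof -
        have "w - w' = r *\<^sub>R ((1 / r) *\<^sub>R w - z)" using r by (simp add: w'_def scaleR_diff_right)
        then show ?thesis using r by simp
      qed
      also have "\<dots> \<le> r * \<eta>"
        using z(2) r by (intro mult_left_mono) (auto simp: dist_norm norm_minus_commute)
      finally have ww: "norm (w - w') \<le> r * \<eta>" .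
      have cnt: "?cnt \<omega> \<le> 2 * (C * (2 * H * r) * ?N)" using \<omega> by (auto simp: B_def)
      have "\<bar>?R w \<omega> - ?R w' \<omega>\<bar> \<le> (\<Sum>p\<in>I. norm (w - w') * (H * r + 4 * H * of_bool (\<bar>eps p \<omega>\<bar> \<le> 2 * H * r)))"
        unfolding sum_subtractf[symmetric]
        using lad_remainder_lipschitz[OF sd H IJ fin _ w w' r(2)] by (intro order_trans[OF sum_abs] sum_mono)
      also have "\<dots> = norm (w - w') * (?N * (H * r) + 4 * H * ?cnt \<omega>)"
        by (simp add: sum_distrib_left[symmetric] sum.distrib)
      also have "\<dots> \<le> (r * \<eta>) * (?N * (H * r) + 4 * H * (2 * (C * (2 * H * r) * ?N)))"
        using ww cnt H r N \<eta> by (intro mult_mono add_mono mult_left_mono) (auto intro!: add_nonneg_nonneg mult_nonneg_nonneg sum_nonneg)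
      finally have 1: "\<bar>?R w \<omega> - ?R w' \<omega>\<bar> \<le> \<eta> * ?N * r\<^sup>2 * (H + 16 * C * H\<^sup>2)"
        by (simp add: power2_eq_square algebra_simps)
      have 2: "\<bar>?R w' \<omega> - ?ER w'\<bar> \<le> a"
        using \<omega> z(1) unfolding B_def w'_def by force
      have "\<bar>?ER w' - (\<Sum>p\<in>I. \<gamma> * (d p \<bullet> w')\<^sup>2)\<bar> \<le> (\<Sum>p\<in>I. (8 * C * H ^ 3 + 3 * \<gamma> * H\<^sup>2) * r ^ 3)"
        unfolding sum_subtractf[symmetric]
        using lad_remainder_mean[OF sd H IJ fin _ w' r(2)] by (intro order_trans[OF sum_abs] sum_mono)
      then have 3: "\<bar>?ER w' - \<gamma> * (\<Sum>p\<in>I. (d p \<bullet> w')\<^sup>2)\<bar> \<le> (8 * C * H ^ 3 + 3 * \<gamma> * H\<^sup>2) * ?N * r ^ 3"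
        by (simp add: sum_distrib_left mult_ac)
      have "\<bar>(d p \<bullet> w')\<^sup>2 - (d p \<bullet> w)\<^sup>2\<bar> \<le> 2 * H\<^sup>2 * r\<^sup>2 * \<eta>" if p: "p \<in> I" for p
      proof -
        note D = smooth_designD[OF sd H p]
        have "\<bar>d p \<bullet> (w' - w)\<bar> \<le> H * (r * \<eta>)"
          using order_trans[OF D(4)[of "w' - w"] mult_left_mono[of _ "r * \<eta>" H]] ww H by (simp add: norm_minus_commute)
        moreover have "\<bar>d p \<bullet> w'\<bar> \<le> H * r" "\<bar>d p \<bullet> w\<bar> \<le> H * r"
          using order_trans[OF D(4) mult_left_mono[OF w, of H]] order_trans[OF D(4) mult_left_mono[OF w', of H]] H by simp_all
        then have "\<bar>d p \<bullet> (w' + w)\<bar> \<le> 2 * H * r" unfolding inner_add_right by linarith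
        moreover have "\<bar>(d p \<bullet> w')\<^sup>2 - (d p \<bullet> w)\<^sup>2\<bar> = \<bar>d p \<bullet> (w' - w)\<bar> * \<bar>d p \<bullet> (w' + w)\<bar>"
          by (simp add: abs_mult[symmetric] inner_diff_right inner_add_right power2_eq_square algebra_simps)
        ultimately have "\<bar>(d p \<bullet> w')\<^sup>2 - (d p \<bullet> w)\<^sup>2\<bar> \<le> (H * (r * \<eta>)) * (2 * H * r)"
          using H r \<eta> by (simp only:) (intro mult_mono, auto)
        then show ?thesis by (simp add: power2_eq_square mult_ac)
      qed
      then have "\<bar>(\<Sum>p\<in>I. (d p \<bullet> w')\<^sup>2) - (\<Sum>p\<in>I. (d p \<bullet> w)\<^sup>2)\<bar> \<le> (\<Sum>p\<in>I. 2 * H\<^sup>2 * r\<^sup>2 * \<eta>)"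
        unfolding sum_subtractf[symmetric] by (intro order_trans[OF sum_abs] sum_mono)
      then have "\<gamma> * \<bar>(\<Sum>p\<in>I. (d p \<bullet> w')\<^sup>2) - (\<Sum>p\<in>I. (d p \<bullet> w)\<^sup>2)\<bar> \<le> \<gamma> * (?N * (2 * H\<^sup>2 * r\<^sup>2 * \<eta>))"
        using \<gamma>_pos by (intro mult_left_mono) auto
      then have 4: "\<bar>\<gamma> * (\<Sum>p\<in>I. (d p \<bullet> w')\<^sup>2) - \<gamma> * (\<Sum>p\<in>I. (d p \<bullet> w)\<^sup>2)\<bar> \<le> \<eta> * ?N * r\<^sup>2 * (2 * \<gamma> * H\<^sup>2)"
        using \<gamma>_pos by (simp add: abs_mult right_diff_distrib[symmetric] mult_ac)
      have "\<eta> * ?N * r\<^sup>2 * (H + 16 * C * H\<^sup>2) + \<eta> * ?N * r\<^sup>2 * (2 * \<gamma> * H\<^sup>2) = \<eta> * L * ?N * r\<^sup>2"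
        unfolding L_def by (simp add: algebra_simps)
      also have "\<dots> = a" using L by (simp add: \<eta>_def a_def)
      finally have 5: "\<eta> * ?N * r\<^sup>2 * (H + 16 * C * H\<^sup>2) + \<eta> * ?N * r\<^sup>2 * (2 * \<gamma> * H\<^sup>2) = a" .
      have 6: "a + a = \<kappa> * ?N * r\<^sup>2" by (simp add: a_def)
      show ?thesis using 1 2 3 4 5 6 by linarith
    qed
    show "\<exists>E\<in>events. 1 - K2 / (card I * r) \<le> prob E \<and>
        (\<forall>\<omega>\<in>E. \<forall>w. norm w \<le> r \<longrightarrow>
          \<bar>(\<Sum>p\<in>I. lad_remainder d h p w \<omega>) - \<gamma> * (\<Sum>p\<in>I. (d p \<bullet> w)\<^sup>2)\<bar>
            \<le> \<kappa> * card I * r\<^sup>2 + (8 * C * H ^ 3 + 3 * \<gamma> * H\<^sup>2) * card I * r ^ 3)"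
      using pE Bm main by (intro bexI[of _ "space M - B"]) auto
  qed
qed

end

section \<open>Linearization of the estimator\<close>

lemma (in prob_space) prob_Int_ge:
  assumes "E1 \<in> events" "E2 \<in> events" "1 - q1 \<le> prob E1" "1 - q2 \<le> prob E2"
  shows "1 - (q1 + q2) \<le> prob (E1 \<inter> E2)"
proof -
  have "prob (space M - (E1 \<inter> E2)) \<le> prob (space M - E1) + prob (space M - E2)"
    using assms by (subst Diff_Int) (intro measure_Un_le, auto)
  then show ?thesis using assms prob_compl[of E1] prob_compl[of E2] prob_compl[of "E1 \<inter> E2"] by simp
qed

text \<open>An event inside all the \<open>E j\<close> is asserted, since the intersection over an
  empty \<open>A\<close> would be \<open>UNIV\<close>, which need not be an event.\<close>

lemma (in prob_space) prob_finite_INT_ge: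
  assumes "finite A" "\<And>j. j \<in> A \<Longrightarrow> E j \<in> events" "\<And>j. j \<in> A \<Longrightarrow> 1 - q j \<le> prob (E j)"
  shows "\<exists>E'\<in>events. 1 - (\<Sum>j\<in>A. q j) \<le> prob E' \<and> (\<forall>\<omega>\<in>E'. \<forall>j\<in>A. \<omega> \<in> E j)"
  using assms
proof (induction A)
  case empty
  then show ?case by (intro bexI[of _ "space M"]) (auto simp: prob_space)
next
  case (insert k A)
  then obtain E' where E': "E' \<in> events" "1 - (\<Sum>j\<in>A. q j) \<le> prob E'" "\<forall>\<omega>\<in>E'. \<forall>j\<in>A. \<omega> \<in> E j" by auto
  then show ?case
    using prob_Int_ge[of "E k" E' "q k"] insert by (intro bexI[of _ "E k \<inter> E'"]) auto
qed

text \<open>\<open>what i\<close> is the estimation error, and \<open>vstar i\<close> the minimizer of the limiting quadratic, in which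
  the Gram matrix of \<open>d i\<close> is replaced by its limit \<open>L\<^sup>T L\<close>.\<close>

locale lad_array = median_noise M eps J C \<gamma>
  for M :: "'a measure" and eps :: "'p \<Rightarrow> 'a \<Rightarrow> real" and J C \<gamma> +
  fixes F :: "'i filter" and I :: "'i \<Rightarrow> 'p set" and d :: "'i \<Rightarrow> 'p \<Rightarrow> 'b::euclidean_space"
    and h :: "'i \<Rightarrow> 'p \<Rightarrow> 'b \<Rightarrow> real" and H :: real and L :: "'b \<Rightarrow> 'c::euclidean_space"
    and what vstar :: "'i \<Rightarrow> 'a \<Rightarrow> 'b"
  assumes IJ: "I i \<subseteq> J" and fin: "finite (I i)"
    and card: "filterlim (\<lambda>i. real (card (I i))) at_top F"
    and H: "1 \<le> H"
    and design: "\<forall>\<^sub>F i in F. smooth_design H (I i) (d i) (h i)"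
    and gram: "\<And>w. ((\<lambda>i. (\<Sum>p\<in>I i. (d i p \<bullet> w)\<^sup>2) / card (I i)) \<longlongrightarrow> (norm (L w))\<^sup>2) F"
    and L: "linear L" "inj L"
    and what: "what i \<in> borel_measurable M"
    and optimal: "\<exists>\<delta>>0. \<forall>\<^sub>F i in F. \<forall>\<omega>\<in>space M. \<forall>w. norm w \<le> \<delta> \<longrightarrow>
      (\<Sum>p\<in>I i. \<bar>eps p \<omega> - h i p (what i \<omega>)\<bar> - \<bar>eps p \<omega>\<bar>) \<le> (\<Sum>p\<in>I i. \<bar>eps p \<omega> - h i p w\<bar> - \<bar>eps p \<omega>\<bar>)"
    and consistent: "\<And>\<delta> q. 0 < \<delta> \<Longrightarrow> 0 < q \<Longrightarrow> \<forall>\<^sub>F i in F. prob {\<omega> \<in> space M. \<delta> < norm (what i \<omega>)} \<le> q"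
    and vstar: "\<omega> \<in> space M \<Longrightarrow>
      (1 / sqrt (card (I i))) *\<^sub>R (\<Sum>p\<in>I i. sgn (eps p \<omega>) *\<^sub>R d i p) \<bullet> u = 2 * \<gamma> * (L (vstar i \<omega>) \<bullet> L u)"
begin

abbreviation N :: "'i \<Rightarrow> real" where "N i \<equiv> real (card (I i))"

definition score :: "'i \<Rightarrow> 'a \<Rightarrow> 'b"
  where "score i \<omega> = (1 / sqrt (N i)) *\<^sub>R (\<Sum>p\<in>I i. sgn (eps p \<omega>) *\<^sub>R d i p)"

lemma score_measurable[measurable]: "score i \<in> borel_measurable M"
  unfolding score_def using IJ
  by (intro borel_measurable_scaleR borel_measurable_sum borel_measurable_const measurable_compose[OF eps_measurable]) auto

lemma N_large: "\<forall>\<^sub>F i in F. c \<le> N i"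
  using card by (simp add: filterlim_at_top)

text \<open>Convergence at each \<open>w\<close> yields convergence of the finitely many matrix
  entries by polarization, and these control the form for all \<open>w\<close> at once, with an
  error relative to \<open>(norm w)^2\<close>. The uniformity matters because the form is evaluated
  at the random estimate.\<close>

lemma gram_uniform:
  assumes \<kappa>: "0 < \<kappa>"
  shows "\<forall>\<^sub>F i in F. \<forall>w. \<bar>(\<Sum>p\<in>I i. (d i p \<bullet> w)\<^sup>2) - N i * (norm (L w))\<^sup>2\<bar> \<le> \<kappa> * N i * (norm w)\<^sup>2"
proof -
  define g where "g = (\<lambda>i b b'. (\<Sum>p\<in>I i. (d i p \<bullet> b) * (d i p \<bullet> b')) / N i)"
  define n where "n = real DIM('b)"
  have n: "0 < n" by (simp add: n_def)
  have g: "((\<lambda>i. g i b b') \<longlongrightarrow> L b \<bullet> L b') F" for b b'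
  proof -
    have "g i b b' = ((\<Sum>p\<in>I i. (d i p \<bullet> (b + b'))\<^sup>2) / N i - (\<Sum>p\<in>I i. (d i p \<bullet> (b - b'))\<^sup>2) / N i) / 4" for i
    proof -
      have "(\<Sum>p\<in>I i. (d i p \<bullet> (b + b'))\<^sup>2) - (\<Sum>p\<in>I i. (d i p \<bullet> (b - b'))\<^sup>2) = 4 * (\<Sum>p\<in>I i. (d i p \<bullet> b) * (d i p \<bullet> b'))"
        unfolding sum_subtractf[symmetric] sum_distrib_left
        by (intro sum.cong) (auto simp: inner_add_right inner_diff_right power2_eq_square algebra_simps)
      then show ?thesis by (simp add: g_def diff_divide_distrib[symmetric])
    qed
    moreover have "L b \<bullet> L b' = ((norm (L (b + b')))\<^sup>2 - (norm (L (b - b')))\<^sup>2) / 4"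
      unfolding power2_norm_eq_inner linear_add[OF L(1)] linear_diff[OF L(1)]
      by (simp add: inner_add_left inner_add_right inner_diff_left inner_diff_right inner_commute)
    ultimately show ?thesis by (simp only:) (intro tendsto_intros gram, simp)
  qed
  have "\<forall>\<^sub>F i in F. \<forall>b\<in>Basis. \<forall>b'\<in>Basis. dist (g i b b') (L b \<bullet> L b') < \<kappa> / n\<^sup>2"
    using \<kappa> n by (intro eventually_ball_finite ballI tendstoD[OF g]) auto
  then show ?thesis
    using N_large[of 1]
  proof eventually_elim
    case (elim i)
    show ?case
    proof
      fix w
      have Lw: "(norm (L w))\<^sup>2 = (\<Sum>b\<in>Basis. \<Sum>b'\<in>Basis. (w \<bullet> b) * (w \<bullet> b') * (L b \<bullet> L b'))"
      proof -
        have "L w = L (\<Sum>b\<in>Basis. (w \<bullet> b) *\<^sub>R b)" by (simp add: euclidean_representation)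
        also have "\<dots> = (\<Sum>b\<in>Basis. (w \<bullet> b) *\<^sub>R L b)" by (simp add: linear_sum[OF L(1)] linear_scale[OF L(1)])
        finally show ?thesis
          unfolding power2_norm_eq_inner
          by (simp only: inner_sum_left) (simp add: inner_sum_right sum_distrib_left mult_ac)
      qed
      have dw: "(\<Sum>p\<in>I i. (d i p \<bullet> w)\<^sup>2) = (\<Sum>b\<in>Basis. \<Sum>b'\<in>Basis. (w \<bullet> b) * (w \<bullet> b') * (N i * g i b b'))"
      proof -
        have "(\<Sum>p\<in>I i. (d i p \<bullet> w)\<^sup>2) = (\<Sum>p\<in>I i. \<Sum>b\<in>Basis. \<Sum>b'\<in>Basis. (w \<bullet> b) * (w \<bullet> b') * ((d i p \<bullet> b) * (d i p \<bullet> b')))"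
          by (intro sum.cong refl, subst euclidean_inner) (simp add: power2_eq_square sum_product mult_ac)
        also have "\<dots> = (\<Sum>b\<in>Basis. \<Sum>b'\<in>Basis. \<Sum>p\<in>I i. (w \<bullet> b) * (w \<bullet> b') * ((d i p \<bullet> b) * (d i p \<bullet> b')))"
          by (subst sum.swap) (intro sum.cong refl, rule sum.swap)
        also have "\<dots> = (\<Sum>b\<in>Basis. \<Sum>b'\<in>Basis. (w \<bullet> b) * (w \<bullet> b') * (N i * g i b b'))"
          using elim(2) by (simp add: g_def sum_distrib_left[symmetric])
        finally show ?thesis .
      qed
      have "\<bar>(\<Sum>p\<in>I i. (d i p \<bullet> w)\<^sup>2) - N i * (norm (L w))\<^sup>2\<bar>
        = \<bar>\<Sum>b\<in>Basis. \<Sum>b'\<in>Basis. (w \<bullet> b) * (w \<bullet> b') * (N i * (g i b b' - L b \<bullet> L b'))\<bar>"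
        unfolding Lw dw sum_distrib_left sum_subtractf[symmetric] by (simp add: algebra_simps)
      \<comment> \<open>Each of the \<open>n^2\<close> entries is off by at most
        \<open>\<kappa> / n^2\<close> and weighted by at most \<open>(norm w)^2\<close>, as
        coordinates are bounded by the norm.\<close>
      also have "\<dots> \<le> (\<Sum>b\<in>(Basis::'b set). \<Sum>b'\<in>(Basis::'b set). norm w * norm w * (N i * (\<kappa> / n\<^sup>2)))"
      proof (intro order_trans[OF sum_abs] sum_mono)
        fix b b' :: 'b assume b: "b \<in> Basis" "b' \<in> Basis"
        have "\<bar>g i b b' - L b \<bullet> L b'\<bar> \<le> \<kappa> / n\<^sup>2" using elim(1) b by (force simp: dist_real_def)
        then show "\<bar>(w \<bullet> b) * (w \<bullet> b') * (N i * (g i b b' - L b \<bullet> L b'))\<bar> \<le> norm w * norm w * (N i * (\<kappa> / n\<^sup>2))"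
          unfolding abs_mult using b by (intro mult_mono Basis_le_norm) auto
      qed
      also have "\<dots> = \<kappa> * N i * (norm w)\<^sup>2"
        using n by (simp add: n_def[symmetric] power2_eq_square)
      finally show "\<bar>(\<Sum>p\<in>I i. (d i p \<bullet> w)\<^sup>2) - N i * (norm (L w))\<^sup>2\<bar> \<le> \<kappa> * N i * (norm w)\<^sup>2" .
    qed
  qed
qed

lemma score_tight:
  assumes q: "0 < q"
  obtains K where "0 < K" "\<forall>\<^sub>F i in F. 1 - q \<le> prob {\<omega> \<in> space M. norm (score i \<omega>) \<le> K}"
proof -
  define n where "n = real DIM('b)"
  have n: "0 < n" by (simp add: n_def)
  \<comment> \<open>Each coordinate of the score exceeds \<open>k\<close> with probability at most
    \<open>H^2 / k^2 = q / n\<close>; the union over \<open>n\<close> coordinates costs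
    \<open>q\<close>, and the norm is at most the sum \<open>n * k\<close> of the coordinate
    bounds.\<close>
  define k where "k = sqrt (n * H\<^sup>2 / q)"
  have k: "0 < k" "k\<^sup>2 = n * H\<^sup>2 / q" using n q H by (simp_all add: k_def)
  show thesis
  proof
    show "0 < n * k" using n k by simp
    show "\<forall>\<^sub>F i in F. 1 - q \<le> prob {\<omega> \<in> space M. norm (score i \<omega>) \<le> n * k}"
      using N_large[of 1] design
    proof eventually_elim
      case (elim i)
      let ?Y = "\<lambda>b p \<omega>. (d i p \<bullet> b) * sgn (eps p \<omega>)"
      let ?a = "sqrt (N i) * k"
      define bad where "bad = (\<lambda>b. {\<omega> \<in> space M. ?a \<le> \<bar>(\<Sum>p\<in>I i. ?Y b p \<omega>) - (\<Sum>p\<in>I i. expectation (?Y b p))\<bar>})"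
      have a: "0 < ?a" using elim k by simp
      have dH: "\<bar>d i p \<bullet> b\<bar> \<le> H" if "p \<in> I i" "b \<in> Basis" for p b
        using Basis_le_norm[OF that(2)] smooth_designD(1)[OF elim(2) H that(1)] order_trans by blast
      have E0: "expectation (?Y b p) = 0" if "p \<in> I i" for b p
        using that IJ sgn_mean by (subst integral_mult_right_zero) auto
      have Ym: "?Y b p \<in> borel_measurable M" if "p \<in> I i" for b p
        using that IJ by (intro borel_measurable_times borel_measurable_const measurable_compose[OF eps_measurable]) auto
      have badm: "bad b \<in> events" for b
      proof -
        have [measurable]: "(\<lambda>\<omega>. \<Sum>p\<in>I i. ?Y b p \<omega>) \<in> borel_measurable M" using Ym by (rule borel_measurable_sum)
        show ?thesis unfolding bad_def by measurable
      qed
      have badU: "(\<Union>b\<in>Basis. bad b) \<in> events" by (intro sets.finite_UN finite_Basis badm)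
      have bad: "prob (bad b) \<le> q / n" if b: "b \<in> Basis" for b
      proof -
        have bdY: "\<bar>?Y b p \<omega>\<bar> \<le> H" if "p \<in> I i" for p \<omega>
        proof -
          have "\<bar>?Y b p \<omega>\<bar> \<le> H * 1" unfolding abs_mult using dH[OF that b] H by (intro mult_mono) (auto simp: sgn_if)
          then show ?thesis by simp
        qed
        have "indep_vars (\<lambda>_. borel) (?Y b) (I i)"
          using IJ by (intro indep_vars_compose2[OF indep_vars_subset[OF indep], of "I i" "\<lambda>p e. (d i p \<bullet> b) * sgn e"]) auto
        then have "prob (bad b) \<le> (\<Sum>p\<in>I i. expectation (\<lambda>\<omega>. (?Y b p \<omega>)\<^sup>2)) / ?a\<^sup>2"
          unfolding bad_def using bdY a fin by (intro indep_sum_deviation[where B = H]) auto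
        also have "\<dots> \<le> (\<Sum>p\<in>I i. H\<^sup>2) / ?a\<^sup>2"
        proof (intro divide_right_mono sum_mono)
          fix p assume p: "p \<in> I i"
          have sq: "(?Y b p \<omega>)\<^sup>2 \<le> H\<^sup>2" for \<omega> using power_mono[OF bdY[OF p], of \<omega> 2] by simp
          have "expectation (\<lambda>\<omega>. (?Y b p \<omega>)\<^sup>2) \<le> expectation (\<lambda>_. H\<^sup>2)"
            using sq Ym[OF p] by (intro integral_mono integrable_const_bound[where B = "H\<^sup>2"]) auto
          then show "expectation (\<lambda>\<omega>. (?Y b p \<omega>)\<^sup>2) \<le> H\<^sup>2" by (simp add: prob_space)
        qed simp
        also have "\<dots> = q / n" using elim n q H by (simp add: power_mult_distrib k(2))
        finally show ?thesis .
      qed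
      have "prob (\<Union>b\<in>Basis. bad b) \<le> (\<Sum>b\<in>Basis. prob (bad b))"
        by (rule finite_measure_subadditive_finite) (auto intro: badm)
      also have "\<dots> \<le> (\<Sum>b\<in>(Basis::'b set). q / n)"
        by (rule sum_mono[OF bad])
      also have "\<dots> = q" using n by (simp add: n_def)
      finally have "1 - q \<le> prob (space M - (\<Union>b\<in>Basis. bad b))"
        by (subst prob_compl[OF badU]) simp
      also have "\<dots> \<le> prob {\<omega> \<in> space M. norm (score i \<omega>) \<le> n * k}"
      proof (rule finite_measure_mono)
        show "{\<omega> \<in> space M. norm (score i \<omega>) \<le> n * k} \<in> events" by measurable
        show "space M - (\<Union>b\<in>Basis. bad b) \<subseteq> {\<omega> \<in> space M. norm (score i \<omega>) \<le> n * k}"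
        proof safe
          fix \<omega> assume \<omega>: "\<omega> \<in> space M" "\<omega> \<notin> (\<Union>b\<in>Basis. bad b)"
          have "\<bar>score i \<omega> \<bullet> b\<bar> \<le> k" if b: "b \<in> Basis" for b
          proof -
            have "\<bar>\<Sum>p\<in>I i. ?Y b p \<omega>\<bar> \<le> sqrt (N i) * k" 
            proof -
              have S0: "(\<Sum>p\<in>I i. expectation (?Y b p)) = 0" by (intro sum.neutral ballI E0)
              have "\<omega> \<notin> bad b" using \<omega>(2) b by blast
              then have "\<not> ?a \<le> \<bar>(\<Sum>p\<in>I i. ?Y b p \<omega>) - (\<Sum>p\<in>I i. expectation (?Y b p))\<bar>"
                using \<omega>(1) unfolding bad_def by blast
              then show ?thesis unfolding S0 by simp
            qed
            moreover have "score i \<omega> \<bullet> b = (\<Sum>p\<in>I i. ?Y b p \<omega>) / sqrt (N i)"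
              by (simp add: score_def inner_sum_left mult.commute)
            ultimately show ?thesis using elim(1) by (simp add: abs_divide divide_le_eq mult.commute)
          qed
          then have "(\<Sum>b\<in>Basis. \<bar>score i \<omega> \<bullet> b\<bar>) \<le> (\<Sum>b\<in>(Basis::'b set). k)" by (intro sum_mono) auto
          then show "norm (score i \<omega>) \<le> n * k"
            using norm_le_l1[of "score i \<omega>"] by (simp add: n_def)
        qed
      qed
      finally show ?case .
    qed
  qed
qed

end

section \<open>Rate of the estimator by peeling, and comparison with the minimizer of the
  quadratic\<close>

lemma dyadic_shell:
  fixes x :: real
  assumes "1 < x"
  obtains j :: nat where "1 \<le> j" "x \<le> 2 ^ j" "2 ^ j < 2 * x"
proof -
  obtain n :: nat where n: "x < 2 ^ n" using real_arch_pow[of 2 x] by auto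
  define j where "j = (LEAST j. x \<le> 2 ^ j)"
  have j: "x \<le> 2 ^ j" unfolding j_def by (rule LeastI[of _ n]) (use n in simp)
  have "j \<noteq> 0" using j assms by (cases j) auto
  then obtain k where k: "j = Suc k" by (cases j) auto
  have "\<not> x \<le> 2 ^ k" using not_less_Least[of k "\<lambda>j. x \<le> 2 ^ j"] k by (simp add: j_def[symmetric])
  then show thesis using j k by (intro that[of j]) auto
qed

context lad_array
begin

lemma lad_difference:
  assumes "0 < N i"
  shows "(\<Sum>p\<in>I i. \<bar>eps p \<omega> - h i p w\<bar> - \<bar>eps p \<omega>\<bar>)
    = (\<Sum>p\<in>I i. lad_remainder (d i) (h i) p w \<omega>) - sqrt (N i) * (score i \<omega> \<bullet> w)"
  using assms by (simp add: lad_decomposition score_def)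

text \<open>At radius \<open>2 ^ j / sqrt (N i)\<close> the remainder bound fails with probability
  at most \<open>K2 / sqrt (N i) * (1 / 2) ^ j\<close>, so over the shells with
  \<open>j \<ge> 1\<close> the failures add up to at most \<open>K2 / sqrt (N i)\<close>. Where the
  bound holds, the curvature at the optimal \<open>w\<close> is dominated by the linear form: a
  multiple of \<open>N i * (norm w)^2\<close> is at most a multiple of
  \<open>sqrt (N i) * norm w\<close>, which is the rate.\<close>

lemma estimator_tight:
  assumes q: "0 < q"
  obtains K where "1 \<le> K" "\<forall>\<^sub>F i in F. \<exists>E\<in>events. 1 - q \<le> prob E \<and>
    (\<forall>\<omega>\<in>E. norm (sqrt (N i) *\<^sub>R what i \<omega>) \<le> K \<and> norm (vstar i \<omega>) \<le> K)"
proof -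
  obtain c0 where c0: "0 < c0" "\<And>x. c0 * norm x \<le> norm (L x)" using linear_inj_bounded_below_pos[OF L] by blast
  define c where "c = c0\<^sup>2"
  have c: "0 < c" "\<And>x. c * (norm x)\<^sup>2 \<le> (norm (L x))\<^sup>2"
    using c0 power_mono[OF c0(2), of _ 2] by (auto simp: c_def power_mult_distrib)
  define b where "b = \<gamma> * c"
  have b: "0 < b" using c \<gamma>_pos by (simp add: b_def)
  \<comment> \<open>On a shell \<open>r < 2 * norm w\<close>, so
    \<open>r^2 \<le> 4 * (norm w)^2\<close>. With \<open>b / 32\<close> for \<open>\<kappa>\<close>
    and as a bound for \<open>D * r0\<close>, the two remainder terms use up \<open>b / 8\<close>
    each; the Gram error takes another eighth, and at least half of the curvature \<open>b\<close>
    survives.\<close>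
  define \<kappa> where "\<kappa> = b / 32"
  define D where "D = 8 * C * H ^ 3 + 3 * \<gamma> * H\<^sup>2"
  have D: "0 < D" using C_pos H \<gamma>_pos by (simp add: D_def add_pos_pos)
  define r0 where "r0 = min 1 (b / (32 * D))"
  have r0: "0 < r0" "r0 \<le> 1" "D * r0 \<le> b / 32"
    using b D mult_left_mono[of r0 "b / (32 * D)" D] by (auto simp: r0_def)
  have "0 < \<kappa>" using b by (simp add: \<kappa>_def)
  then obtain K2 where K2: "0 < K2"
    "\<And>I (d :: 'p \<Rightarrow> 'b) h (r :: real). smooth_design H I d h \<Longrightarrow> I \<subseteq> J \<Longrightarrow> finite I \<Longrightarrow> I \<noteq> {} \<Longrightarrow> 0 < r \<Longrightarrow> r \<le> 1 \<Longrightarrow>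
      \<exists>E\<in>events. 1 - K2 / (real (card I) * r) \<le> prob E \<and>
        (\<forall>\<omega>\<in>E. \<forall>w. norm w \<le> r \<longrightarrow> \<bar>(\<Sum>p\<in>I. lad_remainder d h p w \<omega>) - \<gamma> * (\<Sum>p\<in>I. (d p \<bullet> w)\<^sup>2)\<bar>
            \<le> \<kappa> * real (card I) * r\<^sup>2 + D * real (card I) * r ^ 3)"
  proof (rule lad_remainder_uniform[OF H, where 'b = 'b, folded D_def], goal_cases)
    case (1 K2)
    show ?case by (rule 1(1)[OF 1(2,3)])
  qed
  have q3: "0 < q / 3" using q by simp
  obtain Kw where Kw: "0 < Kw" "\<forall>\<^sub>F i in F. 1 - q / 3 \<le> prob {\<omega> \<in> space M. norm (score i \<omega>) \<le> Kw}"
    using score_tight[OF q3] by blast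
  define K where "K = max 1 (2 * Kw / b)"
  obtain \<delta> where \<delta>: "0 < \<delta>" "\<forall>\<^sub>F i in F. \<forall>\<omega>\<in>space M. \<forall>w. norm w \<le> \<delta> \<longrightarrow>
      (\<Sum>p\<in>I i. \<bar>eps p \<omega> - h i p (what i \<omega>)\<bar> - \<bar>eps p \<omega>\<bar>) \<le> (\<Sum>p\<in>I i. \<bar>eps p \<omega> - h i p w\<bar> - \<bar>eps p \<omega>\<bar>)"
    using optimal by blast
  have "0 < c / 8" using c by simp
  note gu = gram_uniform[OF this]
  \<comment> \<open>Consistency at \<open>r0 / 2\<close> places the dyadic radius around the
    estimate, less than twice its norm, below \<open>r0\<close>.\<close>
  have "0 < r0 / 2" using r0 by simp
  note cons = consistent[OF this q3]
  show thesis
  proof (rule that[of K])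
    show "1 \<le> K" by (simp add: K_def)
    show "\<forall>\<^sub>F i in F. \<exists>E\<in>events. 1 - q \<le> prob E \<and>
      (\<forall>\<omega>\<in>E. norm (sqrt (N i) *\<^sub>R what i \<omega>) \<le> K \<and> norm (vstar i \<omega>) \<le> K)"
      using Kw(2) \<delta>(2) gu cons design N_large[of 1] N_large[of "(3 * K2 / q)\<^sup>2"]
    proof eventually_elim
      case (elim i)
      let ?n = "sqrt (N i)"
      have n: "1 \<le> ?n" "?n * ?n = N i" "3 * K2 / q \<le> ?n" "I i \<noteq> {}"
        using elim(6,7) K2(1) q by (auto simp: real_le_rsqrt)
      define s where "s = ?n"
      have s: "1 \<le> s" "N i = s * s" using n(1,2) by (simp_all add: s_def)
      note sd = elim(5)
      \<comment> \<open>Only finitely many shells lie below \<open>r0\<close>, so the good events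
        can be intersected; \<open>j \<ge> 1\<close> makes the geometric series sum to at most
        \<open>1\<close>.\<close>
      define A where "A = {j::nat. 1 \<le> j \<and> 2 ^ j / ?n \<le> r0}"
      have "A \<subseteq> {..nat \<lfloor>?n\<rfloor>}"
      proof
        fix j assume "j \<in> A"
        then have "2 ^ j \<le> r0 * ?n" using n by (simp add: A_def divide_le_eq)
        also have "\<dots> \<le> ?n" using r0 n by (simp add: mult_left_le_one_le)
        finally have "real j \<le> ?n" using of_nat_less_two_power[of j, where 'a = real] by linarith
        then show "j \<in> {..nat \<lfloor>?n\<rfloor>}" by (simp add: le_nat_floor)
      qed
      then have finA: "finite A" by (rule finite_subset) simp
      have "\<forall>j\<in>A. \<exists>E\<in>events. 1 - K2 / ?n * (1 / 2) ^ j \<le> prob E \<and>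
        (\<forall>\<omega>\<in>E. \<forall>w. norm w \<le> 2 ^ j / ?n \<longrightarrow>
          \<bar>(\<Sum>p\<in>I i. lad_remainder (d i) (h i) p w \<omega>) - \<gamma> * (\<Sum>p\<in>I i. (d i p \<bullet> w)\<^sup>2)\<bar>
            \<le> \<kappa> * N i * (2 ^ j / ?n)\<^sup>2 + D * N i * (2 ^ j / ?n) ^ 3)"
      proof
        fix j assume j: "j \<in> A"
        have "K2 / (N i * (2 ^ j / ?n)) = K2 / ?n * (1 / 2) ^ j"
          unfolding s_def[symmetric] unfolding s(2) using s(1) by (simp add: power_one_over field_simps)
        moreover have "0 < 2 ^ j / ?n" using n(1) by simp
        moreover have "2 ^ j / ?n \<le> 1" using j order_trans[OF _ r0(2)] unfolding A_def by blast
        ultimately show "\<exists>E\<in>events. 1 - K2 / ?n * (1 / 2) ^ j \<le> prob E \<and>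
        (\<forall>\<omega>\<in>E. \<forall>w. norm w \<le> 2 ^ j / ?n \<longrightarrow>
          \<bar>(\<Sum>p\<in>I i. lad_remainder (d i) (h i) p w \<omega>) - \<gamma> * (\<Sum>p\<in>I i. (d i p \<bullet> w)\<^sup>2)\<bar>
            \<le> \<kappa> * N i * (2 ^ j / ?n)\<^sup>2 + D * N i * (2 ^ j / ?n) ^ 3)"
          using K2(2)[OF sd IJ fin n(4), of "2 ^ j / ?n"] by simp
      qed
      then obtain Ej where "\<forall>j\<in>A. Ej j \<in> events \<and> 1 - K2 / ?n * (1 / 2) ^ j \<le> prob (Ej j) \<and>
        (\<forall>\<omega>\<in>Ej j. \<forall>w. norm w \<le> 2 ^ j / ?n \<longrightarrow>
          \<bar>(\<Sum>p\<in>I i. lad_remainder (d i) (h i) p w \<omega>) - \<gamma> * (\<Sum>p\<in>I i. (d i p \<bullet> w)\<^sup>2)\<bar>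
            \<le> \<kappa> * N i * (2 ^ j / ?n)\<^sup>2 + D * N i * (2 ^ j / ?n) ^ 3)"
        unfolding Bex_def by (rule bchoice[THEN exE])
      then have Ej: "\<And>j. j \<in> A \<Longrightarrow> Ej j \<in> events" "\<And>j. j \<in> A \<Longrightarrow> 1 - K2 / ?n * (1 / 2) ^ j \<le> prob (Ej j)"
        "\<And>j \<omega> w. j \<in> A \<Longrightarrow> \<omega> \<in> Ej j \<Longrightarrow> norm w \<le> 2 ^ j / ?n \<Longrightarrow>
          \<bar>(\<Sum>p\<in>I i. lad_remainder (d i) (h i) p w \<omega>) - \<gamma> * (\<Sum>p\<in>I i. (d i p \<bullet> w)\<^sup>2)\<bar>
            \<le> \<kappa> * N i * (2 ^ j / ?n)\<^sup>2 + D * N i * (2 ^ j / ?n) ^ 3"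
        by blast+
      obtain E1 where E1: "E1 \<in> events" "1 - (\<Sum>j\<in>A. K2 / ?n * (1 / 2) ^ j) \<le> prob E1" "\<And>\<omega> j. \<omega> \<in> E1 \<Longrightarrow> j \<in> A \<Longrightarrow> \<omega> \<in> Ej j"
        using prob_finite_INT_ge[of A Ej "\<lambda>j. K2 / ?n * (1 / 2) ^ j", OF finA Ej(1) Ej(2)] by auto
      have "(\<Sum>j\<in>A. (1 / 2 :: real) ^ j) \<le> 1"
      proof -
        have "(\<Sum>j\<in>A. (1 / 2 :: real) ^ j) = (\<Sum>j\<in>A. (1 / 2 :: real) ^ Suc (j - 1))"
          by (intro sum.cong refl) (auto simp: A_def)
        also have "\<dots> = (\<Sum>k\<in>(\<lambda>j. j - 1) ` A. (1 / 2 :: real) ^ Suc k)"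
        proof -
          have "inj_on (\<lambda>j. j - 1) A" by (auto simp: inj_on_def A_def)
          then show ?thesis by (simp only: sum.reindex comp_def)
        qed
        also have "\<dots> \<le> (\<Sum>k. (1 / 2 :: real) ^ Suc k)"
          by (intro sum_le_suminf sums_summable[OF power_half_series]) (use finA in auto)
        also have "\<dots> = 1" by (rule sums_unique[OF power_half_series, symmetric])
        finally show ?thesis .
      qed
      from mult_left_mono[OF this, of "K2 / ?n"] have "(\<Sum>j\<in>A. K2 / ?n * (1 / 2) ^ j) \<le> K2 / ?n"
        unfolding sum_distrib_left[symmetric] using K2(1) n(1) by simp
      also have "\<dots> \<le> q / 3" using n(1,3) K2(1) q by (simp add: field_simps)
      finally have E1q: "1 - q / 3 \<le> prob E1" using E1(2) by linarith
      let ?E2 = "{\<omega> \<in> space M. norm (score i \<omega>) \<le> Kw}" and ?E3 = "{\<omega> \<in> space M. norm (what i \<omega>) \<le> r0 / 2}"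
      have [measurable]: "what i \<in> borel_measurable M" by (rule what)
      have E2: "?E2 \<in> events" by measurable
      have E3: "?E3 \<in> events" by measurable
      have "?E3 = space M - {\<omega> \<in> space M. r0 / 2 < norm (what i \<omega>)}" by auto
      then have E3q: "1 - q / 3 \<le> prob ?E3" using elim(4) by (simp add: prob_compl)
      have "1 - (q / 3 + (q / 3 + q / 3)) \<le> prob (E1 \<inter> (?E2 \<inter> ?E3))"
        using E2 E3 by (intro prob_Int_ge E1(1) E1q elim(1) E3q sets.Int)
      moreover have "norm (sqrt (N i) *\<^sub>R what i \<omega>) \<le> K \<and> norm (vstar i \<omega>) \<le> K" if \<omega>: "\<omega> \<in> E1 \<inter> (?E2 \<inter> ?E3)" for \<omega>
      proof
        have \<omega>M: "\<omega> \<in> space M" and sc: "norm (score i \<omega>) \<le> Kw" and small: "norm (what i \<omega>) \<le> r0 / 2" using \<omega> by auto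
        let ?w = "what i \<omega>"
        show "norm (?n *\<^sub>R ?w) \<le> K"
        proof (cases "?n * norm ?w \<le> 1")
          case True
          then show ?thesis by (simp add: K_def)
        next
          case False
          then obtain j where j: "1 \<le> j" "?n * norm ?w \<le> 2 ^ j" "2 ^ j < 2 * (?n * norm ?w)"
            using dyadic_shell[of "?n * norm ?w"] by auto
          define r where "r = 2 ^ j / ?n"
          have r: "norm ?w \<le> r" "r < 2 * norm ?w" "0 < r"
            using j n by (simp_all add: r_def field_simps)
          have rr0: "r \<le> r0" using r small by linarith
          have jA: "j \<in> A" using j rr0 by (simp add: A_def r_def)
          let ?S = "\<Sum>p\<in>I i. lad_remainder (d i) (h i) p ?w \<omega>" and ?G = "\<Sum>p\<in>I i. (d i p \<bullet> ?w)\<^sup>2"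
          have 1: "\<bar>?S - \<gamma> * ?G\<bar> \<le> \<kappa> * N i * r\<^sup>2 + D * N i * r ^ 3"
            using Ej(3)[OF jA E1(3)[OF _ jA], of \<omega> ?w] r(1) \<omega> unfolding r_def by blast
          have r2: "r\<^sup>2 \<le> 4 * (norm ?w)\<^sup>2"
            using power_mono[of r "2 * norm ?w" 2] r by (simp add: power_mult_distrib)
          have "D * r ^ 3 = (D * r) * r\<^sup>2" by (simp add: power2_eq_square power3_eq_cube)
          also have "\<dots> \<le> (b / 32) * (4 * (norm ?w)\<^sup>2)"
          proof (rule mult_mono)
            show "D * r \<le> b / 32" using order_trans[OF mult_left_mono[OF rr0, of D] r0(3)] D by simp
          qed (use r2 b in auto)
          finally have Dr3: "D * r ^ 3 \<le> (b / 32) * (4 * (norm ?w)\<^sup>2)" .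
          have "\<kappa> * r\<^sup>2 + D * r ^ 3 \<le> b / 4 * (norm ?w)\<^sup>2"
          proof -
            have "\<kappa> * r\<^sup>2 \<le> (b / 32) * (4 * (norm ?w)\<^sup>2)"
              unfolding \<kappa>_def using r2 b by (intro mult_left_mono) auto
            then show ?thesis using Dr3 by simp
          qed
          then have 2: "\<kappa> * N i * r\<^sup>2 + D * N i * r ^ 3 \<le> N i * (b / 4 * (norm ?w)\<^sup>2)"
            using mult_left_mono[of "\<kappa> * r\<^sup>2 + D * r ^ 3" "b / 4 * (norm ?w)\<^sup>2" "N i"] by (simp add: algebra_simps)
          have "N i * (norm (L ?w))\<^sup>2 - ?G \<le> c / 8 * N i * (norm ?w)\<^sup>2" using elim(3)[rule_format, of ?w] unfolding abs_le_iff by linarith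
          moreover have "N i * (c * (norm ?w)\<^sup>2) \<le> N i * (norm (L ?w))\<^sup>2" by (rule mult_left_mono[OF c(2)]) simp
          ultimately have "7 / 8 * (N i * (c * (norm ?w)\<^sup>2)) \<le> ?G" by (simp add: mult_ac)
          then have "\<gamma> * (7 / 8 * (N i * (c * (norm ?w)\<^sup>2))) \<le> \<gamma> * ?G" using \<gamma>_pos by (intro mult_left_mono) auto
          then have 3: "7 / 8 * (N i * (b * (norm ?w)\<^sup>2)) \<le> \<gamma> * ?G"
            by (simp add: b_def mult_ac)
          have "(\<Sum>p\<in>I i. \<bar>eps p \<omega> - h i p ?w\<bar> - \<bar>eps p \<omega>\<bar>) \<le> (\<Sum>p\<in>I i. \<bar>eps p \<omega> - h i p 0\<bar> - \<bar>eps p \<omega>\<bar>)"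
            using elim(2) \<omega>M \<delta>(1) by simp
          also have "\<dots> = 0" by (intro sum.neutral ballI) (simp add: smooth_designD(2)[OF sd H])
          finally have "?S \<le> ?n * (score i \<omega> \<bullet> ?w)" using elim(6) by (simp add: lad_difference)
          also have "\<dots> \<le> ?n * (Kw * norm ?w)"
            by (intro mult_left_mono order_trans[OF norm_cauchy_schwarz mult_right_mono[OF sc]]) auto
          finally have 4: "?S \<le> ?n * (Kw * norm ?w)" .
          have "0 \<le> N i * (b * (norm ?w)\<^sup>2)" using b by simp
          moreover have "N i * (b / 4 * (norm ?w)\<^sup>2) = 1 / 4 * (N i * (b * (norm ?w)\<^sup>2))" by simp
          ultimately have "1 / 2 * (N i * (b * (norm ?w)\<^sup>2)) \<le> ?n * (Kw * norm ?w)"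
            using 1 2 3 4 unfolding abs_le_iff by linarith
          moreover have "0 < norm ?w" using r by linarith
          ultimately have "1 / 2 * b * (?n * norm ?w) \<le> Kw"
            unfolding s_def[symmetric] unfolding s(2) using s(1) by (simp add: power2_eq_square field_simps)
          then have "?n * norm ?w \<le> 2 * Kw / b" using b by (simp add: field_simps)
          then show ?thesis by (simp add: K_def)
        qed
        \<comment> \<open>Testing the defining equation of \<open>vstar\<close> with
          \<open>vstar\<close> itself bounds it by the score.\<close>
        have "2 * b * (norm (vstar i \<omega>))\<^sup>2 \<le> 2 * \<gamma> * (norm (L (vstar i \<omega>)))\<^sup>2"
          using c(2)[of "vstar i \<omega>"] \<gamma>_pos by (simp add: b_def mult.assoc)
        also have "\<dots> = score i \<omega> \<bullet> vstar i \<omega>"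
          using vstar[OF \<omega>M, of i "vstar i \<omega>"] by (simp add: score_def power2_norm_eq_inner)
        also have "\<dots> \<le> Kw * norm (vstar i \<omega>)"
          using norm_cauchy_schwarz[of "score i \<omega>" "vstar i \<omega>"] mult_right_mono[OF sc, of "norm (vstar i \<omega>)"] by simp
        finally have "norm (vstar i \<omega>) * (2 * b * norm (vstar i \<omega>)) \<le> norm (vstar i \<omega>) * Kw"
          by (simp add: power2_eq_square mult_ac)
        then have "2 * b * norm (vstar i \<omega>) \<le> Kw" using Kw(1)
          by (cases "vstar i \<omega> = 0") (auto simp: mult_le_cancel_left_pos)
        then have "2 * (2 * b * norm (vstar i \<omega>)) \<le> 4 * (2 * Kw)" using Kw(1) by simp
        then have "norm (vstar i \<omega>) \<le> 2 * Kw / b" using b by (simp add: field_simps)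
        then show "norm (vstar i \<omega>) \<le> K" by (simp add: K_def)
      qed
      ultimately show ?case using E1(1) E2 E3 by (intro bexI[of _ "E1 \<inter> (?E2 \<inter> ?E3)"]) (auto simp: sets.Int)
    qed
  qed
qed

text \<open>Both the scaled estimate and \<open>vstar\<close> lie in a fixed ball, where the
  criterion differs from the quadratic by at most \<open>\<tau>\<close>. Optimality against
  \<open>vstar\<close> then leaves the estimate at most \<open>2 * \<tau>\<close> above the minimum
  of the quadratic, and strong convexity turns this into a distance.\<close>

theorem estimator_linearization:
  assumes \<epsilon>: "0 < \<epsilon>" and q: "0 < q"
  shows "\<forall>\<^sub>F i in F. \<exists>E\<in>events. 1 - q \<le> prob E \<and>
    (\<forall>\<omega>\<in>E. norm (sqrt (N i) *\<^sub>R what i \<omega> - vstar i \<omega>) \<le> \<epsilon>)"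
proof -
  obtain c0 where c0: "0 < c0" "\<And>x. c0 * norm x \<le> norm (L x)" using linear_inj_bounded_below_pos[OF L] by blast
  define c where "c = c0\<^sup>2"
  have c: "0 < c" "\<And>x. c * (norm x)\<^sup>2 \<le> (norm (L x))\<^sup>2"
    using c0 power_mono[OF c0(2), of _ 2] by (auto simp: c_def power_mult_distrib)
  have q2: "0 < q / 2" using q by simp
  obtain K where K: "1 \<le> K" "\<forall>\<^sub>F i in F. \<exists>E\<in>events. 1 - q / 2 \<le> prob E \<and>
    (\<forall>\<omega>\<in>E. norm (sqrt (N i) *\<^sub>R what i \<omega>) \<le> K \<and> norm (vstar i \<omega>) \<le> K)"
    using estimator_tight[OF q2] by blast
  \<comment> \<open>\<open>2 * \<tau>\<close> is \<open>\<gamma> * c * \<epsilon>^2\<close>, a lower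
    bound for the growth of the quadratic at distance \<open>\<epsilon>\<close> from its minimizer.
    \<open>\<tau>\<close> is shared in thirds by the error \<open>\<kappa>\<close>, the cubic error
    with \<open>D\<close> and the Gram error \<open>\<kappa>'\<close>.\<close>
  define \<tau> where "\<tau> = \<gamma> * c * \<epsilon>\<^sup>2 / 2"
  have \<tau>: "0 < \<tau>" using \<gamma>_pos c \<epsilon> by (simp add: \<tau>_def)
  define \<kappa> where "\<kappa> = \<tau> / (3 * K\<^sup>2)"
  define \<kappa>' where "\<kappa>' = \<tau> / (3 * \<gamma> * K\<^sup>2)"
  have \<kappa>: "0 < \<kappa>" "\<kappa> * K\<^sup>2 = \<tau> / 3" using \<tau> K by (simp_all add: \<kappa>_def)
  have \<kappa>': "0 < \<kappa>'" "\<gamma> * \<kappa>' * K\<^sup>2 = \<tau> / 3" using \<tau> K \<gamma>_pos by (simp_all add: \<kappa>'_def)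
  define D where "D = 8 * C * H ^ 3 + 3 * \<gamma> * H\<^sup>2"
  have D: "0 < D" using C_pos H \<gamma>_pos by (simp add: D_def add_pos_pos)
  obtain K2 where K2: "0 < K2"
    "\<And>I (d :: 'p \<Rightarrow> 'b) h (r :: real). smooth_design H I d h \<Longrightarrow> I \<subseteq> J \<Longrightarrow> finite I \<Longrightarrow> I \<noteq> {} \<Longrightarrow> 0 < r \<Longrightarrow> r \<le> 1 \<Longrightarrow>
      \<exists>E\<in>events. 1 - K2 / (real (card I) * r) \<le> prob E \<and>
        (\<forall>\<omega>\<in>E. \<forall>w. norm w \<le> r \<longrightarrow> \<bar>(\<Sum>p\<in>I. lad_remainder d h p w \<omega>) - \<gamma> * (\<Sum>p\<in>I. (d p \<bullet> w)\<^sup>2)\<bar>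
            \<le> \<kappa> * real (card I) * r\<^sup>2 + D * real (card I) * r ^ 3)"
  proof (rule lad_remainder_uniform[OF H \<kappa>(1), where 'b = 'b, folded D_def], goal_cases)
    case (1 K2)
    show ?case by (rule 1(1)[OF 1(2,3)])
  qed
  obtain \<delta> where \<delta>: "0 < \<delta>" "\<forall>\<^sub>F i in F. \<forall>\<omega>\<in>space M. \<forall>w. norm w \<le> \<delta> \<longrightarrow>
      (\<Sum>p\<in>I i. \<bar>eps p \<omega> - h i p (what i \<omega>)\<bar> - \<bar>eps p \<omega>\<bar>) \<le> (\<Sum>p\<in>I i. \<bar>eps p \<omega> - h i p w\<bar> - \<bar>eps p \<omega>\<bar>)"
    using optimal by blast
  \<comment> \<open>\<open>K\<close> makes the radius \<open>K / sqrt (N i)\<close> at most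
    \<open>1\<close>, \<open>K / \<delta>\<close> makes the scaled \<open>vstar\<close> an
    admissible competitor, \<open>2 * K2 / q\<close> bounds the failure probability, and the last
    entry the cubic error.\<close>
  define n0 where "n0 = max (max 1 K) (max (K / \<delta>) (max (2 * K2 / q) (3 * D * K ^ 3 / \<tau>)))"
  show ?thesis
    using K(2) \<delta>(2) gram_uniform[OF \<kappa>'(1)] design N_large[of "n0\<^sup>2"]
  proof eventually_elim
    case (elim i)
    let ?n = "sqrt (N i)"
    have "n0 \<le> ?n" using elim(5) by (rule real_le_rsqrt)
    then have n: "1 \<le> ?n" "K \<le> ?n" "K / \<delta> \<le> ?n" "2 * K2 / q \<le> ?n" "3 * D * K ^ 3 / \<tau> \<le> ?n"
      unfolding n0_def by linarith+
    have ne: "I i \<noteq> {}" using n(1) by auto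
    define s where "s = ?n"
    have s: "1 \<le> s" "N i = s * s" using n(1) by (simp_all add: s_def)
    note sd = elim(4)
    define r where "r = K / ?n"
    have r: "0 < r" "r \<le> 1" "r \<le> \<delta>" using n K \<delta> by (auto simp: r_def field_simps)
    obtain E1 where E1: "E1 \<in> events" "1 - q / 2 \<le> prob E1"
      "\<And>\<omega>. \<omega> \<in> E1 \<Longrightarrow> norm (?n *\<^sub>R what i \<omega>) \<le> K \<and> norm (vstar i \<omega>) \<le> K" using elim(1) by blast
    obtain E2 where E2: "E2 \<in> events" "1 - K2 / (N i * r) \<le> prob E2"
      "\<And>\<omega> w. \<omega> \<in> E2 \<Longrightarrow> norm w \<le> r \<Longrightarrow>
        \<bar>(\<Sum>p\<in>I i. lad_remainder (d i) (h i) p w \<omega>) - \<gamma> * (\<Sum>p\<in>I i. (d i p \<bullet> w)\<^sup>2)\<bar> \<le> \<kappa> * N i * r\<^sup>2 + D * N i * r ^ 3"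
      using K2(2)[OF sd IJ fin ne r(1,2)] by blast
    have "N i * r = ?n * K" unfolding r_def s_def[symmetric] unfolding s(2) using s(1) by simp
    then have "K2 / (N i * r) \<le> K2 / ?n" using K(1) n(1) K2(1) by (simp add: frac_le)
    also have "\<dots> \<le> q / 2" using n q by (simp add: field_simps)
    finally have E2q: "1 - q / 2 \<le> prob E2" using E2(2) by linarith
    have err: "\<kappa> * N i * r\<^sup>2 + D * N i * r ^ 3 \<le> \<tau> / 3 + \<tau> / 3"
    proof -
      have "N i * r\<^sup>2 = K\<^sup>2" unfolding r_def s_def[symmetric] unfolding s(2) using s(1) by (simp add: power2_eq_square)
      moreover have "N i * r ^ 3 = K ^ 3 / ?n" unfolding r_def s_def[symmetric] unfolding s(2) using s(1) by (simp add: power3_eq_cube)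
      moreover have "D * (K ^ 3 / ?n) \<le> \<tau> / 3" using n(1,5) \<tau> by (simp add: field_simps)
      ultimately show ?thesis using \<kappa>(2) by (simp add: mult.assoc)
    qed
    have exp: "\<bar>(\<Sum>p\<in>I i. \<bar>eps p \<omega> - h i p ((1 / ?n) *\<^sub>R v)\<bar> - \<bar>eps p \<omega>\<bar>)
        - (\<gamma> * (norm (L v))\<^sup>2 - 2 * \<gamma> * (L (vstar i \<omega>) \<bullet> L v))\<bar> \<le> \<tau>"
      if "\<omega> \<in> E2" "\<omega> \<in> space M" "norm v \<le> K" for \<omega> v
    proof -
      let ?w = "(1 / ?n) *\<^sub>R v"
      let ?S = "\<Sum>p\<in>I i. lad_remainder (d i) (h i) p ?w \<omega>" and ?G = "\<Sum>p\<in>I i. (d i p \<bullet> ?w)\<^sup>2"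
      have w: "norm ?w \<le> r" using that n by (simp add: r_def divide_right_mono)
      have 1: "\<bar>?S - \<gamma> * ?G\<bar> \<le> \<tau> / 3 + \<tau> / 3" using E2(3)[OF that(1) w] err by linarith
      have a: "N i * (norm (L ?w))\<^sup>2 = (norm (L v))\<^sup>2"
        unfolding linear_scale[OF L(1)] s_def[symmetric] unfolding s(2) using s(1) by (simp add: power_mult_distrib power2_eq_square)
      have b: "\<kappa>' * N i * (norm ?w)\<^sup>2 = \<kappa>' * (norm v)\<^sup>2"
        unfolding s_def[symmetric] unfolding s(2) using s(1) by (simp add: power_mult_distrib power2_eq_square)
      have "\<kappa>' * (norm v)\<^sup>2 \<le> \<kappa>' * K\<^sup>2" using that \<kappa>' by (intro mult_left_mono power_mono) auto
      moreover have "\<bar>?G - N i * (norm (L ?w))\<^sup>2\<bar> \<le> \<kappa>' * N i * (norm ?w)\<^sup>2" using elim(3) by blast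
      ultimately have "\<bar>?G - (norm (L v))\<^sup>2\<bar> \<le> \<kappa>' * K\<^sup>2" unfolding a b by linarith
      then have "\<gamma> * \<bar>?G - (norm (L v))\<^sup>2\<bar> \<le> \<gamma> * (\<kappa>' * K\<^sup>2)"
        using \<gamma>_pos by (intro mult_left_mono) auto
      also have "\<dots> = \<tau> / 3" using \<kappa>'(2) by (simp only: mult.assoc)
      finally have "\<gamma> * \<bar>?G - (norm (L v))\<^sup>2\<bar> \<le> \<tau> / 3" .
      then have 2: "\<bar>\<gamma> * ?G - \<gamma> * (norm (L v))\<^sup>2\<bar> \<le> \<tau> / 3"
        using \<gamma>_pos by (simp add: abs_mult right_diff_distrib[symmetric])
      have "?n * (score i \<omega> \<bullet> ?w) = score i \<omega> \<bullet> v" using n(1) by simp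
      also have "\<dots> = 2 * \<gamma> * (L (vstar i \<omega>) \<bullet> L v)" using vstar[OF that(2), of i v] by (simp add: score_def)
      finally have 3: "?n * (score i \<omega> \<bullet> ?w) = 2 * \<gamma> * (L (vstar i \<omega>) \<bullet> L v)" .
      have "0 < N i" using n(1) by simp
      then have "(\<Sum>p\<in>I i. \<bar>eps p \<omega> - h i p ?w\<bar> - \<bar>eps p \<omega>\<bar>) = ?S - 2 * \<gamma> * (L (vstar i \<omega>) \<bullet> L v)"
        unfolding 3[symmetric] by (rule lad_difference)
      then show ?thesis using 1 2 by linarith
    qed
    have "1 - (q / 2 + q / 2) \<le> prob (E1 \<inter> E2)" by (intro prob_Int_ge E1 E2(1) E2q)
    moreover have "norm (?n *\<^sub>R what i \<omega> - vstar i \<omega>) \<le> \<epsilon>" if \<omega>: "\<omega> \<in> E1 \<inter> E2" for \<omega>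
    proof -
      have \<omega>M: "\<omega> \<in> space M" using \<omega> E1(1) sets.sets_into_space by blast
      let ?v = "?n *\<^sub>R what i \<omega>" and ?s = "vstar i \<omega>"
      have eq: "(norm (L (?v - ?s)))\<^sup>2 = (norm (L ?v))\<^sup>2 - 2 * (L ?s \<bullet> L ?v) + (norm (L ?s))\<^sup>2"
        unfolding power2_norm_eq_inner linear_diff[OF L(1)]
        by (simp add: inner_diff_left inner_diff_right inner_commute)
      have v: "norm ?v \<le> K" "norm ?s \<le> K" using E1(3) \<omega> by auto
      have "norm ((1 / ?n) *\<^sub>R ?s) \<le> \<delta>"
        using v(2) n r(3) order_trans[of "norm ?s / ?n" "K / ?n" \<delta>] by (simp add: r_def divide_right_mono)
      then have "(\<Sum>p\<in>I i. \<bar>eps p \<omega> - h i p (what i \<omega>)\<bar> - \<bar>eps p \<omega>\<bar>) \<le> (\<Sum>p\<in>I i. \<bar>eps p \<omega> - h i p ((1 / ?n) *\<^sub>R ?s)\<bar> - \<bar>eps p \<omega>\<bar>)"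
        using elim(2) \<omega>M by blast
      moreover have "what i \<omega> = (1 / ?n) *\<^sub>R ?v" using n(1) by auto
      ultimately have "(\<Sum>p\<in>I i. \<bar>eps p \<omega> - h i p ((1 / ?n) *\<^sub>R ?v)\<bar> - \<bar>eps p \<omega>\<bar>) \<le> (\<Sum>p\<in>I i. \<bar>eps p \<omega> - h i p ((1 / ?n) *\<^sub>R ?s)\<bar> - \<bar>eps p \<omega>\<bar>)"
        by simp
      \<comment> \<open>The criterion at both points is traded for the quadratic, at a cost of
        \<open>\<tau>\<close> each; completing the square gives the distance in the norm of
        \<open>L\<close>.\<close>
      then have "\<gamma> * (norm (L ?v))\<^sup>2 - 2 * \<gamma> * (L ?s \<bullet> L ?v) \<le> \<gamma> * (norm (L ?s))\<^sup>2 - 2 * \<gamma> * (L ?s \<bullet> L ?s) + 2 * \<tau>"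
        using exp[OF IntD2[OF \<omega>] \<omega>M v(1)] exp[OF IntD2[OF \<omega>] \<omega>M v(2)] unfolding abs_le_iff by linarith
      moreover have "\<gamma> * (norm (L (?v - ?s)))\<^sup>2 = \<gamma> * (norm (L ?v))\<^sup>2 - 2 * \<gamma> * (L ?s \<bullet> L ?v) + \<gamma> * (norm (L ?s))\<^sup>2"
        unfolding eq by (simp add: algebra_simps)
      moreover have "\<gamma> * (norm (L ?s))\<^sup>2 - 2 * \<gamma> * (L ?s \<bullet> L ?s) = - (\<gamma> * (norm (L ?s))\<^sup>2)"
        by (simp add: power2_norm_eq_inner)
      ultimately have "\<gamma> * (norm (L (?v - ?s)))\<^sup>2 \<le> 2 * \<tau>" by linarith
      moreover have "\<gamma> * (c * (norm (?v - ?s))\<^sup>2) \<le> \<gamma> * (norm (L (?v - ?s)))\<^sup>2"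
        by (rule mult_left_mono[OF c(2)]) (use \<gamma>_pos in simp)
      ultimately have "(\<gamma> * c) * (norm (?v - ?s))\<^sup>2 \<le> (\<gamma> * c) * \<epsilon>\<^sup>2"
        by (simp add: \<tau>_def mult.assoc)
      then have "(norm (?v - ?s))\<^sup>2 \<le> \<epsilon>\<^sup>2" using \<gamma>_pos c(1) by (simp add: mult_le_cancel_left_pos)
      then show ?thesis by (rule power2_le_imp_le) (use \<epsilon> in simp)
    qed
    ultimately show ?case by (intro bexI[of _ "E1 \<inter> E2"] conjI ballI sets.Int E1(1) E2(1)) simp_all
  qed
qed

end

section \<open>Gaussian limit of the score through products of cosines\<close>

lemma cos_exp_diff_le:
  fixes x :: real
  shows "\<bar>cos x - exp (- x\<^sup>2 / 2)\<bar> \<le> x ^ 4"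
proof -
  \<comment> \<open>\<open>1 - x^2 / 2\<close> is the common expansion: the Taylor remainder of the
    cosine is at most \<open>x^4 / 24\<close>, that of the exponential, with
    \<open>y = x^2 / 2\<close>, at most \<open>y^2 = x^4 / 4\<close>.\<close>
  obtain t where "cos x = (\<Sum>m<4. cos_coeff m * x ^ m) + cos (t + 1 / 2 * real 4 * pi) / fact 4 * x ^ 4"
    using Maclaurin_cos_expansion[of x 4] by auto
  moreover have "(\<Sum>m<4. cos_coeff m * x ^ m) = 1 - x\<^sup>2 / 2"
  proof -
    have "(\<Sum>m<4. f m) = f 0 + f 1 + f 2 + f 3" for f :: "nat \<Rightarrow> real"
      by (simp add: eval_nat_numeral)
    then show ?thesis by (simp add: cos_coeff_def)
  qed
  ultimately have "cos x - (1 - x\<^sup>2 / 2) = cos (t + 1 / 2 * real 4 * pi) / fact 4 * x ^ 4" by simp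
  then have "\<bar>cos x - (1 - x\<^sup>2 / 2)\<bar> = \<bar>cos (t + 1 / 2 * real 4 * pi)\<bar> / fact 4 * x ^ 4"
    by (simp add: abs_mult)
  also have "\<dots> \<le> 1 / fact 4 * x ^ 4"
    by (intro mult_right_mono divide_right_mono) auto
  also have "\<dots> \<le> x ^ 4 / 2" by (simp add: fact_numeral)
  finally have 1: "\<bar>cos x - (1 - x\<^sup>2 / 2)\<bar> \<le> x ^ 4 / 2" .
  define y where "y = x\<^sup>2 / 2"
  have y: "0 \<le> y" by (simp add: y_def)
  have "exp (- y) \<le> 1 / (1 + y)"
    using exp_ge_add_one_self[of y] y by (simp add: exp_minus inverse_eq_divide frac_le)
  also have "\<dots> \<le> 1 - y + y\<^sup>2"
  proof -
    have "1 \<le> (1 - y + y\<^sup>2) * (1 + y)" using y by (simp add: power2_eq_square algebra_simps)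
    then show ?thesis using y by (simp add: divide_le_eq)
  qed
  finally have "exp (- y) \<le> 1 - y + y\<^sup>2" .
  moreover have "1 - y \<le> exp (- y)" using exp_ge_add_one_self[of "- y"] by simp
  ultimately have "\<bar>exp (- y) - (1 - y)\<bar> \<le> y\<^sup>2" by linarith
  moreover have "y\<^sup>2 = x ^ 4 / 4" by (simp add: y_def power2_eq_square eval_nat_numeral)
  moreover have "- x\<^sup>2 / 2 = - y" "1 - x\<^sup>2 / 2 = 1 - y" by (simp_all add: y_def)
  moreover have "0 \<le> x ^ 4" by simp
  ultimately show ?thesis using 1 by (simp only:)
qed

text \<open>Cosines and Gaussian factors have modulus at most one, so the products differ by at most
  the sum of the factorwise differences, hence by at most the sum of the fourth powers of the
  \<open>a i p\<close>, which is at most \<open>(m i)^2\<close> times the sum of squares.\<close>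

lemma prod_cos_limit:
  fixes a :: "'i \<Rightarrow> 'p \<Rightarrow> real"
  assumes fin: "\<And>i. finite (I i)" and small: "\<forall>\<^sub>F i in F. \<forall>p\<in>I i. \<bar>a i p\<bar> \<le> m i" and m: "(m \<longlongrightarrow> 0) F"
    and sq: "((\<lambda>i. \<Sum>p\<in>I i. (a i p)\<^sup>2) \<longlongrightarrow> s) F"
  shows "((\<lambda>i. \<Prod>p\<in>I i. cos (a i p)) \<longlongrightarrow> exp (- s / 2)) F"
proof -
  have "((\<lambda>i. exp (- (\<Sum>p\<in>I i. (a i p)\<^sup>2) / 2)) \<longlongrightarrow> exp (- s / 2)) F"
    by (intro tendsto_intros sq) simp
  moreover have "((\<lambda>i. (\<Prod>p\<in>I i. cos (a i p)) - exp (- (\<Sum>p\<in>I i. (a i p)\<^sup>2) / 2)) \<longlongrightarrow> 0) F"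
  proof (rule Lim_null_comparison)
    show "((\<lambda>i. (m i)\<^sup>2 * (\<Sum>p\<in>I i. (a i p)\<^sup>2)) \<longlongrightarrow> 0) F"
      using tendsto_mult[OF tendsto_power[OF m, of 2] sq] by simp
    show "\<forall>\<^sub>F i in F. norm ((\<Prod>p\<in>I i. cos (a i p)) - exp (- (\<Sum>p\<in>I i. (a i p)\<^sup>2) / 2))
      \<le> (m i)\<^sup>2 * (\<Sum>p\<in>I i. (a i p)\<^sup>2)"
      using small
    proof eventually_elim
      case (elim i)
      have "exp (- (\<Sum>p\<in>I i. (a i p)\<^sup>2) / 2) = (\<Prod>p\<in>I i. exp (- (a i p)\<^sup>2 / 2))"
        using fin by (simp add: exp_sum[symmetric] sum_divide_distrib sum_negf)
      then have "norm ((\<Prod>p\<in>I i. cos (a i p)) - exp (- (\<Sum>p\<in>I i. (a i p)\<^sup>2) / 2))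
        \<le> (\<Sum>p\<in>I i. norm (cos (a i p) - exp (- (a i p)\<^sup>2 / 2)))"
        by (simp only:) (intro norm_prod_diff, auto)
      also have "\<dots> \<le> (\<Sum>p\<in>I i. (m i)\<^sup>2 * (a i p)\<^sup>2)"
      proof (rule sum_mono)
        fix p assume "p \<in> I i"
        then have "(a i p)\<^sup>2 \<le> (m i)\<^sup>2" using elim power_mono[of "\<bar>a i p\<bar>" "m i" 2] by simp
        then have "(a i p)\<^sup>2 * (a i p)\<^sup>2 \<le> (m i)\<^sup>2 * (a i p)\<^sup>2" by (intro mult_right_mono) auto
        then show "norm (cos (a i p) - exp (- (a i p)\<^sup>2 / 2)) \<le> (m i)\<^sup>2 * (a i p)\<^sup>2"
          using cos_exp_diff_le[of "a i p"] by (simp add: power_add[symmetric])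
      qed
      finally show ?case by (simp add: sum_distrib_left)
    qed
  qed
  ultimately show ?thesis using tendsto_add by fastforce
qed

text \<open>A centred sign that is almost surely nonzero takes the values \<open>1\<close> and
  \<open>-1\<close> with equal weight, so each factor of the characteristic function is exactly
  \<open>cos (a p)\<close>; independence multiplies them.\<close>

lemma (in median_noise) sign_sum_cos:
  assumes IJ: "I \<subseteq> J" and fin: "finite I"
  shows "expectation (\<lambda>\<omega>. cos ((\<Sum>p\<in>I. a p * sgn (eps p \<omega>)) + b)) = cos b * (\<Prod>p\<in>I. cos (a p))"
proof -
  have m: "(\<lambda>e. cis (a p * sgn e)) \<in> borel_measurable borel" for p
    unfolding cis_conv_exp by measurable
  have Xm: "(\<lambda>\<omega>. cis (a p * sgn (eps p \<omega>))) \<in> borel_measurable M" if "p \<in> I" for p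
    by (rule measurable_compose[OF eps_measurable m]) (use that IJ in blast)
  have int: "integrable M (\<lambda>\<omega>. cis (a p * sgn (eps p \<omega>)))" if "p \<in> I" for p
    using Xm[OF that] by (intro integrable_const_bound[where B = 1]) auto
  have one: "expectation (\<lambda>\<omega>. cis (a p * sgn (eps p \<omega>))) = of_real (cos (a p))" if "p \<in> I" for p
  proof -
    have pJ: "p \<in> J" using that IJ by blast
    have "expectation (\<lambda>\<omega>. cis (a p * sgn (eps p \<omega>)))
      = expectation (\<lambda>\<omega>. of_real (cos (a p)) + \<i> * of_real (sin (a p)) * of_real (sgn (eps p \<omega>)))"
    proof (rule integral_cong_AE)
      show "AE \<omega> in M. cis (a p * sgn (eps p \<omega>)) = of_real (cos (a p)) + \<i> * of_real (sin (a p)) * of_real (sgn (eps p \<omega>))"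
        using nonzero[OF pJ] by eventually_elim (auto simp: sgn_if complex_eq_iff)
    qed (use Xm[OF that] eps_measurable[OF pJ] in auto)
    also have "\<dots> = of_real (cos (a p)) + \<i> * of_real (sin (a p)) * of_real (expectation (\<lambda>\<omega>. sgn (eps p \<omega>)))"
      using integrable_sgn[OF pJ] by (simp add: prob_space)
    finally show ?thesis by (simp add: sgn_mean[OF pJ])
  qed
  have cis_sum: "cis (\<Sum>p\<in>B. f p) = (\<Prod>p\<in>B. cis (f p))" if "finite B" for f and B :: "'p set"
    using that by (induction B) (auto simp: cis_mult[symmetric])
  have "indep_vars (\<lambda>_. borel) (\<lambda>p \<omega>. cis (a p * sgn (eps p \<omega>))) I"
    by (rule indep_vars_compose2[OF indep_vars_subset[OF indep IJ], of "\<lambda>p e. cis (a p * sgn e)"]) (rule m)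
  then have P: "expectation (\<lambda>\<omega>. \<Prod>p\<in>I. cis (a p * sgn (eps p \<omega>))) = (\<Prod>p\<in>I. of_real (cos (a p)))"
    using fin int one by (simp add: indep_vars_lebesgue_integral)
  have Pint: "integrable M (\<lambda>\<omega>. cis b * (\<Prod>p\<in>I. cis (a p * sgn (eps p \<omega>))))"
    by (intro integrable_const_bound[where B = 1] borel_measurable_times borel_measurable_prod borel_measurable_const Xm)
      (auto simp: norm_mult prod_norm[symmetric])
  have "expectation (\<lambda>\<omega>. cos ((\<Sum>p\<in>I. a p * sgn (eps p \<omega>)) + b))
    = expectation (\<lambda>\<omega>. Re (cis b * (\<Prod>p\<in>I. cis (a p * sgn (eps p \<omega>)))))"
    unfolding cis_sum[OF fin, symmetric] by (simp add: cis_mult add.commute)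
  also have "\<dots> = Re (expectation (\<lambda>\<omega>. cis b * (\<Prod>p\<in>I. cis (a p * sgn (eps p \<omega>)))))"
    by (rule integral_Re[OF Pint])
  also have "\<dots> = Re (cis b * (\<Prod>p\<in>I. of_real (cos (a p))))" by (simp add: P)
  also have "\<dots> = cos b * (\<Prod>p\<in>I. cos (a p))"
    by (simp add: of_real_prod[symmetric] del: of_real_prod)
  finally show ?thesis .
qed

context lad_array
begin

lemma score_cos_limit:
  "((\<lambda>i. expectation (\<lambda>\<omega>. cos (score i \<omega> \<bullet> z + b))) \<longlongrightarrow> cos b * exp (- (norm (L z))\<^sup>2 / 2)) F"
proof -
  define a where "a = (\<lambda>i p. (d i p \<bullet> z) / sqrt (N i))"
  have "score i \<omega> \<bullet> z = (\<Sum>p\<in>I i. a i p * sgn (eps p \<omega>))" for i \<omega>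
    by (simp add: score_def a_def inner_sum_left sum_distrib_left mult_ac)
  then have E: "expectation (\<lambda>\<omega>. cos (score i \<omega> \<bullet> z + b)) = cos b * (\<Prod>p\<in>I i. cos (a i p))" for i
    by (simp add: sign_sum_cos[OF IJ fin])
  have "((\<lambda>i. \<Prod>p\<in>I i. cos (a i p)) \<longlongrightarrow> exp (- (norm (L z))\<^sup>2 / 2)) F"
  proof (rule prod_cos_limit[OF fin])
    show "\<forall>\<^sub>F i in F. \<forall>p\<in>I i. \<bar>a i p\<bar> \<le> H * norm z / sqrt (N i)"
      using design
    proof eventually_elim
      case (elim i)
      show ?case
        using smooth_designD(4)[OF elim H] by (auto simp: a_def intro!: divide_right_mono)
    qed
    have "filterlim (\<lambda>i. sqrt (N i)) at_top F"
      by (rule filterlim_compose[OF sqrt_at_top card])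
    then show "((\<lambda>i. H * norm z / sqrt (N i)) \<longlongrightarrow> 0) F"
      by (rule real_tendsto_divide_at_top[OF tendsto_const])
    have "(\<Sum>p\<in>I i. (a i p)\<^sup>2) = (\<Sum>p\<in>I i. (d i p \<bullet> z)\<^sup>2) / N i" for i
      by (simp add: a_def power_divide sum_divide_distrib)
    then show "((\<lambda>i. \<Sum>p\<in>I i. (a i p)\<^sup>2) \<longlongrightarrow> (norm (L z))\<^sup>2) F" using gram[of z] by simp
  qed
  then show ?thesis unfolding E by (intro tendsto_intros)
qed

text \<open>\<open>z\<close> represents the functional \<open>u\<close> for the inner product
  \<open>2 * \<gamma> * (L x \<bullet> L y)\<close>, so that \<open>u \<bullet> vstar\<close> is
  \<open>score \<bullet> z\<close>; the linearization then transfers the limit, cosines being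
  bounded and Lipschitz.\<close>

theorem estimator_cos_limit:
  assumes uz: "\<And>x. u \<bullet> x = 2 * \<gamma> * (L x \<bullet> L z)"
  shows "((\<lambda>i. expectation (\<lambda>\<omega>. cos (u \<bullet> (sqrt (N i) *\<^sub>R what i \<omega>) + b)))
    \<longlongrightarrow> cos b * exp (- (norm (L z))\<^sup>2 / 2)) F"
proof -
  have uv: "u \<bullet> vstar i \<omega> = score i \<omega> \<bullet> z" if "\<omega> \<in> space M" for i \<omega>
    using vstar[OF that, of i z] uz[of "vstar i \<omega>"] by (simp add: score_def)
  have cm: "(\<lambda>\<omega>. cos (u \<bullet> (sqrt (N i) *\<^sub>R what i \<omega>) + b)) \<in> borel_measurable M" for i
    using what[of i] by measurable
  have sm: "(\<lambda>\<omega>. cos (score i \<omega> \<bullet> z + b)) \<in> borel_measurable M" for i by measurable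
  have "((\<lambda>i. expectation (\<lambda>\<omega>. cos (u \<bullet> (sqrt (N i) *\<^sub>R what i \<omega>) + b)) - expectation (\<lambda>\<omega>. cos (score i \<omega> \<bullet> z + b))) \<longlongrightarrow> 0) F"
  proof (rule tendstoI)
    fix e :: real assume e: "0 < e"
    \<comment> \<open>On the good event the cosines differ by at most
      \<open>norm u * \<epsilon> \<le> e / 4\<close>, off it by at most \<open>2\<close> with
      probability at most \<open>e / 8\<close>: together \<open>e / 2\<close>.\<close>
    define \<epsilon> where "\<epsilon> = e / (4 * (norm u + 1))"
    have \<epsilon>: "0 < \<epsilon>" "norm u * \<epsilon> \<le> e / 4"
      using e by (auto simp: \<epsilon>_def field_simps add_pos_nonneg)
    have "0 < e / 8" using e by simp
    from estimator_linearization[OF \<epsilon>(1) this]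
    show "\<forall>\<^sub>F i in F. dist (expectation (\<lambda>\<omega>. cos (u \<bullet> (sqrt (N i) *\<^sub>R what i \<omega>) + b)) - expectation (\<lambda>\<omega>. cos (score i \<omega> \<bullet> z + b))) 0 < e"
    proof eventually_elim
      case (elim i)
      then obtain E where E: "E \<in> events" "1 - e / 8 \<le> prob E"
        "\<And>\<omega>. \<omega> \<in> E \<Longrightarrow> norm (sqrt (N i) *\<^sub>R what i \<omega> - vstar i \<omega>) \<le> \<epsilon>" by blast
      let ?f = "\<lambda>\<omega>. cos (u \<bullet> (sqrt (N i) *\<^sub>R what i \<omega>) + b)" and ?g = "\<lambda>\<omega>. cos (score i \<omega> \<bullet> z + b)"
      have int: "integrable M ?f" "integrable M ?g"
        by (rule integrable_const_bound[where B = 1], simp, rule cm)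
          (rule integrable_const_bound[where B = 1], simp, rule sm)
      have ind: "integrable M (\<lambda>\<omega>. e / 4 + 2 * indicator (space M - E) \<omega>)"
        using E(1) by (intro Bochner_Integration.integrable_add integrable_mult_right integrable_const integrable_const_bound[where B = 1 and f = "indicator (space M - E)"]) auto
      have "\<bar>expectation ?f - expectation ?g\<bar> = \<bar>expectation (\<lambda>\<omega>. ?f \<omega> - ?g \<omega>)\<bar>" using int by simp
      also have "\<dots> \<le> expectation (\<lambda>\<omega>. \<bar>?f \<omega> - ?g \<omega>\<bar>)" by (rule integral_abs_bound)
      also have "\<dots> \<le> expectation (\<lambda>\<omega>. e / 4 + 2 * indicator (space M - E) \<omega>)"
      proof (rule integral_mono[OF _ ind])
        show "integrable M (\<lambda>\<omega>. \<bar>?f \<omega> - ?g \<omega>\<bar>)" using int by simp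
        fix \<omega> assume \<omega>: "\<omega> \<in> space M"
        show "\<bar>?f \<omega> - ?g \<omega>\<bar> \<le> e / 4 + 2 * indicator (space M - E) \<omega>"
        proof (cases "\<omega> \<in> E")
          case True
          note abs_cos_diff_le[of "u \<bullet> (sqrt (N i) *\<^sub>R what i \<omega>) + b" "u \<bullet> vstar i \<omega> + b"]
          then have "\<bar>?f \<omega> - ?g \<omega>\<bar> \<le> \<bar>u \<bullet> (sqrt (N i) *\<^sub>R what i \<omega> - vstar i \<omega>)\<bar>"
            by (simp add: uv[OF \<omega>] inner_diff_right)
          also have "\<dots> \<le> norm u * \<epsilon>"
            by (rule order_trans[OF Cauchy_Schwarz_ineq2 mult_left_mono[OF E(3)[OF True]]]) simp
          finally show ?thesis using \<epsilon>(2) True by simp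
        next
          case False
          have "\<bar>?f \<omega>\<bar> \<le> 1" "\<bar>?g \<omega>\<bar> \<le> 1" by simp_all
          then have "\<bar>?f \<omega> - ?g \<omega>\<bar> \<le> 2" by linarith
          then show ?thesis using False \<omega> e by simp
        qed
      qed
      also have "\<dots> = e / 4 + 2 * prob (space M - E)"
        using E(1) by (subst Bochner_Integration.integral_add)
          (auto simp: prob_space Int_absorb2 Diff_subset intro!: integrable_mult_right integrable_const_bound[where B = 1 and f = "indicator (space M - E)"])
      also have "\<dots> \<le> e / 2" using E(2) prob_compl[OF E(1)] by simp
      also have "\<dots> < e" using e by simp
      finally show ?case by (simp add: dist_real_def)
    qed
  qed
  from tendsto_add[OF this score_cos_limit[of z b]] show ?thesis by simp
qed

lemma estimator_tight':
  assumes q: "0 < q"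
  shows "\<exists>K. \<forall>\<^sub>F i in F. prob {\<omega> \<in> space M. K < norm (sqrt (N i) *\<^sub>R what i \<omega>)} \<le> q"
proof -
  obtain K where K: "1 \<le> K" "\<forall>\<^sub>F i in F. \<exists>E\<in>events. 1 - q \<le> prob E \<and>
    (\<forall>\<omega>\<in>E. norm (sqrt (N i) *\<^sub>R what i \<omega>) \<le> K \<and> norm (vstar i \<omega>) \<le> K)"
    by (rule estimator_tight[OF q])
  have "\<forall>\<^sub>F i in F. prob {\<omega> \<in> space M. K < norm (sqrt (N i) *\<^sub>R what i \<omega>)} \<le> q"
    using K(2)
  proof eventually_elim
    case (elim i)
    then obtain E where E: "E \<in> events" "1 - q \<le> prob E" "\<And>\<omega>. \<omega> \<in> E \<Longrightarrow> norm (sqrt (N i) *\<^sub>R what i \<omega>) \<le> K" by blast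
    have "prob {\<omega> \<in> space M. K < norm (sqrt (N i) *\<^sub>R what i \<omega>)} \<le> prob (space M - E)"
    proof (rule finite_measure_mono)
      show "{\<omega> \<in> space M. K < norm (sqrt (N i) *\<^sub>R what i \<omega>)} \<subseteq> space M - E"
      proof
        fix \<omega> assume "\<omega> \<in> {\<omega> \<in> space M. K < norm (sqrt (N i) *\<^sub>R what i \<omega>)}"
        then show "\<omega> \<in> space M - E" using E(3)[of \<omega>] by (auto simp: not_le[symmetric])
      qed
    qed (use E(1) in auto)
    then show ?case using E(2) prob_compl[OF E(1)] by simp
  qed
  then show ?thesis ..
qed

end

section \<open>Noise with a Lipschitz density\<close>

lemma lad_excess_minus: "lad_excess (- e) (- h) = lad_excess e h"
  by (auto simp: lad_excess_def abs_if sgn_if)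

lemma lad_excess_lborel_pos:
  assumes "0 \<le> h"
  shows "has_bochner_integral lborel (\<lambda>x. lad_excess x h) (h\<^sup>2)"
proof -
  have "has_bochner_integral lborel (\<lambda>x. (2 * (h - x)) * indicator {0..h} x) ((2 * h * h - h\<^sup>2) - (2 * h * 0 - 0\<^sup>2))"
    by (rule has_bochner_integral_FTC_Icc_real[OF assms]) (auto intro!: derivative_eq_intros continuous_intros)
  \<comment> \<open>For \<open>h > 0\<close> the two sides differ at \<open>x = 0\<close>, where the
    excess is \<open>h\<close> and the triangle has height \<open>2 * h\<close>.\<close>
  moreover have "AE x in lborel. (2 * (h - x)) * indicator {0..h} x = lad_excess x h"
    using AE_lborel_singleton[of "0 :: real"]
  proof eventually_elim
    case (elim x)
    then show ?case using assms by (auto simp: lad_excess_def indicator_def abs_if sgn_if split: if_splits)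
  qed
  ultimately have "has_bochner_integral lborel (\<lambda>x. lad_excess x h) ((2 * h * h - h\<^sup>2) - (2 * h * 0 - 0\<^sup>2))"
    by (subst has_bochner_integral_cong_AE[symmetric]) auto
  then show ?thesis by (simp add: power2_eq_square)
qed

lemma lad_excess_lborel: "has_bochner_integral lborel (\<lambda>x. lad_excess x h) (h\<^sup>2)"
proof (cases "0 \<le> h")
  case True
  then show ?thesis by (rule lad_excess_lborel_pos)
next
  case False
  then have 1: "has_bochner_integral lborel (\<lambda>x. lad_excess x (- h)) ((- h)\<^sup>2)" by (intro lad_excess_lborel_pos) simp
  have "has_bochner_integral lborel (\<lambda>x. lad_excess (0 + - 1 * x) (- h)) ((- h)\<^sup>2)"
    using lborel_has_bochner_integral_real_affine_iff[of "- 1" "\<lambda>x. lad_excess x (- h)" "(- h)\<^sup>2" 0] 1 by simp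
  then show ?thesis using lad_excess_minus[of _ h] by simp
qed

text \<open>The excess, as a function of the noise, has integral \<open>h^2\<close> and is supported
  in \<open>\<bar>x\<bar> \<le> \<bar>h\<bar>\<close>, where \<open>g\<close> stays within
  \<open>B * \<bar>h\<bar>\<close> of \<open>g 0\<close>: this gives the curvature
  \<open>g 0\<close> and the cubic error.\<close>

lemma density_small_ball_curvature:
  fixes g :: "real \<Rightarrow> real"
  assumes "prob_space M" and X: "distributed M lborel X (\<lambda>x. ennreal (g x))" and g0: "\<And>x. 0 \<le> g x"
    and cont: "continuous_on UNIV g" and lip: "\<And>x. \<bar>g x - g 0\<bar> \<le> B * \<bar>x\<bar>" and B: "0 \<le> B"
  shows "0 \<le> x \<Longrightarrow> measure M {\<omega> \<in> space M. \<bar>X \<omega>\<bar> \<le> x} \<le> (2 * (g 0 + B) + 1) * x"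
    and "\<bar>(\<integral>\<omega>. lad_excess (X \<omega>) h \<partial>M) - g 0 * h\<^sup>2\<bar> \<le> B * \<bar>h\<bar> ^ 3"
proof -
  interpret prob_space M by fact
  have Xm[measurable]: "X \<in> borel_measurable M" using distributed_measurable[OF X] by simp
  have gm[measurable]: "g \<in> borel_measurable borel" using cont by (rule borel_measurable_continuous_onI)
  show "prob {\<omega> \<in> space M. \<bar>X \<omega>\<bar> \<le> x} \<le> (2 * (g 0 + B) + 1) * x" if x: "0 \<le> x"
  proof (cases "x \<le> 1")
    case True
    have "emeasure M {\<omega> \<in> space M. \<bar>X \<omega>\<bar> \<le> x} = emeasure M (X -` {-x..x} \<inter> space M)"
      by (intro arg_cong[where f = "emeasure M"]) auto
    also have "\<dots> = (\<integral>\<^sup>+y. ennreal (g y) * indicator {-x..x} y \<partial>lborel)"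
      using X by (intro distributed_emeasure) auto
    also have "\<dots> \<le> (\<integral>\<^sup>+y. ennreal (g 0 + B) * indicator {-x..x} y \<partial>lborel)"
    proof (rule nn_integral_mono)
      fix y
      have "g y \<le> g 0 + B" if "\<bar>y\<bar> \<le> x"
      proof -
        have "B * \<bar>y\<bar> \<le> B * 1" using B that True by (intro mult_left_mono) auto
        then show ?thesis using lip[of y] by simp
      qed
      then show "ennreal (g y) * indicator {-x..x} y \<le> ennreal (g 0 + B) * indicator {-x..x} y"
        by (auto simp: indicator_def intro!: ennreal_leI)
    qed
    also have "\<dots> = ennreal (g 0 + B) * ennreal (2 * x)"
      using x by (simp add: nn_integral_cmult_indicator)
    also have "\<dots> = ennreal ((g 0 + B) * (2 * x))"
      using x B g0[of 0] by (simp add: ennreal_mult)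
    finally have "prob {\<omega> \<in> space M. \<bar>X \<omega>\<bar> \<le> x} \<le> (g 0 + B) * (2 * x)"
      using x B g0[of 0] by (simp add: emeasure_eq_measure ennreal_le_iff)
    then show ?thesis using x by (simp add: algebra_simps)
  next
    case False
    \<comment> \<open>For \<open>x > 1\<close> the trivial bound \<open>1 < x\<close> is used; the
      \<open>+ 1\<close> in the constant is there for it.\<close>
    have "prob {\<omega> \<in> space M. \<bar>X \<omega>\<bar> \<le> x} \<le> 1" by simp
    also have "1 \<le> 1 * x" using False by simp
    also have "\<dots> \<le> (2 * (g 0 + B) + 1) * x" using x B g0[of 0] by (intro mult_right_mono) auto
    finally show ?thesis .
  qed
  have R: "integrable lborel (\<lambda>x. lad_excess x h)" "(\<integral>x. lad_excess x h \<partial>lborel) = h\<^sup>2"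
    using lad_excess_lborel[of h] by (auto simp: has_bochner_integral_iff)
  have gR: "\<bar>g x * lad_excess x h - g 0 * lad_excess x h\<bar> \<le> B * \<bar>h\<bar> * lad_excess x h" for x
  proof (cases "\<bar>h\<bar> \<le> \<bar>x\<bar>")
    case True
    then show ?thesis by (simp add: lad_excess_eq_0)
  next
    case False
    have "\<bar>g x * lad_excess x h - g 0 * lad_excess x h\<bar> = \<bar>g x - g 0\<bar> * lad_excess x h"
      using lad_excess_nonneg[of x h] by (simp add: left_diff_distrib[symmetric] abs_mult)
    also have "\<dots> \<le> (B * \<bar>h\<bar>) * lad_excess x h"
    proof (rule mult_right_mono)
      have "B * \<bar>x\<bar> \<le> B * \<bar>h\<bar>" using False B by (intro mult_left_mono) auto
      then show "\<bar>g x - g 0\<bar> \<le> B * \<bar>h\<bar>" using lip[of x] by simp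
    qed (rule lad_excess_nonneg)
    finally show ?thesis .
  qed
  have iR: "integrable lborel (\<lambda>x. g 0 * lad_excess x h)" "integrable lborel (\<lambda>x. B * \<bar>h\<bar> * lad_excess x h)"
    using R(1) by simp_all
  have id: "integrable lborel (\<lambda>x. g x * lad_excess x h - g 0 * lad_excess x h)"
    by (rule Bochner_Integration.integrable_bound[OF iR(2)]) (use gR order_trans[OF gR abs_ge_self] in auto)
  have ig: "integrable lborel (\<lambda>x. g x * lad_excess x h)"
    using Bochner_Integration.integrable_add[OF id iR(1)] by simp
  have "(\<integral>\<omega>. lad_excess (X \<omega>) h \<partial>M) = (\<integral>x. g x * lad_excess x h \<partial>lborel)"
    using X g0 by (intro distributed_integral[symmetric]) auto
  then have "\<bar>(\<integral>\<omega>. lad_excess (X \<omega>) h \<partial>M) - g 0 * h\<^sup>2\<bar> = \<bar>\<integral>x. g x * lad_excess x h - g 0 * lad_excess x h \<partial>lborel\<bar>"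
    using ig iR(1) R(2) by simp
  also have "\<dots> \<le> (\<integral>x. \<bar>g x * lad_excess x h - g 0 * lad_excess x h\<bar> \<partial>lborel)" by (rule integral_abs_bound)
  also have "\<dots> \<le> (\<integral>x. B * \<bar>h\<bar> * lad_excess x h \<partial>lborel)"
    by (rule integral_mono[OF integrable_abs[OF id] iR(2) gR])
  also have "\<dots> = B * \<bar>h\<bar> ^ 3" using R(2) by (simp add: power2_eq_square power3_eq_cube)
  finally show "\<bar>(\<integral>\<omega>. lad_excess (X \<omega>) h \<partial>M) - g 0 * h\<^sup>2\<bar> \<le> B * \<bar>h\<bar> ^ 3" .
qed

text \<open>In the absence of an atom at \<open>0\<close>, the sign is almost surely
  \<open>1\<close> minus twice the indicator of \<open>X \<le> 0\<close>, whose mean is zero as the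
  distribution function is \<open>1 / 2\<close> at \<open>0\<close>.\<close>

lemma median_zero_sgn:
  assumes "prob_space M" and X[measurable]: "X \<in> borel_measurable M"
    and null: "measure M {\<omega> \<in> space M. \<bar>X \<omega>\<bar> \<le> 0} \<le> 0" and med: "cdf (distr M borel X) 0 = 1 / 2"
  shows "AE \<omega> in M. X \<omega> \<noteq> (0 :: real)" and "(\<integral>\<omega>. sgn (X \<omega>) \<partial>M) = 0"
proof -
  interpret prob_space M by fact
  have "prob {\<omega> \<in> space M. X \<omega> = 0} = 0" using null measure_nonneg[of M] by (simp add: antisym)
  then show nz: "AE \<omega> in M. X \<omega> \<noteq> 0"
    by (intro AE_I[of _ _ "{\<omega> \<in> space M. X \<omega> = 0}"]) (auto simp: emeasure_eq_measure)
  let ?A = "{\<omega> \<in> space M. X \<omega> \<le> 0}"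
  have A: "?A \<in> events" by measurable
  have "prob ?A = 1 / 2"
    using med by (simp add: cdf_def measure_distr vimage_def Int_def conj_commute)
  have "(\<integral>\<omega>. sgn (X \<omega>) \<partial>M) = (\<integral>\<omega>. 1 - 2 * indicator ?A \<omega> \<partial>M)"
  proof (rule integral_cong_AE)
    show "AE \<omega> in M. sgn (X \<omega>) = 1 - 2 * indicator ?A \<omega>"
      using nz AE_space by eventually_elim (auto simp: indicator_def sgn_if)
  qed (use A in measurable)
  also have "\<dots> = 1 - 2 * prob ?A"
    using A by (subst Bochner_Integration.integral_diff)
      (auto simp: prob_space Int_absorb2 sets.sets_into_space intro!: integrable_mult_right integrable_const_bound[where B = 1])
  finally show "(\<integral>\<omega>. sgn (X \<omega>) \<partial>M) = 0" using \<open>prob ?A = 1 / 2\<close> by simp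
qed

section \<open>Oscillating averages over grids\<close>

lemma summation_by_parts_geometric:
  fixes z :: complex and c :: "nat \<Rightarrow> real"
  shows "(1 - z) * (\<Sum>t = 1..T. of_real (c t) * z ^ t)
    = (\<Sum>t = 1..T. of_real (c t - c (t - 1)) * z ^ t) - of_real (c T) * z ^ Suc T + of_real (c 0) * z"
  by (induction T) (simp_all add: algebra_simps)

text \<open>After summation by parts the increments of the weight telescope to
  \<open>c T - c 0\<close>, and the boundary terms add \<open>c T + c 0\<close>; apart from the last
  weight the bound does not grow with \<open>T\<close>.\<close>

lemma monotone_geometric_sum_bound:
  fixes z :: complex and c :: "nat \<Rightarrow> real"
  assumes z: "norm z = 1" "z \<noteq> 1" and c: "mono c" "0 \<le> c 0"
  shows "norm (\<Sum>t = 1..T. of_real (c t) * z ^ t) \<le> 2 * c T / norm (1 - z)"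
proof -
  have inc: "0 \<le> c t - c (t - 1)" for t using monoD[OF c(1), of "t - 1" t] by simp
  have "norm (\<Sum>t = 1..T. of_real (c t - c (t - 1)) * z ^ t) \<le> (\<Sum>t = 1..T. c t - c (t - 1))"
    by (rule order_trans[OF norm_sum], rule sum_mono) (simp only: norm_mult norm_power norm_of_real z(1) abs_of_nonneg[OF inc] power_one mult_1_right order_refl)
  also have "\<dots> = c T - c 0" by (induction T) auto
  finally have 1: "norm (\<Sum>t = 1..T. of_real (c t - c (t - 1)) * z ^ t) \<le> c T - c 0" .
  have cT: "0 \<le> c T" using monoD[OF c(1), of 0 T] c(2) by simp
  have "norm (1 - z) * norm (\<Sum>t = 1..T. of_real (c t) * z ^ t)
    \<le> norm (\<Sum>t = 1..T. of_real (c t - c (t - 1)) * z ^ t) + norm (of_real (c T) * z ^ Suc T) + norm (of_real (c 0) * z)"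
    unfolding norm_mult[symmetric] summation_by_parts_geometric
    by (intro order_trans[OF norm_triangle_ineq] add_right_mono norm_triangle_ineq4)
  also have "\<dots> \<le> 2 * c T" using 1 z c cT by (simp add: norm_mult norm_power)
  finally show ?thesis using z by (simp add: pos_le_divide_eq mult.commute)
qed

definition grid :: "nat \<times> nat \<Rightarrow> (nat \<times> nat) set"
  where "grid i = {1..fst i} \<times> {1..snd i}"

lemma finite_grid[simp]: "finite (grid i)"
  by (simp add: grid_def)

lemma card_grid: "card (grid i) = fst i * snd i"
  by (simp add: grid_def)

lemma grid_sum_mult:
  fixes f g :: "nat \<Rightarrow> 'a::comm_semiring_0"
  shows "(\<Sum>p\<in>grid i. f (fst p) * g (snd p)) = (\<Sum>t = 1..fst i. f t) * (\<Sum>s = 1..snd i. g s)"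
  unfolding grid_def sum_product sum.cartesian_product by (simp add: case_prod_beta)

abbreviation (input) grid_filter :: "(nat \<times> nat) filter"
  where "grid_filter \<equiv> filtercomap (\<lambda>(T, S). min T S) at_top"

lemma eventually_grid_filterI:
  assumes "\<And>T S. n \<le> T \<Longrightarrow> n \<le> S \<Longrightarrow> P (T, S)"
  shows "\<forall>\<^sub>F i in grid_filter. P i"
  unfolding eventually_filtercomap
proof (intro exI conjI allI impI)
  show "\<forall>\<^sub>F k in at_top. n \<le> k" by (rule eventually_ge_at_top)
  show "P i" if "n \<le> (case i of (T, S) \<Rightarrow> min T S)" for i
    using that assms by (cases i) auto
qed

lemma filterlim_fst_grid: "filterlim fst at_top grid_filter"
  unfolding filterlim_at_top by (auto intro: eventually_grid_filterI)

lemma filterlim_snd_grid: "filterlim snd at_top grid_filter"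
  unfolding filterlim_at_top by (auto intro: eventually_grid_filterI)

definition osc :: "real \<Rightarrow> real \<Rightarrow> nat \<times> nat \<Rightarrow> complex"
  where "osc x y p = cis (x * real (fst p) + y * real (snd p))"

text \<open>The sum factors over the two directions. Cancellation is used in the first, where it
  gives \<open>O(1)\<close>; with the trivial bound \<open>snd i\<close> for the second, division by
  the number of grid points still leaves \<open>O(1 / fst i)\<close>.\<close>

lemma osc_sum_bound:
  fixes c e :: "nat \<Rightarrow> real"
  assumes x: "cis x \<noteq> 1" and c: "mono c" "0 \<le> c 0" "c (fst i) \<le> 1" and e: "\<And>s. s \<in> {1..snd i} \<Longrightarrow> \<bar>e s\<bar> \<le> 1"
  shows "norm (\<Sum>p\<in>grid i. of_real (c (fst p) * e (snd p)) * osc x y p) \<le> 2 / norm (1 - cis x) * real (snd i)"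
proof -
  have "(\<Sum>p\<in>grid i. of_real (c (fst p) * e (snd p)) * osc x y p)
    = (\<Sum>p\<in>grid i. (of_real (c (fst p)) * cis x ^ fst p) * (of_real (e (snd p)) * cis y ^ snd p))"
    unfolding osc_def by (intro sum.cong) (auto simp: Complex.DeMoivre cis_mult[symmetric] mult_ac)
  also have "\<dots> = (\<Sum>t = 1..fst i. of_real (c t) * cis x ^ t) * (\<Sum>s = 1..snd i. of_real (e s) * cis y ^ s)"
    by (rule grid_sum_mult)
  also have "norm \<dots> \<le> (2 / norm (1 - cis x)) * real (snd i)"
    unfolding norm_mult
  proof (rule mult_mono)
    have "norm (\<Sum>t = 1..fst i. of_real (c t) * cis x ^ t) \<le> 2 * c (fst i) / norm (1 - cis x)"
      by (rule monotone_geometric_sum_bound[OF _ x c(1,2)]) simp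
    also have "\<dots> \<le> 2 / norm (1 - cis x)" using c by (intro divide_right_mono) auto
    finally show "norm (\<Sum>t = 1..fst i. of_real (c t) * cis x ^ t) \<le> 2 / norm (1 - cis x)" .
    have "norm (\<Sum>s = 1..snd i. of_real (e s) * cis y ^ s) \<le> (\<Sum>s = 1..snd i. 1)"
      by (rule order_trans[OF norm_sum], rule sum_mono) (use e in \<open>simp add: norm_mult norm_power\<close>)
    then show "norm (\<Sum>s = 1..snd i. of_real (e s) * cis y ^ s) \<le> real (snd i)" by simp
  qed auto
  finally show ?thesis .
qed

text \<open>\<open>tau\<close> and \<open>sig\<close> are the grid coordinates on the unit scale, on
  which the frequency derivatives of the regression function stay bounded.\<close>

definition tau :: "nat \<times> nat \<Rightarrow> nat \<times> nat \<Rightarrow> real" where "tau i p = real (fst p) / real (fst i)"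
definition sig :: "nat \<times> nat \<Rightarrow> nat \<times> nat \<Rightarrow> real" where "sig i p = real (snd p) / real (snd i)"

lemma tau_sig_bounds: "p \<in> grid i \<Longrightarrow> 0 \<le> tau i p \<and> tau i p \<le> 1 \<and> 0 \<le> sig i p \<and> sig i p \<le> 1"
  by (auto simp: grid_def tau_def sig_def)

abbreviation grid_mean :: "(nat \<times> nat \<Rightarrow> nat \<times> nat \<Rightarrow> 'a::real_normed_field) \<Rightarrow> nat \<times> nat \<Rightarrow> 'a"
  where "grid_mean f i \<equiv> (\<Sum>p\<in>grid i. f i p) / of_nat (card (grid i))"

lemma osc_mean_limit:
  assumes x: "cis x \<noteq> 1"
  shows "(grid_mean (\<lambda>i p. of_real (tau i p ^ a * sig i p ^ b) * osc x y p) \<longlongrightarrow> 0) grid_filter"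
proof (rule Lim_null_comparison)
  let ?K = "2 / norm (1 - cis x)"
  show "\<forall>\<^sub>F i in grid_filter. norm (grid_mean (\<lambda>i p. of_real (tau i p ^ a * sig i p ^ b) * osc x y p) i) \<le> ?K / real (fst i)"
  proof (rule eventually_grid_filterI[of 1])
    fix T S :: nat assume TS: "1 \<le> T" "1 \<le> S"
    have "norm (\<Sum>p\<in>grid (T, S). of_real ((real (fst p) / real T) ^ a * (real (snd p) / real S) ^ b) * osc x y p) \<le> ?K * real (snd (T, S))"
    proof (rule osc_sum_bound[OF x])
      show "mono (\<lambda>t. (real t / real T) ^ a)" by (intro monoI power_mono divide_right_mono) auto
      show "(real (fst (T, S)) / real T) ^ a \<le> 1" using TS by simp
      show "\<bar>(real s / real S) ^ b\<bar> \<le> 1" if "s \<in> {1..snd (T, S)}" for s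
        using that by (auto simp: power_abs intro!: power_le_one)
    qed simp
    then have "norm (\<Sum>p\<in>grid (T, S). of_real (tau (T, S) p ^ a * sig (T, S) p ^ b) * osc x y p) \<le> ?K * real S"
      by (simp add: tau_def sig_def)
    then have "norm (\<Sum>p\<in>grid (T, S). of_real (tau (T, S) p ^ a * sig (T, S) p ^ b) * osc x y p) / (real T * real S) \<le> ?K * real S / (real T * real S)"
      by (rule divide_right_mono) simp
    then show "norm (grid_mean (\<lambda>i p. of_real (tau i p ^ a * sig i p ^ b) * osc x y p) (T, S)) \<le> ?K / real (fst (T, S))"
      using TS by (simp add: card_grid norm_divide norm_mult)
  qed
  show "((\<lambda>i. ?K / real (fst i)) \<longlongrightarrow> 0) grid_filter"
    by (rule real_tendsto_divide_at_top[OF tendsto_const filterlim_compose[OF filterlim_real_sequentially filterlim_fst_grid]])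
qed

text \<open>Riemann sums of \<open>x^a\<close> on the unit interval. Exponents up to
  \<open>2\<close> are those of squared linear forms in \<open>tau\<close> and \<open>sig\<close>,
  and explicit power sums settle them.\<close>

lemma power_mean_limit:
  assumes "a \<le> 2"
  shows "(\<lambda>T. (\<Sum>t = 1..T. (real t / real T) ^ a) / real T) \<longlonglongrightarrow> 1 / (real a + 1)"
proof -
  consider "a = 0" | "a = 1" | "a = 2" using assms by linarith
  then show ?thesis
  proof cases
    case 1
    have "\<forall>\<^sub>F T in sequentially. 1 = (\<Sum>t = 1..T. (real t / real T) ^ a) / real T"
      using eventually_gt_at_top[of 0] by eventually_elim (simp add: 1)
    then show ?thesis using 1 by (simp add: tendsto_eventually eventually_mono)
  next
    case 2
    have s: "(\<Sum>t = 1..T. real t) = real T * (real T + 1) / 2" for T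
      by (induction T) (simp_all add: field_simps)
    have "\<forall>\<^sub>F T in sequentially. 1 / 2 + 1 / 2 * (1 / real T) = (\<Sum>t = 1..T. (real t / real T) ^ a) / real T"
      using eventually_gt_at_top[of 0]
    proof eventually_elim
      case (elim T)
      have "(\<Sum>t = 1..T. (real t / real T) ^ a) = real T * (real T + 1) / 2 / real T"
        unfolding 2 power_one_right sum_divide_distrib[symmetric] s ..
      then show ?case using elim by (simp add: field_simps)
    qed
    moreover have "(\<lambda>T. 1 / 2 + 1 / 2 * (1 / real T)) \<longlonglongrightarrow> 1 / 2 + 1 / 2 * 0"
      by (intro tendsto_intros lim_1_over_n)
    ultimately show ?thesis using 2 by (auto elim: Lim_transform_eventually[rotated])
  next
    case 3
    have s: "(\<Sum>t = 1..T. (real t)\<^sup>2) = real T * (real T + 1) * (2 * real T + 1) / 6" for T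
      by (induction T) (simp_all add: field_simps power2_eq_square)
    have "\<forall>\<^sub>F T in sequentially. 1 / 3 + 1 / 2 * (1 / real T) + 1 / 6 * (1 / real T) * (1 / real T) = (\<Sum>t = 1..T. (real t / real T) ^ a) / real T"
      using eventually_gt_at_top[of 0]
    proof eventually_elim
      case (elim T)
      have "(\<Sum>t = 1..T. (real t / real T) ^ a) = real T * (real T + 1) * (2 * real T + 1) / 6 / (real T)\<^sup>2"
        unfolding 3 power_divide sum_divide_distrib[symmetric] s ..
      then show ?case using elim by (simp add: field_simps power2_eq_square)
    qed
    moreover have "(\<lambda>T. 1 / 3 + 1 / 2 * (1 / real T) + 1 / 6 * (1 / real T) * (1 / real T)) \<longlonglongrightarrow> 1 / 3 + 1 / 2 * 0 + 1 / 6 * 0 * 0"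
      by (intro tendsto_intros lim_1_over_n)
    ultimately show ?thesis using 3 by (auto elim: Lim_transform_eventually[rotated])
  qed
qed

lemma monomial_mean_limit:
  assumes "a \<le> 2" "b \<le> 2"
  shows "(grid_mean (\<lambda>i p. tau i p ^ a * sig i p ^ b) \<longlongrightarrow> (1 / (real a + 1)) * (1 / (real b + 1))) grid_filter"
proof -
  have "grid_mean (\<lambda>i p. tau i p ^ a * sig i p ^ b) i
    = ((\<Sum>t = 1..fst i. (real t / real (fst i)) ^ a) / real (fst i)) * ((\<Sum>s = 1..snd i. (real s / real (snd i)) ^ b) / real (snd i))" for i
    unfolding tau_def sig_def card_grid
    using grid_sum_mult[of "\<lambda>t. (real t / real (fst i)) ^ a" "\<lambda>s. (real s / real (snd i)) ^ b" i] by simp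
  then show ?thesis
    using filterlim_compose[OF power_mean_limit[OF assms(1)] filterlim_fst_grid]
      filterlim_compose[OF power_mean_limit[OF assms(2)] filterlim_snd_grid]
    by (simp only:) (intro tendsto_mult)
qed

text \<open>With \<open>\<psi> = w\<^sub>3 tau + w\<^sub>4 sig\<close>, the derivative of the regression function in direction \<open>w\<close> is
  \<open>Re ((\<alpha> + \<beta> \<psi>) cis \<phi>)\<close>, whose square is \<open>(\<bar>\<alpha> + \<beta> \<psi>\<bar>\<^sup>2 + Re ((\<alpha> + \<beta> \<psi>)\<^sup>2 cis (2 \<phi>))) / 2\<close>.\<close>

lemma quadratic_osc_mean_limit:
  fixes \<alpha> \<beta> :: complex and u v :: real
  assumes l: "cis (2 * l) \<noteq> 1"
  shows "(grid_mean (\<lambda>i p. (Re ((\<alpha> + \<beta> * of_real (u * tau i p + v * sig i p)) * osc l m p))\<^sup>2)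
    \<longlongrightarrow> ((norm \<alpha>)\<^sup>2 + Re (\<alpha> * cnj \<beta>) * (u + v) + (norm \<beta>)\<^sup>2 * (u\<^sup>2 / 3 + u * v / 2 + v\<^sup>2 / 3)) / 2) grid_filter"
proof -
  \<comment> \<open>\<open>?m\<close> and \<open>?o\<close> are the averages of monomials without
    and with oscillation. After expansion the mean is a fixed linear combination of them, and in the
    limit \<open>?m a b\<close> becomes \<open>1 / ((a + 1) * (b + 1))\<close> while
    \<open>?o\<close> vanishes.\<close>
  let ?m = "\<lambda>a b. grid_mean (\<lambda>i p. tau i p ^ a * sig i p ^ b)"
  let ?o = "\<lambda>a b. grid_mean (\<lambda>i p. of_real (tau i p ^ a * sig i p ^ b) * osc (2 * l) (2 * m) p)"
  have sq: "(Re (z * osc l m p))\<^sup>2 = ((norm z)\<^sup>2 + Re (z\<^sup>2 * osc (2 * l) (2 * m) p)) / 2" for z p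
  proof -
    define \<phi> where "\<phi> = l * real (fst p) + m * real (snd p)"
    have "osc (2 * l) (2 * m) p = cis \<phi> * cis \<phi>" "osc l m p = cis \<phi>"
      by (simp_all add: osc_def \<phi>_def cis_mult algebra_simps)
    moreover have "(Re x)\<^sup>2 = ((norm x)\<^sup>2 + Re (x * x)) / 2" for x
      unfolding cmod_power2 by (simp add: power2_eq_square)
    from this[of "z * cis \<phi>"] have "(Re (z * cis \<phi>))\<^sup>2 = ((norm z)\<^sup>2 + Re (z\<^sup>2 * (cis \<phi> * cis \<phi>))) / 2"
      by (simp add: norm_mult power2_eq_square mult_ac)
    ultimately show ?thesis by simp
  qed
  have nsq: "(norm (\<alpha> + \<beta> * of_real y))\<^sup>2 = (norm \<alpha>)\<^sup>2 + 2 * Re (\<alpha> * cnj \<beta>) * y + (norm \<beta>)\<^sup>2 * y\<^sup>2" for y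
    unfolding cmod_power2 by (simp add: power2_eq_square algebra_simps)
  have eq: "\<forall>\<^sub>F i in grid_filter. ((norm \<alpha>)\<^sup>2 * ?m 0 0 i + 2 * Re (\<alpha> * cnj \<beta>) * (u * ?m 1 0 i + v * ?m 0 1 i)
      + (norm \<beta>)\<^sup>2 * (u\<^sup>2 * ?m 2 0 i + 2 * u * v * ?m 1 1 i + v\<^sup>2 * ?m 0 2 i)
      + Re (\<alpha>\<^sup>2 * ?o 0 0 i + 2 * \<alpha> * \<beta> * (of_real u * ?o 1 0 i + of_real v * ?o 0 1 i)
          + \<beta>\<^sup>2 * (of_real (u\<^sup>2) * ?o 2 0 i + of_real (2 * u * v) * ?o 1 1 i + of_real (v\<^sup>2) * ?o 0 2 i))) / 2
    = grid_mean (\<lambda>i p. (Re ((\<alpha> + \<beta> * of_real (u * tau i p + v * sig i p)) * osc l m p))\<^sup>2) i"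
  proof (rule always_eventually, rule allI)
    fix i
    let ?c = "real (card (grid i))"
    have 1: "grid_mean (\<lambda>i p. (norm (\<alpha> + \<beta> * of_real (u * tau i p + v * sig i p)))\<^sup>2) i
      = (norm \<alpha>)\<^sup>2 * ?m 0 0 i + 2 * Re (\<alpha> * cnj \<beta>) * (u * ?m 1 0 i + v * ?m 0 1 i)
      + (norm \<beta>)\<^sup>2 * (u\<^sup>2 * ?m 2 0 i + 2 * u * v * ?m 1 1 i + v\<^sup>2 * ?m 0 2 i)"
      unfolding nsq sum_distrib_left sum_divide_distrib sum.distrib[symmetric]
      by (intro sum.cong refl) (simp add: add_divide_distrib power2_eq_square algebra_simps)
    have 2: "grid_mean (\<lambda>i p. (\<alpha> + \<beta> * of_real (u * tau i p + v * sig i p))\<^sup>2 * osc (2 * l) (2 * m) p) i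
      = \<alpha>\<^sup>2 * ?o 0 0 i + 2 * \<alpha> * \<beta> * (of_real u * ?o 1 0 i + of_real v * ?o 0 1 i)
          + \<beta>\<^sup>2 * (of_real (u\<^sup>2) * ?o 2 0 i + of_real (2 * u * v) * ?o 1 1 i + of_real (v\<^sup>2) * ?o 0 2 i)"
      unfolding sum_distrib_left sum_divide_distrib sum.distrib[symmetric]
      by (intro sum.cong refl) (simp add: add_divide_distrib power2_eq_square algebra_simps)
    have 3: "grid_mean (\<lambda>i p. (Re ((\<alpha> + \<beta> * of_real (u * tau i p + v * sig i p)) * osc l m p))\<^sup>2) i
      = (grid_mean (\<lambda>i p. (norm (\<alpha> + \<beta> * of_real (u * tau i p + v * sig i p)))\<^sup>2) i
       + Re (grid_mean (\<lambda>i p. (\<alpha> + \<beta> * of_real (u * tau i p + v * sig i p))\<^sup>2 * osc (2 * l) (2 * m) p) i)) / 2"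
      unfolding sq by (simp add: sum_divide_distrib[symmetric] sum.distrib Re_divide_of_nat add_divide_distrib)
    show "((norm \<alpha>)\<^sup>2 * ?m 0 0 i + 2 * Re (\<alpha> * cnj \<beta>) * (u * ?m 1 0 i + v * ?m 0 1 i)
      + (norm \<beta>)\<^sup>2 * (u\<^sup>2 * ?m 2 0 i + 2 * u * v * ?m 1 1 i + v\<^sup>2 * ?m 0 2 i)
      + Re (\<alpha>\<^sup>2 * ?o 0 0 i + 2 * \<alpha> * \<beta> * (of_real u * ?o 1 0 i + of_real v * ?o 0 1 i)
          + \<beta>\<^sup>2 * (of_real (u\<^sup>2) * ?o 2 0 i + of_real (2 * u * v) * ?o 1 1 i + of_real (v\<^sup>2) * ?o 0 2 i))) / 2
      = grid_mean (\<lambda>i p. (Re ((\<alpha> + \<beta> * of_real (u * tau i p + v * sig i p)) * osc l m p))\<^sup>2) i"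
      unfolding 3 1 2 ..
  qed
  have lim: "((\<lambda>i. ((norm \<alpha>)\<^sup>2 * ?m 0 0 i + 2 * Re (\<alpha> * cnj \<beta>) * (u * ?m 1 0 i + v * ?m 0 1 i)
      + (norm \<beta>)\<^sup>2 * (u\<^sup>2 * ?m 2 0 i + 2 * u * v * ?m 1 1 i + v\<^sup>2 * ?m 0 2 i)
      + Re (\<alpha>\<^sup>2 * ?o 0 0 i + 2 * \<alpha> * \<beta> * (of_real u * ?o 1 0 i + of_real v * ?o 0 1 i)
          + \<beta>\<^sup>2 * (of_real (u\<^sup>2) * ?o 2 0 i + of_real (2 * u * v) * ?o 1 1 i + of_real (v\<^sup>2) * ?o 0 2 i))) / 2)
    \<longlongrightarrow> ((norm \<alpha>)\<^sup>2 * ((1 / (real 0 + 1)) * (1 / (real 0 + 1))) + 2 * Re (\<alpha> * cnj \<beta>) * (u * ((1 / (real 1 + 1)) * (1 / (real 0 + 1))) + v * ((1 / (real 0 + 1)) * (1 / (real 1 + 1))))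
      + (norm \<beta>)\<^sup>2 * (u\<^sup>2 * ((1 / (real 2 + 1)) * (1 / (real 0 + 1))) + 2 * u * v * ((1 / (real 1 + 1)) * (1 / (real 1 + 1))) + v\<^sup>2 * ((1 / (real 0 + 1)) * (1 / (real 2 + 1))))
      + Re (\<alpha>\<^sup>2 * 0 + 2 * \<alpha> * \<beta> * (of_real u * 0 + of_real v * 0)
          + \<beta>\<^sup>2 * (of_real (u\<^sup>2) * 0 + of_real (2 * u * v) * 0 + of_real (v\<^sup>2) * 0))) / 2) grid_filter"
    by (intro tendsto_divide tendsto_add tendsto_mult tendsto_Re tendsto_const monomial_mean_limit osc_mean_limit l) auto
  have "((norm \<alpha>)\<^sup>2 * ((1 / (real 0 + 1)) * (1 / (real 0 + 1))) + 2 * Re (\<alpha> * cnj \<beta>) * (u * ((1 / (real 1 + 1)) * (1 / (real 0 + 1))) + v * ((1 / (real 0 + 1)) * (1 / (real 1 + 1))))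
      + (norm \<beta>)\<^sup>2 * (u\<^sup>2 * ((1 / (real 2 + 1)) * (1 / (real 0 + 1))) + 2 * u * v * ((1 / (real 1 + 1)) * (1 / (real 1 + 1))) + v\<^sup>2 * ((1 / (real 0 + 1)) * (1 / (real 2 + 1))))
      + Re (\<alpha>\<^sup>2 * 0 + 2 * \<alpha> * \<beta> * (of_real u * 0 + of_real v * 0)
          + \<beta>\<^sup>2 * (of_real (u\<^sup>2) * 0 + of_real (2 * u * v) * 0 + of_real (v\<^sup>2) * 0))) / 2
    = ((norm \<alpha>)\<^sup>2 + Re (\<alpha> * cnj \<beta>) * (u + v) + (norm \<beta>)\<^sup>2 * (u\<^sup>2 / 3 + u * v / 2 + v\<^sup>2 / 3)) / 2"
    by (simp add: field_simps)
  with Lim_transform_eventually[OF lim eq] show ?thesis by (simp only:)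
qed

section \<open>Dirichlet kernels: decay away from frequency zero, and a uniform gap at the scale
  1/n\<close>

lemma norm_one_minus_cis: "norm (1 - cis x) = 2 * \<bar>sin (x / 2)\<bar>"
proof -
  have "(norm (1 - cis x))\<^sup>2 = (1 - cos x)\<^sup>2 + (sin x)\<^sup>2" by (simp add: cmod_power2)
  also have "\<dots> = 1 - 2 * cos x + ((cos x)\<^sup>2 + (sin x)\<^sup>2)" by (simp add: power2_eq_square algebra_simps)
  also have "\<dots> = 2 - 2 * cos (2 * (x / 2))" by simp
  also have "\<dots> = (2 * \<bar>sin (x / 2)\<bar>)\<^sup>2" unfolding cos_double_sin by (simp add: power_mult_distrib)
  finally show ?thesis by (rule power2_eq_imp_eq) simp_all
qed

definition dirichlet_mean :: "real \<Rightarrow> nat \<Rightarrow> complex"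
  where "dirichlet_mean x n = (\<Sum>t = 1..n. cis x ^ t) / of_nat n"

lemma dirichlet_mean_le_1: "norm (dirichlet_mean x n) \<le> 1"
proof -
  have "norm (\<Sum>t = 1..n. cis x ^ t) \<le> (\<Sum>t = 1..n. 1)"
    by (rule order_trans[OF norm_sum], rule sum_mono) (simp add: norm_power)
  then show ?thesis by (cases "n = 0") (simp_all add: dirichlet_mean_def norm_divide divide_le_eq)
qed

lemma dirichlet_mean_formula:
  assumes "sin (x / 2) \<noteq> 0" "1 \<le> n"
  shows "norm (dirichlet_mean x n) = \<bar>sin (real n * x / 2)\<bar> / (real n * \<bar>sin (x / 2)\<bar>)"
proof -
  have "(1 - cis x) * (\<Sum>t = 1..n. cis x ^ t) = cis x * (1 - cis (real n * x))"
  proof -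
    have "(1 - z) * (\<Sum>t = 1..n. z ^ t) = z * (1 - z ^ n)" for z :: complex
    proof (induction n)
      case (Suc n)
      have "(1 - z) * (\<Sum>t = 1..Suc n. z ^ t) = (1 - z) * (\<Sum>t = 1..n. z ^ t) + (1 - z) * z ^ Suc n"
        by (simp add: distrib_left)
      also have "\<dots> = z * (1 - z ^ Suc n)" unfolding Suc.IH by (simp add: algebra_simps)
      finally show ?case .
    qed simp
    from this[of "cis x"] show ?thesis unfolding Complex.DeMoivre[of x n] .
  qed
  then have "norm (1 - cis x) * norm (\<Sum>t = 1..n. cis x ^ t) = norm (1 - cis (real n * x))"
    unfolding norm_mult[symmetric] by (simp only:) (simp add: norm_mult)
  then have "norm (\<Sum>t = 1..n. cis x ^ t) = \<bar>sin (real n * x / 2)\<bar> / \<bar>sin (x / 2)\<bar>"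
    unfolding norm_one_minus_cis using assms(1) by (simp add: field_simps)
  moreover have "norm (dirichlet_mean x n) = norm (\<Sum>t = 1..n. cis x ^ t) / real n"
    unfolding dirichlet_mean_def norm_divide by simp
  ultimately show ?thesis by (simp only: divide_divide_eq_left mult.commute)
qed

text \<open>Sums of two frequencies range up to \<open>2 * pi\<close>, so the sine has to be kept
  from zero at both ends; for \<open>\<bar>x\<bar>\<close> beyond \<open>pi\<close> the angle is
  reflected to \<open>pi - \<bar>x\<bar> / 2\<close>.\<close>

lemma sin_half_lower:
  assumes "0 < \<eta>" "\<eta> \<le> \<bar>x\<bar>" "\<bar>x\<bar> \<le> 2 * pi - \<eta>"
  shows "0 < sin (\<eta> / 2)" "sin (\<eta> / 2) \<le> \<bar>sin (x / 2)\<bar>"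
proof -
  have \<eta>: "\<eta> \<le> pi" using assms by linarith
  then show s: "0 < sin (\<eta> / 2)" using assms(1) pi_gt_zero by (intro sin_gt_zero) auto
  have "sin (\<eta> / 2) \<le> sin (\<bar>x\<bar> / 2)"
  proof (cases "\<bar>x\<bar> \<le> pi")
    case True
    then show ?thesis using assms by (intro sin_monotone_2pi_le) auto
  next
    case False
    then have "sin (\<eta> / 2) \<le> sin (pi - \<bar>x\<bar> / 2)" using assms by (intro sin_monotone_2pi_le) auto
    then show ?thesis by simp
  qed
  also have "\<dots> \<le> \<bar>sin (x / 2)\<bar>" by (cases "0 \<le> x") auto
  finally show "sin (\<eta> / 2) \<le> \<bar>sin (x / 2)\<bar>" .
qed

lemma dirichlet_mean_small:
  assumes "0 < \<eta>" "\<eta> \<le> \<bar>x\<bar>" "\<bar>x\<bar> \<le> 2 * pi - \<eta>" "1 \<le> n"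
  shows "norm (dirichlet_mean x n) \<le> 1 / sin (\<eta> / 2) / real n"
proof -
  note s = sin_half_lower[OF assms(1-3)]
  then have "norm (dirichlet_mean x n) = \<bar>sin (real n * x / 2)\<bar> / (real n * \<bar>sin (x / 2)\<bar>)"
    using assms(4) by (intro dirichlet_mean_formula) auto
  also have "\<dots> \<le> 1 / (real n * sin (\<eta> / 2))"
    using s assms(4) by (intro frac_le mult_left_mono) auto
  finally show ?thesis by (simp add: mult.commute)
qed

lemma dirichlet_mean_near_1:
  assumes "1 \<le> n"
  shows "norm (dirichlet_mean x n - 1) \<le> real n * \<bar>x\<bar>"
proof -
  have "dirichlet_mean x n - 1 = (\<Sum>t = 1..n. cis x ^ t - 1) / of_nat n"
    using assms by (simp add: dirichlet_mean_def sum_subtractf diff_divide_distrib)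
  moreover have "norm (\<Sum>t = 1..n. cis x ^ t - 1) \<le> (\<Sum>t = 1..n. real n * \<bar>x\<bar>)"
  proof (rule order_trans[OF norm_sum], rule sum_mono)
    fix t assume t: "t \<in> {1..n}"
    have "norm (cis x ^ t - 1) = 2 * \<bar>sin (real t * x / 2)\<bar>"
      by (simp add: Complex.DeMoivre norm_minus_commute norm_one_minus_cis)
    also have "\<dots> \<le> real t * \<bar>x\<bar>" using abs_sin_x_le_abs_x[of "real t * x / 2"] by (simp add: abs_mult)
    also have "\<dots> \<le> real n * \<bar>x\<bar>" using t by (intro mult_right_mono) auto
    finally show "norm (cis x ^ t - 1) \<le> real n * \<bar>x\<bar>" .
  qed
  ultimately show ?thesis using assms by (simp add: norm_divide divide_le_eq mult_ac)
qed

text \<open>Halving the angle brings in a factor \<open>cos (y / 2) < 1\<close>, which makes the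
  inequality strict; beyond \<open>1\<close> the bound of the sine by one gives it.\<close>

lemma abs_sin_less: 
  fixes y :: real
  assumes "0 < y"
  shows "\<bar>sin y\<bar> < y"
proof (cases "y \<le> 1")
  case True
  have "sin (y / 2) > 0" "cos (y / 2) < 1" "cos (y / 2) > 0"
  proof -
    show "sin (y / 2) > 0" using assms True pi_gt3 by (intro sin_gt_zero) auto
    show "cos (y / 2) < 1" using cos_monotone_0_pi[of 0 "y / 2"] assms True pi_gt3 by simp
    show "cos (y / 2) > 0" using assms True pi_gt3 by (intro cos_gt_zero_pi) auto
  qed
  then have "sin y < 2 * sin (y / 2)" "0 < sin y" using sin_double[of "y / 2"] by auto
  moreover have "2 * sin (y / 2) \<le> y" using sin_x_le_x[of "y / 2"] assms by simp
  ultimately show ?thesis by simp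
next
  case False
  then show ?thesis using abs_sin_le_one[of y] by linarith
qed

text \<open>The ratio \<open>\<bar>sin y\<bar> / y\<close> is continuous and below one on a compact
  interval, hence bounded away from one there; beyond \<open>2\<close> it is below
  \<open>1 / 2\<close>.\<close>

lemma sin_ratio_bound:
  fixes \<delta> :: real
  assumes "0 < \<delta>"
  obtains \<rho> where "0 < \<rho>" "\<rho> < 1" "\<And>y. \<delta> \<le> y \<Longrightarrow> \<bar>sin y\<bar> \<le> \<rho> * y"
proof -
  define b where "b = max \<delta> 2"
  have "continuous_on {\<delta>..b} (\<lambda>y. \<bar>sin y\<bar> / y)" using assms by (intro continuous_intros) auto
  moreover have "{\<delta>..b} \<noteq> {}" by (simp add: b_def)
  ultimately obtain y0 where y0: "y0 \<in> {\<delta>..b}" "\<And>y. y \<in> {\<delta>..b} \<Longrightarrow> \<bar>sin y\<bar> / y \<le> \<bar>sin y0\<bar> / y0"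
    using continuous_attains_sup[of "{\<delta>..b}" "\<lambda>y. \<bar>sin y\<bar> / y"] by auto
  have "\<bar>sin y0\<bar> / y0 < 1" using abs_sin_less[of y0] y0(1) assms by auto
  show thesis
  proof
    show "0 < max (1 / 2) (\<bar>sin y0\<bar> / y0)" by simp
    show "max (1 / 2) (\<bar>sin y0\<bar> / y0) < 1" using \<open>\<bar>sin y0\<bar> / y0 < 1\<close> by simp
    show "\<bar>sin y\<bar> \<le> max (1 / 2) (\<bar>sin y0\<bar> / y0) * y" if "\<delta> \<le> y" for y
    proof (cases "y \<le> b")
      case True
      then have "\<bar>sin y\<bar> / y \<le> max (1 / 2) (\<bar>sin y0\<bar> / y0)" using y0(2)[of y] that by auto
      then show ?thesis using that assms by (simp add: divide_le_eq)
    next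
      case False
      then have "2 < y" by (simp add: b_def)
      then have "\<bar>sin y\<bar> \<le> 1 / 2 * y" using abs_sin_le_one[of y] by linarith
      also have "\<dots> \<le> max (1 / 2) (\<bar>sin y0\<bar> / y0) * y" using that assms by (intro mult_right_mono) auto
      finally show ?thesis .
    qed
  qed
qed

text \<open>A gap at the scale \<open>1 / n\<close>, uniform in \<open>n\<close>. Near frequency
  zero the kernel is about \<open>\<bar>sin y\<bar> / y\<close> at
  \<open>y = n * \<bar>x\<bar> / 2\<close>, which is at most \<open>\<rho>0\<close>, the denominator
  \<open>sin (x / 2)\<close> costing a factor \<open>1 / \<kappa>\<close>; at a fixed distance from
  zero it decays like \<open>1 / n\<close>.\<close>

lemma dirichlet_mean_away:
  fixes \<delta> :: real
  assumes "0 < \<delta>"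
  obtains \<rho> n0 where "0 < \<rho>" "\<rho> < 1" "1 \<le> n0"
    "\<And>n x. n0 \<le> n \<Longrightarrow> \<bar>x\<bar> \<le> pi \<Longrightarrow> \<delta> \<le> real n * \<bar>x\<bar> \<Longrightarrow> norm (dirichlet_mean x n) \<le> \<rho>"
proof -
  have "0 < \<delta> / 2" using assms by simp
  then obtain \<rho>0 where \<rho>0: "0 < \<rho>0" "\<rho>0 < 1" "\<And>y. \<delta> / 2 \<le> y \<Longrightarrow> \<bar>sin y\<bar> \<le> \<rho>0 * y"
    using sin_ratio_bound by blast
  \<comment> \<open>\<open>\<kappa>\<close> lies strictly between \<open>\<rho>0\<close> and
    \<open>1\<close>: small positive \<open>y\<close> satisfy \<open>\<kappa> * y < sin y\<close>,
    and \<open>\<rho>0 / \<kappa>\<close> is still below one.\<close>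
  define \<kappa> where "\<kappa> = (1 + \<rho>0) / 2"
  have \<kappa>: "\<rho>0 < \<kappa>" "\<kappa> < 1" "0 < \<kappa>" using \<rho>0 by (auto simp: \<kappa>_def)
  have "((\<lambda>y. (sin y - sin 0) / (y - 0)) \<longlongrightarrow> cos (0 :: real)) (at 0)"
    using DERIV_sin[of "0 :: real"] by (simp add: has_field_derivative_iff)
  then have "\<forall>\<^sub>F y in at (0 :: real). \<kappa> < sin y / y" using \<kappa> by (intro order_tendstoD(1)[of _ "cos 0"]) auto
  then obtain \<tau>' where \<tau>': "0 < \<tau>'" "\<And>y. y \<noteq> 0 \<Longrightarrow> \<bar>y\<bar> < \<tau>' \<Longrightarrow> \<kappa> < sin y / y"
    unfolding eventually_at by (auto simp: dist_real_def)
  define \<tau> where "\<tau> = min 1 (\<tau>' / 2)"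
  have \<tau>: "0 < \<tau>" "\<tau> \<le> 1" "\<tau> < \<tau>'" using \<tau>' by (auto simp: \<tau>_def)
  have st: "0 < sin \<tau>" using \<tau> pi_gt3 by (intro sin_gt_zero) auto
  define n0 where "n0 = nat \<lceil>2 / sin \<tau>\<rceil> + 1"
  show thesis
  proof
    show "0 < max (1 / 2) (\<rho>0 / \<kappa>)" by simp
    show "max (1 / 2) (\<rho>0 / \<kappa>) < 1" using \<kappa> by simp
    show "1 \<le> n0" by (simp add: n0_def)
    show "norm (dirichlet_mean x n) \<le> max (1 / 2) (\<rho>0 / \<kappa>)" if n: "n0 \<le> n" and x: "\<bar>x\<bar> \<le> pi" "\<delta> \<le> real n * \<bar>x\<bar>" for n x
    proof (cases "\<bar>x\<bar> < 2 * \<tau>")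
      case True
      have x0: "x \<noteq> 0" using x assms by auto
      have n1: "1 \<le> n" using n by (simp add: n0_def)
      have "\<kappa> < sin (\<bar>x\<bar> / 2) / (\<bar>x\<bar> / 2)" using True x0 \<tau> by (intro \<tau>'(2)) auto
      then have lo: "\<kappa> * (\<bar>x\<bar> / 2) < sin (\<bar>x\<bar> / 2)" using x0 by (simp add: less_divide_eq)
      have ab: "\<bar>sin (r * x / 2)\<bar> = \<bar>sin (r * \<bar>x\<bar> / 2)\<bar>" for r by (cases "0 \<le> x") auto
      have lo': "\<kappa> * (\<bar>x\<bar> / 2) \<le> \<bar>sin (x / 2)\<bar>" using lo ab[of 1] by simp
      moreover have "0 < \<kappa> * (\<bar>x\<bar> / 2)" using x0 \<kappa> by simp
      ultimately have "sin (x / 2) \<noteq> 0" by auto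
      then have "norm (dirichlet_mean x n) = \<bar>sin (real n * x / 2)\<bar> / (real n * \<bar>sin (x / 2)\<bar>)"
        using n1 by (rule dirichlet_mean_formula)
      also have "\<dots> \<le> (\<rho>0 * (real n * \<bar>x\<bar> / 2)) / (real n * (\<kappa> * (\<bar>x\<bar> / 2)))"
        using \<rho>0(3)[of "real n * \<bar>x\<bar> / 2"] x lo' n1 x0 \<kappa> \<rho>0(1) by (intro frac_le mult_left_mono) (auto simp: ab)
      also have "\<dots> = \<rho>0 / \<kappa>" using n1 x0 by simp
      finally show ?thesis by simp
    next
      case False
      have n1: "1 \<le> n" using n by (simp add: n0_def)
      have "norm (dirichlet_mean x n) \<le> 1 / sin ((2 * \<tau>) / 2) / real n"
        using False x \<tau> pi_gt3 n1 by (intro dirichlet_mean_small) auto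
      also have "\<dots> \<le> 1 / 2"
      proof -
        have "2 / sin \<tau> \<le> real n" using n unfolding n0_def by linarith
        then show ?thesis using st n1 by (simp add: field_simps)
      qed
      finally show ?thesis by simp
    qed
  qed
qed

section \<open>Averages of products of two sinusoids, through sum and difference frequencies\<close>

lemma osc_grid_mean: "grid_mean (\<lambda>i p. osc x y p) i = dirichlet_mean x (fst i) * dirichlet_mean y (snd i)"
proof -
  have "(\<Sum>p\<in>grid i. osc x y p) = (\<Sum>p\<in>grid i. cis x ^ fst p * cis y ^ snd p)"
    unfolding osc_def by (intro sum.cong) (auto simp: Complex.DeMoivre cis_mult[symmetric] mult_ac)
  also have "\<dots> = (\<Sum>t = 1..fst i. cis x ^ t) * (\<Sum>s = 1..snd i. cis y ^ s)" by (rule grid_sum_mult)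
  finally show ?thesis by (simp add: dirichlet_mean_def card_grid)
qed

lemma osc_mult: "osc x y p * osc x' y' p = osc (x + x') (y + y') p"
  "osc x y p * cnj (osc x' y' p) = osc (x - x') (y - y') p"
  by (simp_all add: osc_def cis_mult cis_cnj algebra_simps)

lemma Re_mult_Re: "Re x * Re y = (Re (x * y) + Re (x * cnj y)) / 2"
  by (simp add: algebra_simps)

definition osc_mean :: "nat \<times> nat \<Rightarrow> real \<Rightarrow> real \<Rightarrow> complex"
  where "osc_mean i x y = dirichlet_mean x (fst i) * dirichlet_mean y (snd i)"

lemma osc_product_mean:
  assumes "0 < card (grid i)"
  shows "grid_mean (\<lambda>i p. Re (\<alpha> * osc x y p) * Re (\<beta> * osc x' y' p)) i
    = (Re (\<alpha> * \<beta> * osc_mean i (x + x') (y + y')) + Re (\<alpha> * cnj \<beta> * osc_mean i (x - x') (y - y'))) / 2"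
proof -
  have "grid_mean (\<lambda>i p. Re (\<alpha> * osc x y p) * Re (\<beta> * osc x' y' p)) i
    = grid_mean (\<lambda>i p. (Re (\<alpha> * \<beta> * osc (x + x') (y + y') p) + Re (\<alpha> * cnj \<beta> * osc (x - x') (y - y') p)) / 2) i"
  proof -
    have "Re (\<alpha> * osc x y p) * Re (\<beta> * osc x' y' p)
      = (Re (\<alpha> * \<beta> * osc (x + x') (y + y') p) + Re (\<alpha> * cnj \<beta> * osc (x - x') (y - y') p)) / 2" for p
    proof -
      have "\<alpha> * osc x y p * (\<beta> * osc x' y' p) = \<alpha> * \<beta> * (osc x y p * osc x' y' p)"
        "\<alpha> * osc x y p * cnj (\<beta> * osc x' y' p) = \<alpha> * cnj \<beta> * (osc x y p * cnj (osc x' y' p))"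
        by (simp_all only: complex_cnj_mult mult_ac)
      then show ?thesis unfolding Re_mult_Re osc_mult by (simp only:)
    qed
    then show ?thesis by (simp only:)
  qed
  also have "\<dots> = (Re (\<alpha> * \<beta> * grid_mean (\<lambda>i p. osc (x + x') (y + y') p) i)
      + Re (\<alpha> * cnj \<beta> * grid_mean (\<lambda>i p. osc (x - x') (y - y') p) i)) / 2"
  proof -
    have Re_mean: "Re (a * ((\<Sum>p\<in>grid i. f p) / of_nat n)) = (\<Sum>p\<in>grid i. Re (a * f p)) / real n" for a f n
      by (simp only: times_divide_eq_right Re_divide_of_nat sum_distrib_left Re_sum)
    have split: "(\<Sum>p\<in>grid i. (f p + g p) / 2) / r = ((\<Sum>p\<in>grid i. f p) / r + (\<Sum>p\<in>grid i. g p) / r) / 2" for f g and r :: real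
      unfolding sum_divide_distrib[symmetric] sum.distrib by (simp add: add_divide_distrib)
    show ?thesis unfolding Re_mean by (rule split)
  qed
  finally show ?thesis unfolding osc_grid_mean osc_mean_def .
qed

lemma osc_mean_0: "1 \<le> fst i \<Longrightarrow> 1 \<le> snd i \<Longrightarrow> osc_mean i 0 0 = 1"
  by (simp add: osc_mean_def dirichlet_mean_def)

lemma osc_mean_le:
  "norm (osc_mean i x y) \<le> norm (dirichlet_mean x (fst i))"
  "norm (osc_mean i x y) \<le> norm (dirichlet_mean y (snd i))"
  using dirichlet_mean_le_1[of x "fst i"] dirichlet_mean_le_1[of y "snd i"]
  by (simp_all add: osc_mean_def norm_mult mult_left_le mult_right_le_one_le mult_left_le_one_le)

lemma abs_Re_mult_le: "norm z \<le> e \<Longrightarrow> \<bar>Re (\<alpha> * \<beta> * z)\<bar> \<le> norm \<alpha> * norm \<beta> * e"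
  by (rule order_trans[OF abs_Re_le_cmod]) (simp add: norm_mult mult_left_mono)

section \<open>Consistency of the sinusoidal estimator\<close>

definition sinusoid :: "real \<Rightarrow> real \<Rightarrow> real \<Rightarrow> real \<Rightarrow> nat \<times> nat \<Rightarrow> real"
  where "sinusoid A B l m p = A * cos (l * real (fst p) + m * real (snd p)) + B * sin (l * real (fst p) + m * real (snd p))"

lemma sinusoid_Re: "sinusoid A B l m p = Re (Complex A (- B) * osc l m p)"
  by (simp add: sinusoid_def osc_def)

lemma sinusoid_square_mean:
  fixes \<alpha> \<beta> :: complex
  assumes i: "1 \<le> fst i" "1 \<le> snd i"
  shows "grid_mean (\<lambda>i p. (Re (\<alpha> * osc l m p) - Re (\<beta> * osc l0 m0 p))\<^sup>2) i
    = grid_mean (\<lambda>i p. (Re (\<alpha> * osc l m p))\<^sup>2) i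
      + ((norm \<beta>)\<^sup>2 + Re (\<beta> * \<beta> * osc_mean i (l0 + l0) (m0 + m0))) / 2
      - Re (\<alpha> * \<beta> * osc_mean i (l + l0) (m + m0)) - Re (\<alpha> * cnj \<beta> * osc_mean i (l - l0) (m - m0))"
    and "grid_mean (\<lambda>i p. (Re (\<alpha> * osc l m p))\<^sup>2) i = ((norm \<alpha>)\<^sup>2 + Re (\<alpha> * \<alpha> * osc_mean i (l + l) (m + m))) / 2"
proof -
  have N: "0 < card (grid i)" using i by (simp add: card_grid)
  note P = osc_product_mean[OF N]
  have nn: "Re (z * cnj z * osc_mean i 0 0) = (norm z)\<^sup>2" for z
    unfolding osc_mean_0[OF i] cmod_power2 by (simp add: power2_eq_square)
  have sq: "grid_mean (\<lambda>i p. (Re (z * osc x y p))\<^sup>2) i = ((norm z)\<^sup>2 + Re (z * z * osc_mean i (x + x) (y + y))) / 2" for z x y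
    using P[of z x y z x y] nn[of z] by (simp only: power2_eq_square diff_self add.commute)
  show "grid_mean (\<lambda>i p. (Re (\<alpha> * osc l m p))\<^sup>2) i = ((norm \<alpha>)\<^sup>2 + Re (\<alpha> * \<alpha> * osc_mean i (l + l) (m + m))) / 2"
    by (rule sq)
  let ?f = "\<lambda>p. Re (\<alpha> * osc l m p)" and ?g = "\<lambda>p. Re (\<beta> * osc l0 m0 p)"
  have "(\<Sum>p\<in>grid i. (?f p - ?g p)\<^sup>2) = (\<Sum>p\<in>grid i. (?f p)\<^sup>2) + (\<Sum>p\<in>grid i. (?g p)\<^sup>2) - 2 * (\<Sum>p\<in>grid i. ?f p * ?g p)"
    unfolding power2_diff sum.distrib sum_subtractf sum_distrib_left by (simp only: mult.assoc)
  then have "grid_mean (\<lambda>i p. (?f p - ?g p)\<^sup>2) i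
    = grid_mean (\<lambda>i p. (?f p)\<^sup>2) i + grid_mean (\<lambda>i p. (?g p)\<^sup>2) i - 2 * grid_mean (\<lambda>i p. ?f p * ?g p) i"
    by (simp only: add_divide_distrib diff_divide_distrib times_divide_eq_right)
  then show "grid_mean (\<lambda>i p. (?f p - ?g p)\<^sup>2) i
    = grid_mean (\<lambda>i p. (?f p)\<^sup>2) i
      + ((norm \<beta>)\<^sup>2 + Re (\<beta> * \<beta> * osc_mean i (l0 + l0) (m0 + m0))) / 2
      - Re (\<alpha> * \<beta> * osc_mean i (l + l0) (m + m0)) - Re (\<alpha> * cnj \<beta> * osc_mean i (l - l0) (m - m0))"
    unfolding P[of \<alpha> l m \<beta> l0 m0] sq[of \<beta> l0 m0]
    by (simp only: times_divide_eq_right nonzero_mult_div_cancel_left[OF zero_neq_numeral[symmetric]] diff_diff_eq)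
qed

text \<open>When the sum frequencies average out, the mean square is
  \<open>r^2 / 2 + a^2 / 2 - Re (\<alpha> * cnj \<beta> * V)\<close> for the complex amplitudes
  \<open>\<alpha>\<close>, \<open>\<beta>\<close>, their norms \<open>r\<close>, \<open>a\<close>
  and the kernel \<open>V\<close> of the frequency difference. Three regimes bound it below:
  \<open>V\<close> near zero for frequencies at a fixed distance; \<open>norm V \<le> \<rho>\<close>
  for a distance of order \<open>1 / T\<close> or \<open>1 / S\<close>; and \<open>V\<close> near
  one, where the mean square is about \<open>(norm (\<alpha> - \<beta>))^2 / 2\<close> and the
  amplitudes must differ.\<close>

lemma sinusoid_identifiable:
  fixes A0 B0 l0 m0 k \<delta> :: real
  assumes l0: "0 < l0" "l0 < pi" and m0: "0 < m0" "m0 < pi" and AB: "A0 \<noteq> 0 \<or> B0 \<noteq> 0" and \<delta>: "0 < \<delta>" and k: "0 \<le> k"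
  obtains c n0 where "0 < c" "1 \<le> n0"
    "\<And>i A B l m. n0 \<le> fst i \<Longrightarrow> n0 \<le> snd i \<Longrightarrow> \<bar>A\<bar> \<le> k \<Longrightarrow> \<bar>B\<bar> \<le> k \<Longrightarrow> l \<in> {0..pi} \<Longrightarrow> m \<in> {0..pi} \<Longrightarrow>
      \<delta> \<le> \<bar>A - A0\<bar> \<or> \<delta> \<le> \<bar>B - B0\<bar> \<or> \<delta> \<le> real (fst i) * \<bar>l - l0\<bar> \<or> \<delta> \<le> real (snd i) * \<bar>m - m0\<bar> \<Longrightarrow>
      c \<le> grid_mean (\<lambda>i p. (sinusoid A B l m p - sinusoid A0 B0 l0 m0 p)\<^sup>2) i"
proof -
  define \<beta> where "\<beta> = Complex A0 (- B0)"
  define a where "a = norm \<beta>"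
  have a: "0 < a" using AB by (auto simp: a_def \<beta>_def complex_eq_iff)
  define b where "b = 2 * k"
  have b: "0 \<le> b" using k by (simp add: b_def)
  \<comment> \<open>\<open>\<eta>\<close> is the distance of the true frequencies from the ends of
    \<open>[0, pi]\<close>. It keeps \<open>l + l0\<close> away from \<open>0\<close> and
    \<open>2 * pi\<close> for every admissible \<open>l\<close>.\<close>
  define \<eta> where "\<eta> = min (min l0 (pi - l0)) (min m0 (pi - m0))"
  have \<eta>: "0 < \<eta>" "\<eta> \<le> l0" "\<eta> \<le> pi - l0" "\<eta> \<le> m0" "\<eta> \<le> pi - m0" using l0 m0 by (auto simp: \<eta>_def)
  define \<sigma> where "\<sigma> = 1 / sin (\<eta> / 2 / 2)"
  have \<sigma>: "0 < \<sigma>" using \<eta> pi_gt_zero l0 unfolding \<sigma>_def by (intro divide_pos_pos sin_gt_zero) auto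
  \<comment> \<open>The threshold for \<open>V\<close> near one: replacing \<open>V\<close> by
    \<open>1\<close> costs at most \<open>2 * \<delta>1 * (a * b)\<close>, which is to be at most a
    quarter of \<open>\<delta>^2\<close>.\<close>
  define \<delta>1 where "\<delta>1 = min \<delta> (\<delta>\<^sup>2 / (8 * (a * b + 1)))"
  have ab1: "0 < a * b + 1" using a b by (simp add: add_nonneg_pos)
  have \<delta>1: "0 < \<delta>1" "\<delta>1 \<le> \<delta>" using \<delta> ab1 by (auto simp: \<delta>1_def)
  have \<delta>1ab: "2 * \<delta>1 * (a * b) \<le> \<delta>\<^sup>2 / 4"
  proof -
    have "\<delta>1 * (a * b) \<le> \<delta>1 * (a * b + 1)" using \<delta>1 by simp
    also have "\<dots> \<le> \<delta>\<^sup>2 / (8 * (a * b + 1)) * (a * b + 1)" using ab1 by (intro mult_right_mono) (auto simp: \<delta>1_def)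
    also have "\<dots> = \<delta>\<^sup>2 / 8"
    proof -
      have "\<delta>\<^sup>2 / (8 * y) * y = \<delta>\<^sup>2 / 8" if "y \<noteq> 0" for y using that by simp
      from this[of "a * b + 1"] show ?thesis using ab1 by simp
    qed
    finally show ?thesis by simp
  qed
  obtain \<rho> n1 where \<rho>: "0 < \<rho>" "\<rho> < 1" "1 \<le> n1"
    and \<rho>D: "\<And>n x. n1 \<le> n \<Longrightarrow> \<bar>x\<bar> \<le> pi \<Longrightarrow> \<delta>1 \<le> real n * \<bar>x\<bar> \<Longrightarrow> norm (dirichlet_mean x n) \<le> \<rho>"
    using dirichlet_mean_away[OF \<delta>1(1)] by blast
  define c where "c = min (a\<^sup>2 / 4) (min ((1 - \<rho>) * a\<^sup>2 / 4) (\<delta>\<^sup>2 / 8))"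
  have c: "0 < c" "2 * c \<le> a\<^sup>2 / 2" "2 * c \<le> (1 - \<rho>) * a\<^sup>2 / 2" "2 * c \<le> \<delta>\<^sup>2 / 4"
    using a \<rho> \<delta> by (auto simp: c_def)
  \<comment> \<open>\<open>E\<close> collects the amplitude weights of the oscillating terms. Each
    term is damped by \<open>e\<close>, so that together they cost at most \<open>c\<close>; this is
    why the margins above are stated for \<open>2 * c\<close>.\<close>
  define E where "E = a\<^sup>2 + 2 * (a * b) + b\<^sup>2"
  have E: "0 < E" using a b unfolding E_def by (intro add_pos_nonneg) auto
  define n0 where "n0 = max n1 (nat \<lceil>\<sigma> * E / c\<rceil>)"
  have n0: "1 \<le> n0" "n1 \<le> n0" "\<sigma> * E / c \<le> real n0" using \<rho>(3) by (auto simp: n0_def) linarith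
  define e where "e = \<sigma> / real n0"
  have e: "0 < e" "E * e \<le> c" using n0 \<sigma> c(1) by (auto simp: e_def field_simps)
  have small: "norm (dirichlet_mean x n) \<le> e" if "\<eta> / 2 \<le> \<bar>x\<bar>" "\<bar>x\<bar> \<le> 2 * pi - \<eta> / 2" "n0 \<le> n" for x n
  proof -
    have "norm (dirichlet_mean x n) \<le> \<sigma> / real n"
      unfolding \<sigma>_def using that \<eta>(1) n0(1) by (intro dirichlet_mean_small) auto
    also have "\<dots> \<le> e" unfolding e_def using that n0(1) \<sigma> by (intro divide_left_mono) auto
    finally show ?thesis .
  qed
  show thesis
  proof (rule that[OF c(1) n0(1)])
    fix i :: "nat \<times> nat" and A B l m :: real
    assume i: "n0 \<le> fst i" "n0 \<le> snd i" and AB: "\<bar>A\<bar> \<le> k" "\<bar>B\<bar> \<le> k" and l: "l \<in> {0..pi}" and m: "m \<in> {0..pi}"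
      and far: "\<delta> \<le> \<bar>A - A0\<bar> \<or> \<delta> \<le> \<bar>B - B0\<bar> \<or> \<delta> \<le> real (fst i) * \<bar>l - l0\<bar> \<or> \<delta> \<le> real (snd i) * \<bar>m - m0\<bar>"
    have i1: "1 \<le> fst i" "1 \<le> snd i" using i n0(1) by auto
    define \<alpha> where "\<alpha> = Complex A (- B)"
    define r where "r = norm \<alpha>"
    have r: "0 \<le> r" "r \<le> b" using cmod_le[of \<alpha>] AB by (auto simp: r_def b_def \<alpha>_def)
    define V where "V = osc_mean i (l - l0) (m - m0)"
    define G where "G = grid_mean (\<lambda>i p. (sinusoid A B l m p - sinusoid A0 B0 l0 m0 p)\<^sup>2) i"
    define Gf where "Gf = grid_mean (\<lambda>i p. (Re (\<alpha> * osc l m p))\<^sup>2) i"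
    define R0 where "R0 = Re (\<beta> * \<beta> * osc_mean i (l0 + l0) (m0 + m0))"
    define R1 where "R1 = Re (\<alpha> * \<beta> * osc_mean i (l + l0) (m + m0))"
    define R2 where "R2 = Re (\<alpha> * \<alpha> * osc_mean i (l + l) (m + m))"
    define RV where "RV = Re (\<alpha> * cnj \<beta> * V)"
    define RV1 where "RV1 = Re (\<alpha> * cnj \<beta> * (V - 1))"
    define RB where "RB = Re (\<alpha> * cnj \<beta>)"
    have aa: "a * a = a\<^sup>2" by (simp add: power2_eq_square)
    have G: "G = Gf + (a\<^sup>2 + R0) / 2
      - R1 - RV"
      unfolding G_def Gf_def V_def R0_def R1_def RV_def sinusoid_Re \<alpha>_def[symmetric] \<beta>_def[symmetric] a_def
      by (rule sinusoid_square_mean(1)[OF i1])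
    have Gf: "Gf = (r\<^sup>2 + R2) / 2"
      unfolding Gf_def r_def R2_def by (rule sinusoid_square_mean(2)[OF i1])
    note G = G[unfolded add_divide_distrib] and Gf = Gf[unfolded add_divide_distrib]
    have Gf0: "0 \<le> Gf" unfolding Gf_def by (intro divide_nonneg_nonneg sum_nonneg) auto
    have e1: "\<bar>R0\<bar> \<le> a * a * e"
      unfolding a_def R0_def using \<eta> l0 by (intro abs_Re_mult_le order_trans[OF osc_mean_le(1) small] i) auto
    have "\<bar>R1\<bar> \<le> r * a * e"
      unfolding a_def r_def R1_def using \<eta> l0 l by (intro abs_Re_mult_le order_trans[OF osc_mean_le(1) small] i) auto
    also have "\<dots> \<le> b * a * e" using r a e by (intro mult_right_mono) auto
    finally have e2: "\<bar>R1\<bar> \<le> b * a * e" .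
    have Ee: "a\<^sup>2 * e + 2 * (b * a * e) + b\<^sup>2 * e \<le> c"
      using e(2) by (simp add: E_def algebra_simps)
    have pos: "0 \<le> a\<^sup>2 * e" "0 \<le> b * a * e" "0 \<le> b\<^sup>2 * e" using a b e by auto
    \<comment> \<open>Since \<open>l\<close> may lie near \<open>0\<close> or \<open>pi\<close>, the
      mean square of the candidate sinusoid may carry a nonvanishing term at frequency
      \<open>2 * l\<close>. It is discarded as nonnegative, and the true sinusoid alone provides
      \<open>a^2 / 2\<close>.\<close>
    have cases1: "c \<le> G" if "norm V \<le> e"
    proof -
      have "\<bar>RV\<bar> \<le> r * a * e"
        using abs_Re_mult_le[OF that, of \<alpha> "cnj \<beta>"] unfolding RV_def RV1_def r_def a_def complex_mod_cnj .
      also have "\<dots> \<le> b * a * e" using r a e by (intro mult_right_mono) auto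
      finally show ?thesis
        using G Gf0 e1 e2 Ee pos c(2) unfolding aa by linarith
    qed
    have "c \<le> G"
    proof (cases "\<eta> / 2 \<le> \<bar>l - l0\<bar> \<or> \<eta> / 2 \<le> \<bar>m - m0\<bar>")
      case True
      have "norm V \<le> e"
      proof (cases "\<eta> / 2 \<le> \<bar>l - l0\<bar>")
        case True
        then show ?thesis
          unfolding V_def using \<eta> l0 l by (intro order_trans[OF osc_mean_le(1) small] i) auto
      next
        case False
        then show ?thesis
          unfolding V_def using True \<eta> m0 m by (intro order_trans[OF osc_mean_le(2) small] i) auto
      qed
      then show ?thesis by (rule cases1)
    next
      case False
      have "\<bar>l - l0\<bar> < \<eta> / 2" using False by simp
      \<comment> \<open>Closeness to \<open>l0\<close> now controls \<open>2 * l\<close> too, so the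
        mean square of the candidate can be kept, as \<open>r^2 / 2\<close>.\<close>
      then have ll: "\<eta> / 2 \<le> \<bar>l + l\<bar>" "\<bar>l + l\<bar> \<le> 2 * pi - \<eta> / 2" using \<eta> by linarith+
      have "\<bar>R2\<bar> \<le> r * r * e"
        unfolding r_def R2_def by (intro abs_Re_mult_le order_trans[OF osc_mean_le(1) small] i ll)
      also have "\<dots> \<le> b * b * e" using r e by (intro mult_right_mono mult_mono) auto
      finally have e3: "\<bar>R2\<bar> \<le> b\<^sup>2 * e" by (simp add: power2_eq_square)
      have low: "r\<^sup>2 / 2 + a\<^sup>2 / 2 - RV - c \<le> G"
        using G Gf e1 e2 e3 Ee pos unfolding aa by linarith
      have dist: "\<bar>l - l0\<bar> \<le> pi" "\<bar>m - m0\<bar> \<le> pi" using l m l0 m0 by auto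
      show ?thesis
      proof (cases "\<delta>1 \<le> real (fst i) * \<bar>l - l0\<bar> \<or> \<delta>1 \<le> real (snd i) * \<bar>m - m0\<bar>")
        case True
        have "norm V \<le> \<rho>"
        proof (cases "\<delta>1 \<le> real (fst i) * \<bar>l - l0\<bar>")
          case True
          then show ?thesis
            unfolding V_def using n0(2) i dist by (intro order_trans[OF osc_mean_le(1) \<rho>D]) auto
        next
          case False
          then show ?thesis
            unfolding V_def using True n0(2) i dist by (intro order_trans[OF osc_mean_le(2) \<rho>D]) auto
        qed
        then have 1: "\<bar>RV\<bar> \<le> r * a * \<rho>"
          unfolding RV_def r_def a_def using abs_Re_mult_le[of V \<rho> \<alpha> "cnj \<beta>"] by (simp only: complex_mod_cnj)
        \<comment> \<open>\<open>r\<close> may be anything in \<open>[0, b]\<close>; bounding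
          \<open>r * a\<close> by the mean of the squares and giving up the part with
          \<open>r\<close> leaves a margin depending on \<open>a\<close> and \<open>\<rho>\<close>
          only.\<close>
        have "r * a \<le> (r\<^sup>2 + a\<^sup>2) / 2" using zero_le_power2[of "r - a"] by (simp add: power2_eq_square algebra_simps)
        then have "r * a * \<rho> \<le> (r\<^sup>2 + a\<^sup>2) / 2 * \<rho>" using \<rho>(1) by (intro mult_right_mono) auto
        also have "\<dots> = r\<^sup>2 / 2 * \<rho> + a\<^sup>2 / 2 * \<rho>" by (simp add: algebra_simps)
        also have "\<dots> \<le> r\<^sup>2 / 2 * 1 + a\<^sup>2 / 2 * \<rho>" using \<rho> by (intro add_right_mono mult_left_mono) auto
        finally have "a\<^sup>2 / 2 - a\<^sup>2 / 2 * \<rho> \<le> r\<^sup>2 / 2 + a\<^sup>2 / 2 - RV"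
          using 1 unfolding abs_le_iff by linarith
        moreover have "(1 - \<rho>) * a\<^sup>2 / 2 = a\<^sup>2 / 2 - a\<^sup>2 / 2 * \<rho>" by (simp add: left_diff_distrib diff_divide_distrib mult.commute)
        ultimately show ?thesis using low c(3) by linarith
      next
        case False
        have V1: "norm (V - 1) \<le> 2 * \<delta>1"
        proof -
          let ?D = "dirichlet_mean (l - l0) (fst i)" and ?D' = "dirichlet_mean (m - m0) (snd i)"
          have "V - 1 = (?D - 1) * ?D' + (?D' - 1)" unfolding V_def osc_mean_def by (simp add: algebra_simps)
          then have "norm (V - 1) \<le> norm (?D - 1) * norm ?D' + norm (?D' - 1)"
            by (metis norm_mult norm_triangle_ineq)
          also have "\<dots> \<le> norm (?D - 1) * 1 + norm (?D' - 1)"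
            by (intro add_right_mono mult_left_mono dirichlet_mean_le_1) simp
          finally show ?thesis
            using dirichlet_mean_near_1[OF i1(1), of "l - l0"] dirichlet_mean_near_1[OF i1(2), of "m - m0"] False by linarith
        qed
        have "RV = RB + RV1"
          unfolding RV_def RB_def RV1_def right_diff_distrib minus_complex.simps by simp
        moreover have "\<bar>RV1\<bar> \<le> r * a * (2 * \<delta>1)"
          using abs_Re_mult_le[OF V1, of \<alpha> "cnj \<beta>"] unfolding RV_def RV1_def r_def a_def complex_mod_cnj .
        moreover have "r * a * (2 * \<delta>1) \<le> b * a * (2 * \<delta>1)" using r a \<delta>1 by (intro mult_right_mono) auto
        moreover have "b * a * (2 * \<delta>1) = 2 * \<delta>1 * (a * b)" by simp
        moreover have "r\<^sup>2 / 2 + a\<^sup>2 / 2 - RB = (A - A0)\<^sup>2 / 2 + (B - B0)\<^sup>2 / 2"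
          unfolding r_def a_def RB_def cmod_power2 \<alpha>_def \<beta>_def by (simp add: power2_eq_square field_simps)
        moreover have "\<delta>\<^sup>2 \<le> (A - A0)\<^sup>2 + (B - B0)\<^sup>2"
        proof -
          have "\<delta> \<le> \<bar>A - A0\<bar> \<or> \<delta> \<le> \<bar>B - B0\<bar>" using far False \<delta>1(2) by linarith
          then have "\<delta>\<^sup>2 \<le> (A - A0)\<^sup>2 \<or> \<delta>\<^sup>2 \<le> (B - B0)\<^sup>2"
            using power_mono[of \<delta> "\<bar>A - A0\<bar>" 2] power_mono[of \<delta> "\<bar>B - B0\<bar>" 2] \<delta> by auto
          then show ?thesis using zero_le_power2[of "A - A0"] zero_le_power2[of "B - B0"] by linarith
        qed
        ultimately show ?thesis using low c(4) \<delta>1ab unfolding abs_le_iff by linarith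
      qed
    qed
    then show "c \<le> grid_mean (\<lambda>i p. (sinusoid A B l m p - sinusoid A0 B0 l0 m0 p)\<^sup>2) i"
      unfolding G_def .
  qed
qed

lemma sinusoid_bound: "\<bar>sinusoid A B l m p\<bar> \<le> \<bar>A\<bar> + \<bar>B\<bar>"
  unfolding sinusoid_def
  by (rule order_trans[OF abs_triangle_ineq]) (auto simp: abs_mult intro!: add_mono mult_left_le)

text \<open>The modulus in the frequencies grows with the grid, as the phase varies by up to
  \<open>T * \<bar>l - l'\<bar> + S * \<bar>m - m'\<bar>\<close>. It is multiplied by the amplitudes
  \<open>A'\<close>, \<open>B'\<close>, which are later those of a net point.\<close>

lemma sinusoid_lipschitz:
  assumes p: "p \<in> grid i"
  shows "\<bar>sinusoid A B l m p - sinusoid A' B' l' m' p\<bar>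
    \<le> \<bar>A - A'\<bar> + \<bar>B - B'\<bar> + (\<bar>A'\<bar> + \<bar>B'\<bar>) * (real (fst i) * \<bar>l - l'\<bar> + real (snd i) * \<bar>m - m'\<bar>)"
proof -
  define x where "x = l * real (fst p) + m * real (snd p)"
  define y where "y = l' * real (fst p) + m' * real (snd p)"
  have "x - y = (l - l') * real (fst p) + (m - m') * real (snd p)" by (simp add: x_def y_def algebra_simps)
  then have "\<bar>x - y\<bar> \<le> \<bar>l - l'\<bar> * real (fst p) + \<bar>m - m'\<bar> * real (snd p)"
    using abs_triangle_ineq[of "(l - l') * real (fst p)" "(m - m') * real (snd p)"] by (simp add: abs_mult)
  also have "\<dots> \<le> \<bar>l - l'\<bar> * real (fst i) + \<bar>m - m'\<bar> * real (snd i)"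
    using p by (intro add_mono mult_left_mono) (auto simp: grid_def)
  finally have xy: "\<bar>x - y\<bar> \<le> real (fst i) * \<bar>l - l'\<bar> + real (snd i) * \<bar>m - m'\<bar>" by (simp add: mult.commute)
  have eq: "sinusoid A B l m p - sinusoid A' B' l' m' p
    = ((A - A') * cos x + (B - B') * sin x) + (A' * (cos x - cos y) + B' * (sin x - sin y))"
    by (simp add: sinusoid_def x_def y_def algebra_simps)
  have 1: "\<bar>(A - A') * cos x\<bar> \<le> \<bar>A - A'\<bar>" "\<bar>(B - B') * sin x\<bar> \<le> \<bar>B - B'\<bar>"
    by (simp_all add: abs_mult mult_left_le)
  have 2: "\<bar>A' * (cos x - cos y)\<bar> \<le> \<bar>A'\<bar> * \<bar>x - y\<bar>" "\<bar>B' * (sin x - sin y)\<bar> \<le> \<bar>B'\<bar> * \<bar>x - y\<bar>"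
    unfolding abs_mult by (intro mult_left_mono abs_cos_diff_le abs_sin_diff_le; simp)+
  have 3: "\<bar>A'\<bar> * \<bar>x - y\<bar> + \<bar>B'\<bar> * \<bar>x - y\<bar> \<le> (\<bar>A'\<bar> + \<bar>B'\<bar>) * (real (fst i) * \<bar>l - l'\<bar> + real (snd i) * \<bar>m - m'\<bar>)"
    unfolding distrib_right[symmetric] by (intro mult_left_mono xy) auto
  have "\<bar>sinusoid A B l m p - sinusoid A' B' l' m' p\<bar>
    \<le> \<bar>(A - A') * cos x\<bar> + \<bar>(B - B') * sin x\<bar> + (\<bar>A' * (cos x - cos y)\<bar> + \<bar>B' * (sin x - sin y)\<bar>)"
    unfolding eq by (intro order_trans[OF abs_triangle_ineq] add_mono abs_triangle_ineq)
  also have "\<dots> \<le> \<bar>A - A'\<bar> + \<bar>B - B'\<bar> + (\<bar>A'\<bar> * \<bar>x - y\<bar> + \<bar>B'\<bar> * \<bar>x - y\<bar>)"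
    by (intro add_mono 1 2)
  also have "\<dots> \<le> \<bar>A - A'\<bar> + \<bar>B - B'\<bar> + (\<bar>A'\<bar> + \<bar>B'\<bar>) * (real (fst i) * \<bar>l - l'\<bar> + real (snd i) * \<bar>m - m'\<bar>)"
    by (intro add_left_mono 3)
  finally show ?thesis .
qed

section \<open>The mean criterion and its uniform approximation\<close>

context median_noise
begin

definition lad_mean :: "'p \<Rightarrow> real \<Rightarrow> real"
  where "lad_mean p h = expectation (\<lambda>\<omega>. \<bar>eps p \<omega> - h\<bar> - \<bar>eps p \<omega>\<bar>)"

lemma lad_mean_eq: "p \<in> J \<Longrightarrow> lad_mean p h = expectation (\<lambda>\<omega>. lad_excess (eps p \<omega>) h)"
proof -
  assume p: "p \<in> J"
  have "\<bar>e - h\<bar> - \<bar>e\<bar> = lad_excess e h - h * sgn e" for e by (simp add: lad_excess_def)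
  then show ?thesis
    unfolding lad_mean_def using integrable_lad_excess[OF p] integrable_sgn[OF p] sgn_mean[OF p] by simp
qed

lemma integrable_lad: "p \<in> J \<Longrightarrow> integrable M (\<lambda>\<omega>. \<bar>eps p \<omega> - h\<bar> - \<bar>eps p \<omega>\<bar>)"
proof -
  assume p: "p \<in> J"
  have [measurable]: "eps p \<in> borel_measurable M" by (rule eps_measurable[OF p])
  show ?thesis by (rule integrable_const_bound[where B = "\<bar>h\<bar>"]) (auto intro!: AE_I2)
qed

lemma lad_mean_lipschitz: "p \<in> J \<Longrightarrow> \<bar>lad_mean p h - lad_mean p h'\<bar> \<le> \<bar>h - h'\<bar>"
proof -
  assume p: "p \<in> J"
  note int = integrable_lad[OF p]
  have "\<bar>lad_mean p h - lad_mean p h'\<bar> = \<bar>expectation (\<lambda>\<omega>. (\<bar>eps p \<omega> - h\<bar> - \<bar>eps p \<omega>\<bar>) - (\<bar>eps p \<omega> - h'\<bar> - \<bar>eps p \<omega>\<bar>))\<bar>"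
    unfolding lad_mean_def Bochner_Integration.integral_diff[OF int[of h] int[of h']] ..
  also have "\<dots> \<le> expectation (\<lambda>\<omega>. \<bar>(\<bar>eps p \<omega> - h\<bar> - \<bar>eps p \<omega>\<bar>) - (\<bar>eps p \<omega> - h'\<bar> - \<bar>eps p \<omega>\<bar>)\<bar>)"
    by (rule integral_abs_bound)
  also have "\<dots> \<le> expectation (\<lambda>_. \<bar>h - h'\<bar>)"
    by (intro integral_mono integrable_abs[OF Bochner_Integration.integrable_diff[OF int[of h] int[of h']]]) auto
  finally show ?thesis by (simp add: prob_space)
qed

text \<open>The curvature gives \<open>\<gamma> / 2 * h^2\<close> up to \<open>h0\<close>, where the
  cubic error is at most half of the main term. Beyond, monotonicity keeps the value at
  \<open>h0\<close>, and the factor \<open>(h0 / B)^2\<close> in \<open>c\<close> converts it into a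
  quadratic bound up to \<open>B\<close>.\<close>

lemma lad_mean_lower:
  assumes B: "0 < B"
  obtains c where "0 < c" "\<And>p h. p \<in> J \<Longrightarrow> \<bar>h\<bar> \<le> B \<Longrightarrow> c * h\<^sup>2 \<le> lad_mean p h"
proof -
  define h0 where "h0 = min B (\<gamma> / (2 * C))"
  have h0: "0 < h0" "h0 \<le> B" "C * h0 \<le> \<gamma> / 2"
    using B C_pos \<gamma>_pos mult_left_mono[of h0 "\<gamma> / (2 * C)" C] by (auto simp: h0_def)
  have small: "\<gamma> / 2 * h\<^sup>2 \<le> lad_mean p h" if p: "p \<in> J" and h: "\<bar>h\<bar> \<le> h0" for p h
  proof -
    have "C * \<bar>h\<bar> \<le> C * h0" using C_pos h by (intro mult_left_mono) auto
    then have "C * \<bar>h\<bar> * h\<^sup>2 \<le> \<gamma> / 2 * h\<^sup>2" using h0(3) by (intro mult_right_mono) auto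
    moreover have "C * \<bar>h\<bar> ^ 3 = C * \<bar>h\<bar> * h\<^sup>2" by (simp add: power3_eq_cube power2_eq_square)
    ultimately show ?thesis using curvature[OF p, of h] unfolding lad_mean_eq[OF p] by linarith
  qed
  define c where "c = \<gamma> / 2 * (h0 / B)\<^sup>2"
  have c: "0 < c" using \<gamma>_pos h0 B by (simp add: c_def)
  show thesis
  proof (rule that[OF c])
    fix p and h :: real assume p: "p \<in> J" and h: "\<bar>h\<bar> \<le> B"
    show "c * h\<^sup>2 \<le> lad_mean p h"
    proof (cases "\<bar>h\<bar> \<le> h0")
      case True
      have "(h0 / B)\<^sup>2 \<le> 1" using h0 B by (intro power_le_one) auto
      then have "\<gamma> / 2 * (h0 / B)\<^sup>2 \<le> \<gamma> / 2 * 1" using \<gamma>_pos by (intro mult_left_mono) auto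
      then have "c * h\<^sup>2 \<le> \<gamma> / 2 * h\<^sup>2" unfolding c_def by (intro mult_right_mono) auto
      then show ?thesis using small[OF p True] by linarith
    next
      case False
      define h1 where "h1 = (if 0 \<le> h then h0 else - h0)"
      have "h1\<^sup>2 = h0\<^sup>2" "\<bar>h1\<bar> \<le> h0" using h0 by (auto simp: h1_def)
      have "(h0 / B)\<^sup>2 * h\<^sup>2 \<le> (h0 / B)\<^sup>2 * B\<^sup>2"
        using power_mono[OF h, of 2] by (intro mult_left_mono) auto
      also have "\<dots> = h0\<^sup>2" using B by (simp add: power_divide)
      finally have "c * h\<^sup>2 \<le> \<gamma> / 2 * h0\<^sup>2"
        unfolding c_def mult.assoc using \<gamma>_pos by (intro mult_left_mono) auto
      also have "\<dots> \<le> lad_mean p h1" using small[OF p \<open>\<bar>h1\<bar> \<le> h0\<close>] \<open>h1\<^sup>2 = h0\<^sup>2\<close> by simp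
      also have "\<dots> \<le> lad_mean p h"
        unfolding lad_mean_eq[OF p]
        using False h0 by (intro integral_mono integrable_lad_excess p lad_excess_mono) (auto simp: h1_def)
      finally show ?thesis .
    qed
  qed
qed

text \<open>A summand \<open>\<bar>e - z\<bar> - \<bar>e\<bar>\<close> is at most
  \<open>\<bar>z\<bar>\<close> in absolute value whatever the noise, so Hoeffding applies with range
  \<open>2 * B\<close>; a union over \<open>Z\<close> multiplies the failure probability by its
  size.\<close>

lemma hoeffding_net:
  fixes Z :: "('p \<Rightarrow> real) set" and \<kappa> B :: real
  assumes Z: "finite Z" "\<And>z p. z \<in> Z \<Longrightarrow> p \<in> I \<Longrightarrow> \<bar>z p\<bar> \<le> B" and B: "0 < B" and \<kappa>: "0 < \<kappa>"
    and IJ: "I \<subseteq> J" and fin: "finite I" and ne: "I \<noteq> {}"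
  shows "\<exists>E\<in>events. 1 - card Z * (2 * exp (- (\<kappa>\<^sup>2 * card I / (2 * B\<^sup>2)))) \<le> prob E \<and>
    (\<forall>\<omega>\<in>E. \<forall>z\<in>Z. \<bar>(\<Sum>p\<in>I. \<bar>eps p \<omega> - z p\<bar> - \<bar>eps p \<omega>\<bar>) - (\<Sum>p\<in>I. lad_mean p (z p))\<bar> \<le> \<kappa> * card I)"
proof -
  let ?N = "real (card I)"
  have N: "0 < ?N" using fin ne by (simp add: card_gt_0_iff)
  let ?X = "\<lambda>z p \<omega>. \<bar>eps p \<omega> - z p\<bar> - \<bar>eps p \<omega>\<bar>"
  let ?q = "2 * exp (- (\<kappa>\<^sup>2 * ?N / (2 * B\<^sup>2)))"
  define E where "E = (\<lambda>z. {\<omega> \<in> space M. \<bar>(\<Sum>p\<in>I. ?X z p \<omega>) - (\<Sum>p\<in>I. lad_mean p (z p))\<bar> \<le> \<kappa> * ?N})"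
  have Xm: "?X z p \<in> borel_measurable M" if "p \<in> I" for z p
    using integrable_lad[of p "z p"] that IJ by auto
  have Em: "E z \<in> events" for z
  proof -
    have [measurable]: "(\<lambda>\<omega>. \<Sum>p\<in>I. ?X z p \<omega>) \<in> borel_measurable M" using Xm by (rule borel_measurable_sum)
    show ?thesis unfolding E_def by measurable
  qed
  have Eq: "1 - ?q \<le> prob (E z)" if z: "z \<in> Z" for z
  proof -
    have indX: "indep_vars (\<lambda>_. borel) (?X z) I"
      using IJ by (intro indep_vars_compose2[OF indep_vars_subset[OF indep], of I "\<lambda>p e. \<bar>e - z p\<bar> - \<bar>e\<bar>"]) auto
    have "?X z p \<omega> \<in> {- B..B}" if "p \<in> I" for p \<omega>
      using Z(2)[OF z that] unfolding atLeastAtMost_iff by (intro conjI) linarith+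
    then have bd: "AE \<omega> in M. ?X z p \<omega> \<in> {- B..B}" if "p \<in> I" for p
      using that by (intro AE_I2)
    interpret H: indep_interval_bounded_random_variables M I "?X z" "\<lambda>_. - B" "\<lambda>_. B"
      by unfold_locales (use fin indX bd in auto)
    interpret H: Hoeffding_ineq M I "?X z" "\<lambda>_. - B" "\<lambda>_. B" "\<Sum>p\<in>I. expectation (?X z p)"
      by unfold_locales
    have S: "(\<Sum>p\<in>I. (B - - B)\<^sup>2) = 4 * B\<^sup>2 * ?N" by (simp add: power2_eq_square)
    have "prob {\<omega> \<in> space M. \<kappa> * ?N \<le> \<bar>(\<Sum>p\<in>I. ?X z p \<omega>) - (\<Sum>p\<in>I. expectation (?X z p))\<bar>}
      \<le> 2 * exp (- 2 * (\<kappa> * ?N)\<^sup>2 / (\<Sum>p\<in>I. (B - - B)\<^sup>2))"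
      using \<kappa> N B unfolding S by (intro H.Hoeffding_ineq_abs_ge[unfolded S]) auto
    also have "- 2 * (\<kappa> * ?N)\<^sup>2 / (\<Sum>p\<in>I. (B - - B)\<^sup>2) = - (\<kappa>\<^sup>2 * ?N / (2 * B\<^sup>2))"
      unfolding S using N B by (simp add: field_simps power2_eq_square)
    finally have P: "prob {\<omega> \<in> space M. \<kappa> * ?N \<le> \<bar>(\<Sum>p\<in>I. ?X z p \<omega>) - (\<Sum>p\<in>I. lad_mean p (z p))\<bar>} \<le> ?q"
      unfolding lad_mean_def .
    have "prob (space M - E z) \<le> prob {\<omega> \<in> space M. \<kappa> * ?N \<le> \<bar>(\<Sum>p\<in>I. ?X z p \<omega>) - (\<Sum>p\<in>I. lad_mean p (z p))\<bar>}"
    proof (rule finite_measure_mono)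
      have [measurable]: "(\<lambda>\<omega>. \<Sum>p\<in>I. ?X z p \<omega>) \<in> borel_measurable M" using Xm by (rule borel_measurable_sum)
      show "{\<omega> \<in> space M. \<kappa> * ?N \<le> \<bar>(\<Sum>p\<in>I. ?X z p \<omega>) - (\<Sum>p\<in>I. lad_mean p (z p))\<bar>} \<in> events" by measurable
    qed (auto simp: E_def)
    then show ?thesis using P prob_compl[OF Em[of z]] by simp
  qed
  obtain E' where E': "E' \<in> events" "1 - (\<Sum>z\<in>Z. ?q) \<le> prob E'" "\<forall>\<omega>\<in>E'. \<forall>z\<in>Z. \<omega> \<in> E z"
    using prob_finite_INT_ge[of Z E "\<lambda>_. ?q", OF Z(1) Em Eq] by auto
  have "1 - card Z * ?q \<le> prob E'" using E'(2) by simp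
  moreover have "\<forall>\<omega>\<in>E'. \<forall>z\<in>Z. \<bar>(\<Sum>p\<in>I. ?X z p \<omega>) - (\<Sum>p\<in>I. lad_mean p (z p))\<bar> \<le> \<kappa> * ?N"
    using E'(3) unfolding E_def by blast
  ultimately show ?thesis by (intro bexI[OF conjI E'(1)])
qed

end

lemma finite_net_Icc:
  fixes k \<eta> :: real
  assumes "0 < \<eta>"
  obtains W where "finite W" "W \<subseteq> {- k..k}" "\<And>x. \<bar>x\<bar> \<le> k \<Longrightarrow> \<exists>y\<in>W. \<bar>x - y\<bar> \<le> \<eta>"
proof -
  obtain W where W: "finite W" "W \<subseteq> {- k..k}" "{- k..k} \<subseteq> (\<Union>y\<in>W. ball y \<eta>)"
    using compactE_image[OF compact_Icc, of "{- k..k}" "\<lambda>y. ball y \<eta>" "- k" k] assms by force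
  show thesis
  proof (rule that[OF W(1,2)])
    fix x assume "\<bar>x\<bar> \<le> k"
    then have "x \<in> {- k..k}" by auto
    then obtain y where "y \<in> W" "x \<in> ball y \<eta>" using W(3) by blast
    then show "\<exists>y\<in>W. \<bar>x - y\<bar> \<le> \<eta>" by (intro bexI[of _ y]) (auto simp: dist_real_def)
  qed
qed

text \<open>The mesh \<open>\<eta> / n\<close> resolves a phase \<open>l * t\<close> with
  \<open>t \<le> n\<close> up to \<open>\<eta>\<close>, at the price of \<open>O(n)\<close>
  points.\<close>

definition freq_net :: "real \<Rightarrow> nat \<Rightarrow> real set"
  where "freq_net \<eta> n = (\<lambda>j. \<eta> * real j / real n) ` {..nat \<lfloor>pi * real n / \<eta>\<rfloor>}"

lemma finite_freq_net[simp]: "finite (freq_net \<eta> n)"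
  by (simp add: freq_net_def)

lemma card_freq_net:
  assumes "0 < \<eta>" "1 \<le> n"
  shows "real (card (freq_net \<eta> n)) \<le> (pi / \<eta> + 1) * real n"
proof -
  have "card (freq_net \<eta> n) \<le> nat \<lfloor>pi * real n / \<eta>\<rfloor> + 1"
    unfolding freq_net_def by (rule order_trans[OF card_image_le]) auto
  then have "real (card (freq_net \<eta> n)) \<le> real (nat \<lfloor>pi * real n / \<eta>\<rfloor>) + 1"
    by (metis of_nat_1 of_nat_add of_nat_mono)
  also have "\<dots> \<le> pi * real n / \<eta> + real n"
    using assms by (intro add_mono of_nat_floor) auto
  also have "\<dots> = (pi / \<eta> + 1) * real n" by (simp add: algebra_simps)
  finally show ?thesis .
qed

lemma freq_net_dense:
  assumes \<eta>: "0 < \<eta>" and n: "1 \<le> n" and l: "l \<in> {0..pi}"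
  shows "\<exists>l'\<in>freq_net \<eta> n. real n * \<bar>l - l'\<bar> \<le> \<eta>"
proof -
  define x where "x = l * real n / \<eta>"
  have x0: "0 \<le> x" using assms by (simp add: x_def)
  define j where "j = nat \<lfloor>x\<rfloor>"
  have j: "real j \<le> x" "x \<le> real j + 1" using x0 by (auto simp: j_def)
  have "x \<le> pi * real n / \<eta>" unfolding x_def using assms by (intro divide_right_mono mult_right_mono) auto
  then have "j \<le> nat \<lfloor>pi * real n / \<eta>\<rfloor>" unfolding j_def by (intro nat_mono floor_mono)
  then have mem: "\<eta> * real j / real n \<in> freq_net \<eta> n" unfolding freq_net_def by blast
  have "real n * \<bar>l - \<eta> * real j / real n\<bar> = \<bar>real n * (l - \<eta> * real j / real n)\<bar>"
    by (simp add: abs_mult)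
  also have "real n * (l - \<eta> * real j / real n) = \<eta> * (x - real j)"
    using n \<eta> by (simp add: x_def right_diff_distrib)
  also have "\<bar>\<eta> * (x - real j)\<bar> \<le> \<eta> * 1"
    using \<eta> j unfolding abs_mult by (intro mult_mono) auto
  finally show ?thesis using mem by (intro bexI[of _ "\<eta> * real j / real n"]) simp_all
qed

lemma exp_decay_beats_linear:
  fixes c y :: real
  assumes "0 < c" "0 < y"
  shows "y * exp (- (c * y)) \<le> 2 / (c\<^sup>2 * y)"
proof -
  have "(c * y)\<^sup>2 / 2 \<le> exp (c * y)"
    using exp_lower_Taylor_quadratic[of "c * y"] mult_pos_pos[OF assms] by linarith
  then have "exp (- (c * y)) \<le> 1 / ((c * y)\<^sup>2 / 2)"
    using le_imp_inverse_le[of "(c * y)\<^sup>2 / 2" "exp (c * y)"] mult_pos_pos[OF assms] assms by (simp only: exp_minus inverse_eq_divide) simp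
  then have "y * exp (- (c * y)) \<le> y * (1 / ((c * y)\<^sup>2 / 2))" using assms by (intro mult_left_mono) auto
  also have "\<dots> = 2 / (c\<^sup>2 * y)" using assms by (simp add: power2_eq_square)
  finally show ?thesis .
qed

locale grid_noise = median_noise M eps J C \<gamma>
  for M :: "'a measure" and eps :: "nat \<times> nat \<Rightarrow> 'a \<Rightarrow> real" and J C \<gamma> +
  assumes grid_J: "grid i \<subseteq> J"
begin

lemma sinusoid_uniform_deviation:
  fixes A0 B0 l0 m0 k \<kappa> q :: real
  assumes k: "0 \<le> k" and AB0: "\<bar>A0\<bar> \<le> k" "\<bar>B0\<bar> \<le> k" and \<kappa>: "0 < \<kappa>" and q: "0 < q"
  defines "h \<equiv> \<lambda>A B l m p. sinusoid A B l m p - sinusoid A0 B0 l0 m0 p"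
  shows "\<forall>\<^sub>F i in grid_filter. \<exists>E\<in>events. 1 - q \<le> prob E \<and>
    (\<forall>\<omega>\<in>E. \<forall>A B l m. \<bar>A\<bar> \<le> k \<longrightarrow> \<bar>B\<bar> \<le> k \<longrightarrow> l \<in> {0..pi} \<longrightarrow> m \<in> {0..pi} \<longrightarrow>
      \<bar>(\<Sum>p\<in>grid i. \<bar>eps p \<omega> - h A B l m p\<bar> - \<bar>eps p \<omega>\<bar>) - (\<Sum>p\<in>grid i. lad_mean p (h A B l m p))\<bar>
        \<le> \<kappa> * real (card (grid i)))"
proof -
  \<comment> \<open>The nearest net point changes a summand by at most
    \<open>(2 + 4 * k) * \<eta>\<close>: the amplitudes contribute \<open>2 * \<eta>\<close>, the
    frequencies \<open>2 * k * (2 * \<eta>)\<close>. This is paid twice, for the criterion and for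
    its mean, and makes up half of \<open>\<kappa>\<close>; the deviation on the net is the other
    half.\<close>
  define \<eta> where "\<eta> = \<kappa> / (4 * (2 + 4 * k))"
  have \<eta>: "0 < \<eta>" "2 * ((2 + 4 * k) * \<eta>) = \<kappa> / 2"
  proof -
    show "0 < \<eta>" using \<kappa> k by (simp add: \<eta>_def)
    have "2 * (y * (\<kappa> / (4 * y))) = \<kappa> / 2" if "0 < y" for y using that by simp
    from this[of "2 + 4 * k"] show "2 * ((2 + 4 * k) * \<eta>) = \<kappa> / 2" using k unfolding \<eta>_def by simp
  qed
  obtain W where W: "finite W" "W \<subseteq> {- k..k}" "\<And>x. \<bar>x\<bar> \<le> k \<Longrightarrow> \<exists>y\<in>W. \<bar>x - y\<bar> \<le> \<eta>"
    using finite_net_Icc[OF \<eta>(1)] by metis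
  define B where "B = 4 * k + 1"
  have B: "0 < B" using k by (simp add: B_def)
  define c where "c = (\<kappa> / 2)\<^sup>2 / (2 * B\<^sup>2)"
  have c: "0 < c" using \<kappa> B by (simp add: c_def)
  define K where "K = real (card W) * real (card W) * ((pi / \<eta> + 1) * (pi / \<eta> + 1))"
  have K: "0 \<le> K" using \<eta>(1) pi_gt_zero by (simp add: K_def)
  \<comment> \<open>With at most \<open>K * (T * S)\<close> net points the failure probability is at
    most \<open>4 * K / (c^2 * (T * S))\<close>, hence at most \<open>q\<close> for grids beyond
    \<open>n0\<close>.\<close>
  define n0 where "n0 = nat \<lceil>4 * K / (c\<^sup>2 * q)\<rceil> + 1"
  show ?thesis
  proof (rule eventually_grid_filterI[of n0])
    fix T S :: nat assume TS: "n0 \<le> T" "n0 \<le> S"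
    define i where "i = (T, S)"
    have i1: "1 \<le> T" "1 \<le> S" using TS by (auto simp: n0_def)
    let ?N = "real (card (grid i))"
    have Neq: "?N = real T * real S" by (simp add: card_grid i_def)
    have ne: "grid i \<noteq> {}" using i1 by (auto simp: grid_def i_def)
    have N: "0 < ?N" using i1 by (simp add: Neq)
    have "real n0 \<le> ?N"
    proof -
      have "real n0 * 1 \<le> real T * real S" using TS i1 by (intro mult_mono) auto
      then show ?thesis by (simp add: Neq)
    qed
    moreover have "4 * K / (c\<^sup>2 * q) \<le> real n0" unfolding n0_def by linarith
    ultimately have Nq: "4 * K / (c\<^sup>2 * q) \<le> ?N" by linarith
    define net where "net = W \<times> W \<times> freq_net \<eta> T \<times> freq_net \<eta> S"
    define Z where "Z = (\<lambda>(A, B, l, m). h A B l m) ` net"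
    have fnet: "finite net" using W(1) by (simp add: net_def)
    have Z: "finite Z" unfolding Z_def using fnet by simp
    have "real (card Z) \<le> real (card net)" unfolding Z_def using card_image_le[OF fnet] by simp
    also have "\<dots> = real (card W) * real (card W) * (real (card (freq_net \<eta> T)) * real (card (freq_net \<eta> S)))"
      by (simp add: net_def card_cartesian_product)
    also have "\<dots> \<le> real (card W) * real (card W) * (((pi / \<eta> + 1) * real T) * ((pi / \<eta> + 1) * real S))"
      using \<eta>(1) pi_gt_zero i1 by (intro mult_left_mono mult_mono card_freq_net) auto
    also have "\<dots> = K * ?N" by (simp add: K_def Neq)
    finally have cardZ: "real (card Z) \<le> K * ?N" .
    have Zb: "\<bar>z p\<bar> \<le> B" if "z \<in> Z" for z p
    proof -
      obtain A' B' l m where z: "z = h A' B' l m" "A' \<in> W" "B' \<in> W"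
        using \<open>z \<in> Z\<close> by (auto simp: Z_def net_def)
      have "\<bar>A'\<bar> \<le> k" "\<bar>B'\<bar> \<le> k" using z(2,3) W(2) by (auto simp: abs_le_iff)
      then have "\<bar>sinusoid A' B' l m p\<bar> \<le> 2 * k" "\<bar>sinusoid A0 B0 l0 m0 p\<bar> \<le> 2 * k"
        using sinusoid_bound[of A' B' l m p] sinusoid_bound[of A0 B0 l0 m0 p] AB0 by linarith+
      then show ?thesis unfolding z h_def B_def by linarith
    qed
    have "\<exists>E\<in>events. 1 - card Z * (2 * exp (- ((\<kappa> / 2)\<^sup>2 * ?N / (2 * B\<^sup>2)))) \<le> prob E \<and>
      (\<forall>\<omega>\<in>E. \<forall>z\<in>Z. \<bar>(\<Sum>p\<in>grid i. \<bar>eps p \<omega> - z p\<bar> - \<bar>eps p \<omega>\<bar>) - (\<Sum>p\<in>grid i. lad_mean p (z p))\<bar> \<le> \<kappa> / 2 * ?N)"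
      by (rule hoeffding_net[OF Z _ B _ grid_J finite_grid ne]) (use Zb \<kappa> in simp_all)
    then obtain E where E: "E \<in> events" "1 - card Z * (2 * exp (- ((\<kappa> / 2)\<^sup>2 * ?N / (2 * B\<^sup>2)))) \<le> prob E"
      "\<And>\<omega> z. \<omega> \<in> E \<Longrightarrow> z \<in> Z \<Longrightarrow>
        \<bar>(\<Sum>p\<in>grid i. \<bar>eps p \<omega> - z p\<bar> - \<bar>eps p \<omega>\<bar>) - (\<Sum>p\<in>grid i. lad_mean p (z p))\<bar> \<le> \<kappa> / 2 * ?N"
      by blast
    have "real (card Z) * (2 * exp (- ((\<kappa> / 2)\<^sup>2 * ?N / (2 * B\<^sup>2)))) \<le> (K * ?N) * (2 * exp (- (c * ?N)))"
      using cardZ by (simp add: c_def mult_right_mono)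
    also have "\<dots> = 2 * K * (?N * exp (- (c * ?N)))" by simp
    also have "\<dots> \<le> 2 * K * (2 / (c\<^sup>2 * ?N))"
      using K by (intro mult_left_mono exp_decay_beats_linear c N) auto
    also have "\<dots> \<le> q"
      using Nq N c q by (simp add: field_simps)
    finally have Eq: "1 - q \<le> prob E" using E(2) by linarith
    have "\<bar>(\<Sum>p\<in>grid i. \<bar>eps p \<omega> - h A B l m p\<bar> - \<bar>eps p \<omega>\<bar>) - (\<Sum>p\<in>grid i. lad_mean p (h A B l m p))\<bar> \<le> \<kappa> * ?N"
      if \<omega>: "\<omega> \<in> E" and AB: "\<bar>A\<bar> \<le> k" "\<bar>B\<bar> \<le> k" and lm: "l \<in> {0..pi}" "m \<in> {0..pi}" for \<omega> A B l m
    proof -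
      obtain A' where A': "A' \<in> W" "\<bar>A - A'\<bar> \<le> \<eta>" using W(3)[OF AB(1)] by blast
      obtain B' where B': "B' \<in> W" "\<bar>B - B'\<bar> \<le> \<eta>" using W(3)[OF AB(2)] by blast
      obtain l' where l': "l' \<in> freq_net \<eta> T" "real T * \<bar>l - l'\<bar> \<le> \<eta>" using freq_net_dense[OF \<eta>(1) i1(1) lm(1)] by blast
      obtain m' where m': "m' \<in> freq_net \<eta> S" "real S * \<bar>m - m'\<bar> \<le> \<eta>" using freq_net_dense[OF \<eta>(1) i1(2) lm(2)] by blast
      have "A' \<in> {- k..k}" "B' \<in> {- k..k}" using A'(1) B'(1) W(2) by blast+
      then have AB'k: "\<bar>A'\<bar> + \<bar>B'\<bar> \<le> 2 * k" by auto
      let ?z = "h A' B' l' m'" and ?h = "h A B l m"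
      have zZ: "?z \<in> Z" unfolding Z_def net_def using A'(1) B'(1) l'(1) m'(1) by force
      have close: "\<bar>?h p - ?z p\<bar> \<le> (2 + 4 * k) * \<eta>" if p: "p \<in> grid i" for p
      proof -
        have "\<bar>?h p - ?z p\<bar> = \<bar>sinusoid A B l m p - sinusoid A' B' l' m' p\<bar>" by (simp add: h_def)
        also have "\<dots> \<le> \<bar>A - A'\<bar> + \<bar>B - B'\<bar> + (\<bar>A'\<bar> + \<bar>B'\<bar>) * (real T * \<bar>l - l'\<bar> + real S * \<bar>m - m'\<bar>)"
          using sinusoid_lipschitz[OF p, of A B l m A' B' l' m'] by (simp add: i_def)
        also have "\<dots> \<le> \<eta> + \<eta> + (2 * k) * (\<eta> + \<eta>)"
          using A'(2) B'(2) l'(2) m'(2) AB'k by (intro add_mono mult_mono) auto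
        finally show ?thesis by (simp add: algebra_simps)
      qed
      have 1: "\<bar>(\<Sum>p\<in>grid i. \<bar>eps p \<omega> - ?h p\<bar> - \<bar>eps p \<omega>\<bar>) - (\<Sum>p\<in>grid i. \<bar>eps p \<omega> - ?z p\<bar> - \<bar>eps p \<omega>\<bar>)\<bar> \<le> ?N * ((2 + 4 * k) * \<eta>)"
      proof -
        have "\<bar>(\<Sum>p\<in>grid i. \<bar>eps p \<omega> - ?h p\<bar> - \<bar>eps p \<omega>\<bar>) - (\<Sum>p\<in>grid i. \<bar>eps p \<omega> - ?z p\<bar> - \<bar>eps p \<omega>\<bar>)\<bar> \<le> (\<Sum>p\<in>grid i. (2 + 4 * k) * \<eta>)"
          unfolding sum_subtractf[symmetric]
        proof (rule order_trans[OF sum_abs], rule sum_mono)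
          fix p assume p: "p \<in> grid i"
          have "\<bar>\<bar>e - x\<bar> - \<bar>e\<bar> - (\<bar>e - y\<bar> - \<bar>e\<bar>)\<bar> \<le> \<bar>x - y\<bar>" for e x y :: real by linarith
          from order_trans[OF this close[OF p]]
          show "\<bar>\<bar>eps p \<omega> - ?h p\<bar> - \<bar>eps p \<omega>\<bar> - (\<bar>eps p \<omega> - ?z p\<bar> - \<bar>eps p \<omega>\<bar>)\<bar> \<le> (2 + 4 * k) * \<eta>" .
        qed
        then show ?thesis by simp
      qed
      have 2: "\<bar>(\<Sum>p\<in>grid i. lad_mean p (?h p)) - (\<Sum>p\<in>grid i. lad_mean p (?z p))\<bar> \<le> ?N * ((2 + 4 * k) * \<eta>)"
      proof -
        have "\<bar>(\<Sum>p\<in>grid i. lad_mean p (?h p)) - (\<Sum>p\<in>grid i. lad_mean p (?z p))\<bar> \<le> (\<Sum>p\<in>grid i. (2 + 4 * k) * \<eta>)"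
          unfolding sum_subtractf[symmetric]
        proof (rule order_trans[OF sum_abs], rule sum_mono)
          fix p assume p: "p \<in> grid i"
          then have "p \<in> J" using grid_J by blast
          from order_trans[OF lad_mean_lipschitz[OF this] close[OF p]]
          show "\<bar>lad_mean p (?h p) - lad_mean p (?z p)\<bar> \<le> (2 + 4 * k) * \<eta>" .
        qed
        then show ?thesis by simp
      qed
      have "?N * ((2 + 4 * k) * \<eta>) + ?N * ((2 + 4 * k) * \<eta>) = ?N * (2 * ((2 + 4 * k) * \<eta>))" by simp
      also have "\<dots> = \<kappa> / 2 * ?N" unfolding \<eta>(2) by simp
      finally have 3: "?N * ((2 + 4 * k) * \<eta>) + ?N * ((2 + 4 * k) * \<eta>) = \<kappa> / 2 * ?N" .
      have 4: "\<kappa> / 2 * ?N + \<kappa> / 2 * ?N = \<kappa> * ?N" by simp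
      have "\<bar>x - y\<bar> \<le> a + (b + a')" if "\<bar>x - x'\<bar> \<le> a" "\<bar>x' - y'\<bar> \<le> b" "\<bar>y - y'\<bar> \<le> a'" for x y x' y' a b a' :: real
        using that by linarith
      from this[OF 1 E(3)[OF \<omega> zZ] 2] show ?thesis using 3 4 by linarith
    qed
    then show "\<exists>E\<in>events. 1 - q \<le> prob E \<and>
    (\<forall>\<omega>\<in>E. \<forall>A B l m. \<bar>A\<bar> \<le> k \<longrightarrow> \<bar>B\<bar> \<le> k \<longrightarrow> l \<in> {0..pi} \<longrightarrow> m \<in> {0..pi} \<longrightarrow>
      \<bar>(\<Sum>p\<in>grid (T, S). \<bar>eps p \<omega> - h A B l m p\<bar> - \<bar>eps p \<omega>\<bar>) - (\<Sum>p\<in>grid (T, S). lad_mean p (h A B l m p))\<bar>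
        \<le> \<kappa> * real (card (grid (T, S))))"
      using E(1) Eq unfolding i_def by (intro bexI[of _ E]) blast+
  qed
qed

text \<open>Every parameter whose criterion does not exceed that of the truth is localized at once,
  so the statement applies pathwise to the estimate. Far from the truth the mean criterion is at
  least \<open>2 * \<kappa>\<close> per grid point, while the criterion deviates from it by at most
  \<open>\<kappa>\<close>.\<close>

theorem sinusoid_lad_consistent:
  fixes A0 B0 l0 m0 k \<delta> q :: real
  assumes l0: "0 < l0" "l0 < pi" and m0: "0 < m0" "m0 < pi" and AB: "A0 \<noteq> 0 \<or> B0 \<noteq> 0"
    and k: "0 \<le> k" and AB0: "\<bar>A0\<bar> \<le> k" "\<bar>B0\<bar> \<le> k" and \<delta>: "0 < \<delta>" and q: "0 < q"
  defines "h \<equiv> \<lambda>A B l m p. sinusoid A B l m p - sinusoid A0 B0 l0 m0 p"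
  shows "\<forall>\<^sub>F i in grid_filter. \<exists>E\<in>events. 1 - q \<le> prob E \<and>
    (\<forall>\<omega>\<in>E. \<forall>A B l m. \<bar>A\<bar> \<le> k \<longrightarrow> \<bar>B\<bar> \<le> k \<longrightarrow> l \<in> {0..pi} \<longrightarrow> m \<in> {0..pi} \<longrightarrow>
      (\<Sum>p\<in>grid i. \<bar>eps p \<omega> - h A B l m p\<bar> - \<bar>eps p \<omega>\<bar>) \<le> 0 \<longrightarrow>
      \<bar>A - A0\<bar> < \<delta> \<and> \<bar>B - B0\<bar> < \<delta> \<and> real (fst i) * \<bar>l - l0\<bar> < \<delta> \<and> real (snd i) * \<bar>m - m0\<bar> < \<delta>)"
proof -
  obtain c n0 where c: "0 < c" "1 \<le> n0" and ident:
    "\<And>i A B l m. n0 \<le> fst i \<Longrightarrow> n0 \<le> snd i \<Longrightarrow> \<bar>A\<bar> \<le> k \<Longrightarrow> \<bar>B\<bar> \<le> k \<Longrightarrow> l \<in> {0..pi} \<Longrightarrow> m \<in> {0..pi} \<Longrightarrow>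
      \<delta> \<le> \<bar>A - A0\<bar> \<or> \<delta> \<le> \<bar>B - B0\<bar> \<or> \<delta> \<le> real (fst i) * \<bar>l - l0\<bar> \<or> \<delta> \<le> real (snd i) * \<bar>m - m0\<bar> \<Longrightarrow>
      c \<le> grid_mean (\<lambda>i p. (h A B l m p)\<^sup>2) i"
    unfolding h_def
  proof (rule sinusoid_identifiable[OF l0 m0 AB \<delta> k], goal_cases)
    case (1 c n0)
    show ?case by (rule 1(1)[OF 1(2,3,4)])
  qed
  define B1 where "B1 = 4 * k + 1"
  have "0 < B1" using k by (simp add: B1_def)
  then obtain c' where c': "0 < c'" "\<And>p h. p \<in> J \<Longrightarrow> \<bar>h\<bar> \<le> B1 \<Longrightarrow> c' * h\<^sup>2 \<le> lad_mean p h"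
  proof (rule lad_mean_lower, goal_cases)
    case (1 c')
    show ?case by (rule 1(1)[OF 1(2,3)])
  qed
  define \<kappa> where "\<kappa> = c' * c / 2"
  have \<kappa>: "0 < \<kappa>" using c c' by (simp add: \<kappa>_def)
  have "\<forall>\<^sub>F i in grid_filter. n0 \<le> fst i \<and> n0 \<le> snd i" by (rule eventually_grid_filterI[of n0]) simp
  with sinusoid_uniform_deviation[OF k AB0 \<kappa> q, of l0 m0]
  show ?thesis
  proof eventually_elim
    case (elim i)
    from elim(1) obtain E where E: "E \<in> events" "1 - q \<le> prob E"
      and dev: "\<forall>\<omega>\<in>E. \<forall>A B l m. \<bar>A\<bar> \<le> k \<longrightarrow> \<bar>B\<bar> \<le> k \<longrightarrow> l \<in> {0..pi} \<longrightarrow> m \<in> {0..pi} \<longrightarrow>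
      \<bar>(\<Sum>p\<in>grid i. \<bar>eps p \<omega> - h A B l m p\<bar> - \<bar>eps p \<omega>\<bar>) - (\<Sum>p\<in>grid i. lad_mean p (h A B l m p))\<bar>
        \<le> \<kappa> * real (card (grid i))" unfolding h_def by (elim bexE conjE)
    have i: "n0 \<le> fst i" "n0 \<le> snd i" using elim(2) by auto
    let ?N = "real (card (grid i))"
    have N: "0 < ?N" using i c(2) by (simp add: card_grid)
    have "\<bar>A - A0\<bar> < \<delta> \<and> \<bar>B - B0\<bar> < \<delta> \<and> real (fst i) * \<bar>l - l0\<bar> < \<delta> \<and> real (snd i) * \<bar>m - m0\<bar> < \<delta>"
      if \<omega>: "\<omega> \<in> E" and AB: "\<bar>A\<bar> \<le> k" "\<bar>B\<bar> \<le> k" and lm: "l \<in> {0..pi}" "m \<in> {0..pi}"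
        and neg: "(\<Sum>p\<in>grid i. \<bar>eps p \<omega> - h A B l m p\<bar> - \<bar>eps p \<omega>\<bar>) \<le> 0" for \<omega> A B l m
    proof (rule ccontr)
      assume "\<not> ?thesis"
      then have "c \<le> grid_mean (\<lambda>i p. (h A B l m p)\<^sup>2) i"
        by (intro ident[OF i AB lm]) (auto simp: not_less)
      then have "c * ?N \<le> (\<Sum>p\<in>grid i. (h A B l m p)\<^sup>2)" using N by (simp add: pos_le_divide_eq)
      then have "c' * (c * ?N) \<le> c' * (\<Sum>p\<in>grid i. (h A B l m p)\<^sup>2)" using c'(1) by (intro mult_left_mono) auto
      also have "\<dots> \<le> (\<Sum>p\<in>grid i. lad_mean p (h A B l m p))"
        unfolding sum_distrib_left
      proof (rule sum_mono)
        fix p assume p: "p \<in> grid i"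
        have "\<bar>h A B l m p\<bar> \<le> B1"
          using sinusoid_bound[of A B l m p] sinusoid_bound[of A0 B0 l0 m0 p] AB AB0 unfolding h_def B1_def by linarith
        then show "c' * (h A B l m p)\<^sup>2 \<le> lad_mean p (h A B l m p)" using p grid_J[of i] by (intro c'(2)) blast+
      qed
      finally have 1: "c' * (c * ?N) \<le> (\<Sum>p\<in>grid i. lad_mean p (h A B l m p))" .
      have "(\<Sum>p\<in>grid i. lad_mean p (h A B l m p)) - \<kappa> * ?N \<le> (\<Sum>p\<in>grid i. \<bar>eps p \<omega> - h A B l m p\<bar> - \<bar>eps p \<omega>\<bar>)"
        using dev[rule_format, OF \<omega> AB lm] unfolding abs_le_iff by linarith
      then have "c' * (c * ?N) - \<kappa> * ?N \<le> 0" using 1 neg by linarith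
      moreover have "c' * (c * ?N) - \<kappa> * ?N = \<kappa> * ?N" by (simp add: \<kappa>_def field_simps)
      ultimately show False using mult_pos_pos[OF \<kappa> N] by linarith
    qed
    then have "\<forall>\<omega>\<in>E. \<forall>A B l m. \<bar>A\<bar> \<le> k \<longrightarrow> \<bar>B\<bar> \<le> k \<longrightarrow> l \<in> {0..pi} \<longrightarrow> m \<in> {0..pi} \<longrightarrow>
      (\<Sum>p\<in>grid i. \<bar>eps p \<omega> - h A B l m p\<bar> - \<bar>eps p \<omega>\<bar>) \<le> 0 \<longrightarrow>
      \<bar>A - A0\<bar> < \<delta> \<and> \<bar>B - B0\<bar> < \<delta> \<and> real (fst i) * \<bar>l - l0\<bar> < \<delta> \<and> real (snd i) * \<bar>m - m0\<bar> < \<delta>"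
      by (intro ballI allI impI)
    then show ?case using E by (intro bexI[OF conjI E(1)])
  qed
qed

end

section \<open>Asymptotic normality\<close>

lemma vector_4:
  "(vector [a, b, c, d] :: ('a::zero) ^ 4) $ 1 = a"
  "(vector [a, b, c, d] :: 'a ^ 4) $ 2 = b"
  "(vector [a, b, c, d] :: 'a ^ 4) $ 3 = c"
  "(vector [a, b, c, d] :: 'a ^ 4) $ 4 = d"
  unfolding vector_def by simp_all

lemma vector_4_axis:
  "(vector [a, b, c, d] :: real ^ 4) = a *\<^sub>R axis 1 1 + b *\<^sub>R axis 2 1 + c *\<^sub>R axis 3 1 + d *\<^sub>R axis 4 1"
  by (simp add: vec_eq_iff forall_4 vector_4 axis_def)

lemma inner_vector_4: "(vector [a, b, c, d] :: real ^ 4) \<bullet> w = a * w $ 1 + b * w $ 2 + c * w $ 3 + d * w $ 4"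
  by (simp add: inner_vec_def sum_4 vector_4)

lemma norm_4_le: "norm (w :: real ^ 4) \<le> \<bar>w $ 1\<bar> + \<bar>w $ 2\<bar> + \<bar>w $ 3\<bar> + \<bar>w $ 4\<bar>"
  using norm_le_l1_cart[of w] by (simp add: sum_4)

text \<open>The Cholesky factor, found by completing the square in the amplitudes. In the limit
  \<open>tau\<close> and \<open>sig\<close> have mean \<open>1 / 2\<close>, which gives the shifts,
  and are uncorrelated with variance \<open>1 / 12\<close>, which gives the diagonal block with
  \<open>(A^2 + B^2) / 24\<close>.\<close>

definition lad_Sigma_root :: "real \<Rightarrow> real \<Rightarrow> real ^ 4 ^ 4"
  where "lad_Sigma_root A B = vector
    [vector [1 / sqrt 2, 0, B / (2 * sqrt 2), B / (2 * sqrt 2)],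
     vector [0, 1 / sqrt 2, - A / (2 * sqrt 2), - A / (2 * sqrt 2)],
     vector [0, 0, sqrt ((A\<^sup>2 + B\<^sup>2) / 24), 0],
     vector [0, 0, 0, sqrt ((A\<^sup>2 + B\<^sup>2) / 24)]]"

lemma lad_Sigma_root: "transpose (lad_Sigma_root A B) ** lad_Sigma_root A B = lad_Sigma A B"
proof -
  have s: "sqrt ((A\<^sup>2 + B\<^sup>2) / 24) * sqrt ((A\<^sup>2 + B\<^sup>2) / 24) = (A\<^sup>2 + B\<^sup>2) / 24" by simp
  have t: "sqrt 2 * (sqrt 2 * x) = 2 * x" for x :: real by (simp add: mult.assoc[symmetric])
  show ?thesis
    unfolding vec_eq_iff forall_4 matrix_matrix_mult_def transpose_def lad_Sigma_root_def lad_Sigma_def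
    by (simp add: sum_4 vector_4 s power2_eq_square field_simps t)
qed

lemma norm_lad_Sigma_root:
  "(norm (lad_Sigma_root A B *v w))\<^sup>2 = (w $ 1 + B * (w $ 3 + w $ 4) / 2)\<^sup>2 / 2 + (w $ 2 - A * (w $ 3 + w $ 4) / 2)\<^sup>2 / 2
    + (A\<^sup>2 + B\<^sup>2) / 24 * ((w $ 3)\<^sup>2 + (w $ 4)\<^sup>2)"
proof -
  have h: "x / (2 * sqrt 2) = (x / 2) / sqrt 2" for x :: real by simp
  have 1: "(lad_Sigma_root A B *v w) $ 1 = (w $ 1 + B * (w $ 3 + w $ 4) / 2) / sqrt 2"
    and 2: "(lad_Sigma_root A B *v w) $ 2 = (w $ 2 - A * (w $ 3 + w $ 4) / 2) / sqrt 2"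
    and 3: "(lad_Sigma_root A B *v w) $ 3 = sqrt ((A\<^sup>2 + B\<^sup>2) / 24) * w $ 3"
    and 4: "(lad_Sigma_root A B *v w) $ 4 = sqrt ((A\<^sup>2 + B\<^sup>2) / 24) * w $ 4"
    unfolding matrix_vector_mult_def lad_Sigma_root_def h
    by (simp_all add: sum_4 vector_4 add_divide_distrib diff_divide_distrib algebra_simps)
  show ?thesis
    unfolding power2_norm_eq_inner inner_vec_def sum_4 1 2 3 4
    by (simp add: power2_eq_square power_mult_distrib algebra_simps flip: real_sqrt_mult)
qed

lemma det_lad_Sigma: "det (lad_Sigma A B) = (det (lad_Sigma_root A B))\<^sup>2"
  unfolding lad_Sigma_root[symmetric] det_mul det_transpose by (simp add: power2_eq_square)

lemma lad_Sigma_singular: "\<not> invertible (lad_Sigma 0 0)"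
proof
  assume "invertible (lad_Sigma 0 0)"
  then obtain X where X: "X ** lad_Sigma 0 0 = mat 1" using invertible_left_inverse by blast
  have "lad_Sigma 0 0 *v axis 3 1 = 0"
    by (simp add: lad_Sigma_def matrix_vector_mult_def vec_eq_iff forall_4 sum_4 vector_4 axis_def)
  then have "(X ** lad_Sigma 0 0) *v axis 3 1 = 0" by (simp add: matrix_vector_mul_assoc[symmetric])
  then have "axis 3 1 = (0 :: real ^ 4)" by (simp add: X)
  then show False by (simp add: axis_eq_0_iff)
qed

text \<open>The mean value bound for \<open>cos z + sin \<phi> * z\<close>, whose derivative
  \<open>sin \<phi> - sin z\<close> is at most \<open>R\<close> in size near \<open>\<phi>\<close>.
  Two points with a common base \<open>\<phi>\<close> appear because a smooth design compares pairs
  of increments against one gradient.\<close>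

lemma cos_tangent:
  fixes x y \<phi> R :: real
  assumes "\<bar>x - \<phi>\<bar> \<le> R" "\<bar>y - \<phi>\<bar> \<le> R"
  shows "\<bar>cos x - cos y + sin \<phi> * (x - y)\<bar> \<le> R * \<bar>x - y\<bar>"
proof -
  have "norm ((cos x + sin \<phi> * x) - (cos y + sin \<phi> * y)) \<le> R * norm (x - y)"
  proof (rule field_differentiable_bound[of "{\<phi> - R..\<phi> + R}"])
    show "((\<lambda>z. cos z + sin \<phi> * z) has_field_derivative - sin z + sin \<phi>) (at z within {\<phi> - R..\<phi> + R})" for z
      by (auto intro!: derivative_eq_intros)
    show "norm (- sin z + sin \<phi>) \<le> R" if "z \<in> {\<phi> - R..\<phi> + R}" for z
    proof -
      have "\<bar>sin \<phi> - sin z\<bar> \<le> \<bar>\<phi> - z\<bar>" by (rule abs_sin_diff_le)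
      also have "\<dots> \<le> R" using that by auto
      finally show ?thesis by simp
    qed
  qed (use assms in auto)
  then show ?thesis by (simp add: algebra_simps)
qed

lemma sin_tangent:
  fixes x y \<phi> R :: real
  assumes "\<bar>x - \<phi>\<bar> \<le> R" "\<bar>y - \<phi>\<bar> \<le> R"
  shows "\<bar>sin x - sin y - cos \<phi> * (x - y)\<bar> \<le> R * \<bar>x - y\<bar>"
  using cos_tangent[of "x - pi / 2" "\<phi> - pi / 2" R "y - pi / 2"] assms by (simp add: cos_diff sin_diff)

lemma sinusoid_tangent:
  fixes a b u v u' v' \<phi> \<psi> \<psi>' r D :: real
  assumes r: "0 \<le> r" and D: "0 \<le> D" and u: "\<bar>u'\<bar> \<le> r" "\<bar>v'\<bar> \<le> r" and \<psi>: "\<bar>\<psi>\<bar> \<le> 2 * r" "\<bar>\<psi>'\<bar> \<le> 2 * r"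
    and d: "\<bar>u - u'\<bar> \<le> D" "\<bar>v - v'\<bar> \<le> D" "\<bar>\<psi> - \<psi>'\<bar> \<le> 2 * D"
  shows "\<bar>((a + u) * cos (\<phi> + \<psi>) + (b + v) * sin (\<phi> + \<psi>)) - ((a + u') * cos (\<phi> + \<psi>') + (b + v') * sin (\<phi> + \<psi>'))
      - ((u - u') * cos \<phi> + (v - v') * sin \<phi> + (\<psi> - \<psi>') * (b * cos \<phi> - a * sin \<phi>))\<bar>
    \<le> (8 + 4 * (\<bar>a\<bar> + \<bar>b\<bar>)) * r * D"
proof -
  let ?x = "\<phi> + \<psi>" and ?y = "\<phi> + \<psi>'"
  \<comment> \<open>\<open>t1\<close> to \<open>t4\<close> are products of an amplitude increment
    and a phase increment; \<open>t5\<close> and \<open>t6\<close> are the tangent errors of cosine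
    and sine at \<open>\<phi>\<close>, weighted by the base amplitudes.\<close>
  define t1 where "t1 = (u - u') * (cos ?x - cos \<phi>)"
  define t2 where "t2 = (v - v') * (sin ?x - sin \<phi>)"
  define t3 where "t3 = u' * (cos ?x - cos ?y)"
  define t4 where "t4 = v' * (sin ?x - sin ?y)"
  define t5 where "t5 = a * (cos ?x - cos ?y + sin \<phi> * (?x - ?y))"
  define t6 where "t6 = b * (sin ?x - sin ?y - cos \<phi> * (?x - ?y))"
  have b1: "\<bar>t1\<bar> \<le> D * (2 * r)"
    unfolding t1_def abs_mult using d(1) abs_cos_diff_le[of ?x \<phi>] \<psi>(1) D by (intro mult_mono) auto
  have b2: "\<bar>t2\<bar> \<le> D * (2 * r)"
    unfolding t2_def abs_mult using d(2) abs_sin_diff_le[of ?x \<phi>] \<psi>(1) D by (intro mult_mono) auto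
  have b3: "\<bar>t3\<bar> \<le> r * (2 * D)"
    unfolding t3_def abs_mult using u(1) abs_cos_diff_le[of ?x ?y] d(3) r by (intro mult_mono) auto
  have b4: "\<bar>t4\<bar> \<le> r * (2 * D)"
    unfolding t4_def abs_mult using u(2) abs_sin_diff_le[of ?x ?y] d(3) r by (intro mult_mono) auto
  have rD: "2 * r * \<bar>?x - ?y\<bar> \<le> 2 * r * (2 * D)" using d(3) r by (intro mult_left_mono) auto
  have b5: "\<bar>t5\<bar> \<le> \<bar>a\<bar> * (2 * r * (2 * D))"
    unfolding t5_def abs_mult using \<psi> by (intro mult_left_mono order_trans[OF cos_tangent rD]) auto
  have b6: "\<bar>t6\<bar> \<le> \<bar>b\<bar> * (2 * r * (2 * D))"
    unfolding t6_def abs_mult using \<psi> by (intro mult_left_mono order_trans[OF sin_tangent rD]) auto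
  have "((a + u) * cos ?x + (b + v) * sin ?x) - ((a + u') * cos ?y + (b + v') * sin ?y)
      - ((u - u') * cos \<phi> + (v - v') * sin \<phi> + (\<psi> - \<psi>') * (b * cos \<phi> - a * sin \<phi>))
    = t1 + t2 + (t3 + t4) + (t5 + t6)"
    unfolding t1_def t2_def t3_def t4_def t5_def t6_def by (simp add: algebra_simps)
  also have "\<bar>\<dots>\<bar> \<le> \<bar>t1\<bar> + \<bar>t2\<bar> + (\<bar>t3\<bar> + \<bar>t4\<bar>) + (\<bar>t5\<bar> + \<bar>t6\<bar>)"
    by (intro order_trans[OF abs_triangle_ineq] add_mono abs_triangle_ineq)
  also have "\<dots> \<le> D * (2 * r) + D * (2 * r) + (r * (2 * D) + r * (2 * D)) + (\<bar>a\<bar> * (2 * r * (2 * D)) + \<bar>b\<bar> * (2 * r * (2 * D)))"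
    by (intro add_mono b1 b2 b3 b4 b5 b6)
  also have "\<dots> = (8 + 4 * (\<bar>a\<bar> + \<bar>b\<bar>)) * r * D" by (simp add: algebra_simps)
  finally show ?thesis .
qed

section \<open>The sinusoidal model as a smooth design\<close>

definition sinusoid_increment :: "real \<Rightarrow> real \<Rightarrow> real \<Rightarrow> real \<Rightarrow> nat \<times> nat \<Rightarrow> nat \<times> nat \<Rightarrow> real ^ 4 \<Rightarrow> real"
  where "sinusoid_increment A B l m i p w =
    sinusoid (A + w $ 1) (B + w $ 2) (l + w $ 3 / real (fst i)) (m + w $ 4 / real (snd i)) p - sinusoid A B l m p"

definition sinusoid_gradient :: "real \<Rightarrow> real \<Rightarrow> real \<Rightarrow> real \<Rightarrow> nat \<times> nat \<Rightarrow> nat \<times> nat \<Rightarrow> real ^ 4"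
  where "sinusoid_gradient A B l m i p = (let \<phi> = l * real (fst p) + m * real (snd p) in
    vector [cos \<phi>, sin \<phi>, tau i p * (B * cos \<phi> - A * sin \<phi>), sig i p * (B * cos \<phi> - A * sin \<phi>)])"

lemma sinusoid_increment_eq:
  assumes "p \<in> grid i"
  shows "sinusoid_increment A B l m i p w = (A + w $ 1) * cos ((l * real (fst p) + m * real (snd p)) + (w $ 3 * tau i p + w $ 4 * sig i p))
    + (B + w $ 2) * sin ((l * real (fst p) + m * real (snd p)) + (w $ 3 * tau i p + w $ 4 * sig i p)) - sinusoid A B l m p"
proof -
  have "(l + w $ 3 / real (fst i)) * real (fst p) + (m + w $ 4 / real (snd i)) * real (snd p)
    = (l * real (fst p) + m * real (snd p)) + (w $ 3 * tau i p + w $ 4 * sig i p)"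
    by (simp add: tau_def sig_def algebra_simps)
  then show ?thesis unfolding sinusoid_increment_def sinusoid_def by (simp only:)
qed

lemma sinusoid_gradient_norm:
  assumes p: "p \<in> grid i"
  shows "norm (sinusoid_gradient A B l m i p) \<le> 8 + 4 * (\<bar>A\<bar> + \<bar>B\<bar>)"
proof -
  define \<phi> where "\<phi> = l * real (fst p) + m * real (snd p)"
  have g: "sinusoid_gradient A B l m i p = vector [cos \<phi>, sin \<phi>, tau i p * (B * cos \<phi> - A * sin \<phi>), sig i p * (B * cos \<phi> - A * sin \<phi>)]"
    by (simp add: sinusoid_gradient_def \<phi>_def Let_def)
  have e: "\<bar>B * cos \<phi> - A * sin \<phi>\<bar> \<le> \<bar>A\<bar> + \<bar>B\<bar>"
  proof -
    have "\<bar>B * cos \<phi>\<bar> \<le> \<bar>B\<bar>" "\<bar>A * sin \<phi>\<bar> \<le> \<bar>A\<bar>" by (simp_all add: abs_mult mult_left_le)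
    then show ?thesis using abs_triangle_ineq4[of "B * cos \<phi>" "A * sin \<phi>"] by linarith
  qed
  have "\<bar>tau i p * (B * cos \<phi> - A * sin \<phi>)\<bar> \<le> 1 * (\<bar>A\<bar> + \<bar>B\<bar>)" "\<bar>sig i p * (B * cos \<phi> - A * sin \<phi>)\<bar> \<le> 1 * (\<bar>A\<bar> + \<bar>B\<bar>)"
    unfolding abs_mult using e tau_sig_bounds[OF p] by (intro mult_mono; auto)+
  moreover have "\<bar>cos \<phi>\<bar> \<le> 1" "\<bar>sin \<phi>\<bar> \<le> 1" by simp_all
  ultimately show ?thesis using norm_4_le[of "sinusoid_gradient A B l m i p"] unfolding g vector_4 by linarith
qed

text \<open>The complex form feeds the general mean square limit: amplitude increments enter as a
  constant coefficient, frequency increments as one that is linear in \<open>tau\<close> and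
  \<open>sig\<close>.\<close>

lemma sinusoid_gradient_inner:
  "sinusoid_gradient A B l m i p \<bullet> w = Re ((Complex (w $ 1) (- w $ 2) + Complex B A * of_real (w $ 3 * tau i p + w $ 4 * sig i p)) * osc l m p)"
  unfolding sinusoid_gradient_def Let_def inner_vector_4 osc_def by (simp add: algebra_simps)

lemma sinusoid_gram_limit:
  assumes "cis (2 * l) \<noteq> 1"
  shows "((\<lambda>i. (\<Sum>p\<in>grid i. (sinusoid_gradient A B l m i p \<bullet> w)\<^sup>2) / real (card (grid i)))
    \<longlongrightarrow> (norm (lad_Sigma_root A B *v w))\<^sup>2) grid_filter"
proof -
  have "((norm (Complex (w $ 1) (- w $ 2)))\<^sup>2 + Re (Complex (w $ 1) (- w $ 2) * cnj (Complex B A)) * (w $ 3 + w $ 4)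
      + (norm (Complex B A))\<^sup>2 * ((w $ 3)\<^sup>2 / 3 + w $ 3 * w $ 4 / 2 + (w $ 4)\<^sup>2 / 3)) / 2 = (norm (lad_Sigma_root A B *v w))\<^sup>2"
    unfolding norm_lad_Sigma_root cmod_power2 by (simp add: power2_eq_square field_simps)
  then show ?thesis
    using quadratic_osc_mean_limit[OF assms, of "Complex (w $ 1) (- w $ 2)" "Complex B A" "w $ 3" "w $ 4" m]
    unfolding sinusoid_gradient_inner by simp
qed

lemma sinusoid_smooth_design:
  "smooth_design (8 + 4 * (\<bar>A\<bar> + \<bar>B\<bar>)) (grid i) (sinusoid_gradient A B l m i) (sinusoid_increment A B l m i)"
  unfolding smooth_design_def
proof (intro ballI conjI allI impI)
  fix p assume p: "p \<in> grid i"
  show "norm (sinusoid_gradient A B l m i p) \<le> 8 + 4 * (\<bar>A\<bar> + \<bar>B\<bar>)" by (rule sinusoid_gradient_norm[OF p])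
  show "sinusoid_increment A B l m i p 0 = 0" by (simp add: sinusoid_increment_def)
  fix r :: real and w w' :: "real ^ 4" assume w: "norm w \<le> r" "norm w' \<le> r"
  define \<phi> where "\<phi> = l * real (fst p) + m * real (snd p)"
  define \<psi> where "\<psi> v = v $ 3 * tau i p + v $ 4 * sig i p" for v :: "real ^ 4"
  note b = tau_sig_bounds[OF p]
  have c: "\<bar>v $ k\<bar> \<le> norm v" for v :: "real ^ 4" and k by (rule component_le_norm_cart)
  have \<psi>: "\<bar>\<psi> v\<bar> \<le> 2 * norm v" for v
  proof -
    have "\<bar>v $ 3 * tau i p\<bar> \<le> norm v * 1" "\<bar>v $ 4 * sig i p\<bar> \<le> norm v * 1"
      unfolding abs_mult using b c by (intro mult_mono; auto)+
    then show ?thesis unfolding \<psi>_def by linarith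
  qed
  have \<psi>d: "\<psi> w - \<psi> w' = \<psi> (w - w')" by (simp add: \<psi>_def algebra_simps)
  have r: "0 \<le> r" using w(1) norm_ge_zero[of w] by linarith
  have "\<bar>((A + w $ 1) * cos (\<phi> + \<psi> w) + (B + w $ 2) * sin (\<phi> + \<psi> w)) - ((A + w' $ 1) * cos (\<phi> + \<psi> w') + (B + w' $ 2) * sin (\<phi> + \<psi> w'))
      - ((w $ 1 - w' $ 1) * cos \<phi> + (w $ 2 - w' $ 2) * sin \<phi> + (\<psi> w - \<psi> w') * (B * cos \<phi> - A * sin \<phi>))\<bar>
    \<le> (8 + 4 * (\<bar>A\<bar> + \<bar>B\<bar>)) * r * norm (w - w')"
  proof (rule sinusoid_tangent[OF r norm_ge_zero])
    show "\<bar>w' $ 1\<bar> \<le> r" "\<bar>w' $ 2\<bar> \<le> r" using c[of w'] w(2) order_trans by blast+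
    show "\<bar>\<psi> w\<bar> \<le> 2 * r" "\<bar>\<psi> w'\<bar> \<le> 2 * r" using \<psi>[of w] \<psi>[of w'] w by linarith+
    show "\<bar>w $ 1 - w' $ 1\<bar> \<le> norm (w - w')" "\<bar>w $ 2 - w' $ 2\<bar> \<le> norm (w - w')"
      using c[of "w - w'" 1] c[of "w - w'" 2] by simp_all
    show "\<bar>\<psi> w - \<psi> w'\<bar> \<le> 2 * norm (w - w')" unfolding \<psi>d by (rule \<psi>)
  qed
  moreover have "sinusoid_gradient A B l m i p \<bullet> (w - w')
    = (w $ 1 - w' $ 1) * cos \<phi> + (w $ 2 - w' $ 2) * sin \<phi> + (\<psi> w - \<psi> w') * (B * cos \<phi> - A * sin \<phi>)"
    unfolding sinusoid_gradient_def Let_def inner_vector_4 \<phi>_def[symmetric] \<psi>_def by (simp add: algebra_simps)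
  ultimately show "\<bar>sinusoid_increment A B l m i p w - sinusoid_increment A B l m i p w' - sinusoid_gradient A B l m i p \<bullet> (w - w')\<bar>
      \<le> (8 + 4 * (\<bar>A\<bar> + \<bar>B\<bar>)) * r * norm (w - w')"
    unfolding sinusoid_increment_eq[OF p] \<phi>_def[symmetric] \<psi>_def[symmetric] by simp
qed

lemma matrix_scaleR_mult: "(a *\<^sub>R A) ** (b *\<^sub>R B) = (a * b) *\<^sub>R (A ** B)" for A :: "real ^ 'm ^ 'n" and B :: "real ^ 'k ^ 'm"
  by (simp add: matrix_matrix_mult_def vec_eq_iff sum_distrib_left mult_ac)

lemma transpose_scaleR: "transpose (a *\<^sub>R A) = a *\<^sub>R transpose A" for A :: "real ^ 'm ^ 'n"
  by (simp add: transpose_def vec_eq_iff)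

lemma normal_covariance_root:
  fixes R :: "real ^ 'n::{finite, wellorder} ^ 'n::_" and c :: real
  assumes R: "invertible R" and c: "c \<noteq> 0"
  defines "V \<equiv> (1 / c\<^sup>2) *\<^sub>R matrix_inv (transpose R ** R)" and "Q \<equiv> c *\<^sub>R R" and "P \<equiv> (1 / c) *\<^sub>R matrix_inv R"
  shows "matrix_inv V = transpose Q ** Q" "det V = 1 / (det Q)\<^sup>2" "P ** Q = mat 1"
proof -
  have RR: "invertible (transpose R ** R)" using R by (simp add: invertible_mult transpose_invertible)
  have QQ: "transpose Q ** Q = c\<^sup>2 *\<^sub>R (transpose R ** R)"
    by (simp add: Q_def transpose_scaleR matrix_scaleR_mult power2_eq_square)
  have 1: "(transpose Q ** Q) ** V = mat 1"
    unfolding QQ V_def matrix_scaleR_mult using c by (simp add: matrix_inv_mult[OF RR])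
  then show "matrix_inv V = transpose Q ** Q" by (rule matrix_inv_unique)
  have "det (transpose Q ** Q) * det V = 1" using arg_cong[OF 1, of det] by (simp add: det_mul)
  then have "(det Q)\<^sup>2 * det V = 1" by (simp add: det_mul det_transpose power2_eq_square)
  moreover from this have "det Q \<noteq> 0" by auto
  ultimately show "det V = 1 / (det Q)\<^sup>2" by (simp add: field_simps)
  show "P ** Q = mat 1" unfolding P_def Q_def matrix_scaleR_mult using c by (simp add: matrix_inv_mult[OF R])
qed

text \<open>The vector under the first \<open>R\<close> is the inverse of
  \<open>transpose R ** R\<close> applied to \<open>x\<close>, written in factors so that pairing
  through \<open>R\<close> cancels both inverses.\<close>

lemma inner_matrix_inv:
  fixes R :: "real ^ 'n ^ 'n"
  assumes "invertible R"
  shows "(R *v (matrix_inv R *v (transpose (matrix_inv R) *v x))) \<bullet> (R *v u) = x \<bullet> u"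
proof -
  have "R *v (matrix_inv R *v y) = y" "matrix_inv R *v (R *v y) = y" for y
    using matrix_inv_mult[OF assms] by (simp_all add: matrix_vector_mul_assoc)
  then show ?thesis by (simp add: transpose_matrix_vector dot_lmul_matrix)
qed

lemma vector_4_measurable:
  assumes "a \<in> borel_measurable M" "b \<in> borel_measurable M" "c \<in> borel_measurable M" "d \<in> borel_measurable M"
  shows "(\<lambda>x. vector [a x, b x, c x, d x] :: real ^ 4) \<in> borel_measurable M"
  unfolding vector_4_axis using assms by measurable

lemma filterlim_card_grid: "filterlim (\<lambda>i. real (card (grid i))) at_top grid_filter"
proof (rule filterlim_at_top_mono)
  show "filterlim (\<lambda>i. real (fst i)) at_top grid_filter"
    by (rule filterlim_compose[OF filterlim_real_sequentially filterlim_fst_grid])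
  show "\<forall>\<^sub>F i in grid_filter. real (fst i) \<le> real (card (grid i))"
    by (rule eventually_grid_filterI[of 1]) (simp add: card_grid)
qed

text \<open>The parameter set enters through a bound and a cube around the truth. As
  \<open>sqrt (T * S) * T = T^(3/2) * S^(1/2)\<close>, the normalized error of the statement is
  \<open>sqrt (N i)\<close> times the increment in rescaled coordinates.\<close>

theorem (in grid_noise) sinusoid_lad_normal:
  fixes A0 B0 l0 m0 :: real and \<Theta> :: "(real \<times> real \<times> real \<times> real) set"
    and Ahat Bhat lhat mhat :: "nat \<Rightarrow> nat \<Rightarrow> 'a \<Rightarrow> real"
  assumes l0: "0 < l0" "l0 < pi" and m0: "0 < m0" "m0 < pi" and R: "invertible (lad_Sigma A0 B0)"
    and \<Theta>_bounded: "\<And>A B l m. (A, B, l, m) \<in> \<Theta> \<Longrightarrow> \<bar>A\<bar> \<le> k \<and> \<bar>B\<bar> \<le> k \<and> l \<in> {0..pi} \<and> m \<in> {0..pi}"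
    and r: "0 < r" and near: "\<And>a b c d. \<bar>a\<bar> \<le> r \<Longrightarrow> \<bar>b\<bar> \<le> r \<Longrightarrow> \<bar>c\<bar> \<le> r \<Longrightarrow> \<bar>d\<bar> \<le> r \<Longrightarrow> (A0 + a, B0 + b, l0 + c, m0 + d) \<in> \<Theta>"
    and meas: "\<And>T S. Ahat T S \<in> borel_measurable M" "\<And>T S. Bhat T S \<in> borel_measurable M"
      "\<And>T S. lhat T S \<in> borel_measurable M" "\<And>T S. mhat T S \<in> borel_measurable M"
    and mem: "\<And>T S \<omega>. 1 \<le> T \<Longrightarrow> 1 \<le> S \<Longrightarrow> \<omega> \<in> space M \<Longrightarrow> (Ahat T S \<omega>, Bhat T S \<omega>, lhat T S \<omega>, mhat T S \<omega>) \<in> \<Theta>"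
    and lad: "\<And>T S \<omega> A B l m. 1 \<le> T \<Longrightarrow> 1 \<le> S \<Longrightarrow> \<omega> \<in> space M \<Longrightarrow> (A, B, l, m) \<in> \<Theta> \<Longrightarrow>
      (\<Sum>p\<in>grid (T, S). \<bar>eps p \<omega> - (sinusoid (Ahat T S \<omega>) (Bhat T S \<omega>) (lhat T S \<omega>) (mhat T S \<omega>) p - sinusoid A0 B0 l0 m0 p)\<bar>)
      \<le> (\<Sum>p\<in>grid (T, S). \<bar>eps p \<omega> - (sinusoid A B l m p - sinusoid A0 B0 l0 m0 p)\<bar>)"
  shows "converges_in_distribution
    (\<lambda>(T, S) \<omega>. vector
      [sqrt (real T * real S) * (Ahat T S \<omega> - A0),
       sqrt (real T * real S) * (Bhat T S \<omega> - B0),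
       real T powr (3 / 2) * real S powr (1 / 2) * (lhat T S \<omega> - l0),
       real S powr (3 / 2) * real T powr (1 / 2) * (mhat T S \<omega> - m0)] :: real ^ 4)
    (multivariate_normal 0 ((1 / (2 * \<gamma>)\<^sup>2) *\<^sub>R matrix_inv (lad_Sigma A0 B0))) grid_filter"
proof -
  have near0: "(A0, B0, l0, m0) \<in> \<Theta>" using near[of 0 0 0 0] r by simp
  then have k: "\<bar>A0\<bar> \<le> k" "\<bar>B0\<bar> \<le> k" "0 \<le> k" using \<Theta>_bounded[OF near0] by auto
  have AB: "A0 \<noteq> 0 \<or> B0 \<noteq> 0" using R lad_Sigma_singular by auto
  define L where "L = lad_Sigma_root A0 B0"
  have invL: "invertible L" using R unfolding invertible_det_nz det_lad_Sigma L_def by simp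
  \<comment> \<open>\<open>z u\<close> solves the normal equation
    \<open>2 * \<gamma> * \<Sigma> z = u\<close>: applied to the score it yields the minimizer,
    applied to a test vector the representer of its functional.\<close>
  define z where "z u = (1 / (2 * \<gamma>)) *\<^sub>R (matrix_inv L *v (transpose (matrix_inv L) *v u))" for u :: "real ^ 4"
  have z: "2 * \<gamma> * ((L *v z x) \<bullet> (L *v u)) = x \<bullet> u" for x u
    unfolding z_def using inner_matrix_inv[OF invL, of x u] \<gamma>_pos by (simp add: matrix_vector_mult_scaleR)
  define d where "d = sinusoid_gradient A0 B0 l0 m0"
  define h where "h = sinusoid_increment A0 B0 l0 m0"
  define what where "what i \<omega> = (vector [Ahat (fst i) (snd i) \<omega> - A0, Bhat (fst i) (snd i) \<omega> - B0,
    real (fst i) * (lhat (fst i) (snd i) \<omega> - l0), real (snd i) * (mhat (fst i) (snd i) \<omega> - m0)] :: real ^ 4)" for i \<omega>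
  define vstar where "vstar i \<omega> = z ((1 / sqrt (card (grid i))) *\<^sub>R (\<Sum>p\<in>grid i. sgn (eps p \<omega>) *\<^sub>R d i p))" for i \<omega>
  define X where "X = (\<lambda>(T, S) \<omega>. vector
      [sqrt (real T * real S) * (Ahat T S \<omega> - A0),
       sqrt (real T * real S) * (Bhat T S \<omega> - B0),
       real T powr (3 / 2) * real S powr (1 / 2) * (lhat T S \<omega> - l0),
       real S powr (3 / 2) * real T powr (1 / 2) * (mhat T S \<omega> - m0)] :: real ^ 4)"
  have hwhat: "h (T, S) p (what (T, S) \<omega>) = sinusoid (Ahat T S \<omega>) (Bhat T S \<omega>) (lhat T S \<omega>) (mhat T S \<omega>) p - sinusoid A0 B0 l0 m0 p"
    if "1 \<le> T" "1 \<le> S" for T S p \<omega>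
    using that by (simp add: h_def what_def sinusoid_increment_def vector_4)
  have cis: "cis (2 * l0) \<noteq> 1"
  proof
    assume "cis (2 * l0) = 1"
    then have "sin (2 * l0) = 0" "cos (2 * l0) = 1" by (simp_all add: complex_eq_iff)
    then have "(sin l0)\<^sup>2 = 0" by (simp add: cos_double_sin)
    then show False using sin_gt_zero[OF l0] by simp
  qed
  interpret lad_array M eps J C \<gamma> grid_filter grid d h "8 + 4 * (\<bar>A0\<bar> + \<bar>B0\<bar>)" "\<lambda>w. L *v w" what vstar
  proof (intro lad_array.intro lad_array_axioms.intro)
    show "median_noise M eps J C \<gamma>" by (rule median_noise_axioms)
    show "\<And>i. grid i \<subseteq> J" by (rule grid_J)
    show "\<And>i. finite (grid i)" by simp
    show "filterlim (\<lambda>i. real (card (grid i))) at_top grid_filter" by (rule filterlim_card_grid)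
    show "1 \<le> 8 + 4 * (\<bar>A0\<bar> + \<bar>B0\<bar>)" by simp
    show "\<forall>\<^sub>F i in grid_filter. smooth_design (8 + 4 * (\<bar>A0\<bar> + \<bar>B0\<bar>)) (grid i) (d i) (h i)"
      unfolding d_def h_def by (intro always_eventually allI sinusoid_smooth_design)
    show "((\<lambda>i. (\<Sum>p\<in>grid i. (d i p \<bullet> w)\<^sup>2) / card (grid i)) \<longlongrightarrow> (norm (L *v w))\<^sup>2) grid_filter" for w
      unfolding d_def L_def by (rule sinusoid_gram_limit[OF cis])
    show "linear (\<lambda>w. L *v w)" by (rule matrix_vector_mul_linear)
    show "inj (\<lambda>w. L *v w)" using invL by (rule inj_matrix_vector_mult)
    show "what i \<in> borel_measurable M" for i
      unfolding what_def using meas by (intro vector_4_measurable) auto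
    show "(1 / sqrt (card (grid i))) *\<^sub>R (\<Sum>p\<in>grid i. sgn (eps p \<omega>) *\<^sub>R d i p) \<bullet> u = 2 * \<gamma> * ((L *v vstar i \<omega>) \<bullet> (L *v u))"
      if "\<omega> \<in> space M" for \<omega> i u
      unfolding vstar_def z ..
    have "(\<Sum>p\<in>grid (T, S). \<bar>eps p \<omega> - h (T, S) p (what (T, S) \<omega>)\<bar> - \<bar>eps p \<omega>\<bar>)
      \<le> (\<Sum>p\<in>grid (T, S). \<bar>eps p \<omega> - h (T, S) p w\<bar> - \<bar>eps p \<omega>\<bar>)"
      if TS: "1 \<le> T" "1 \<le> S" and \<omega>: "\<omega> \<in> space M" and w: "norm w \<le> r" for T S \<omega> w
    proof -
      have c: "\<bar>w $ k\<bar> \<le> r" for k using component_le_norm_cart[of w k] w by linarith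
      \<comment> \<open>Dividing by \<open>T\<close> or \<open>S\<close> only shrinks the frequency
        components, so competitors of norm at most \<open>r\<close> stay in the cube inside the
        parameter set for all grids.\<close>
      have c': "\<bar>w $ k / real n\<bar> \<le> r" if "1 \<le> n" for k and n :: nat
      proof -
        have "\<bar>w $ k / real n\<bar> \<le> \<bar>w $ k\<bar> / 1" unfolding abs_divide using that by (intro divide_left_mono) auto
        then show ?thesis using c[of k] by simp
      qed
      show ?thesis
        using lad[OF TS \<omega> near[OF c[of 1] c[of 2] c'[OF TS(1), of 3] c'[OF TS(2), of 4]]]
        unfolding sum_subtractf hwhat[OF TS] by (simp add: h_def sinusoid_increment_def)
    qed
    then show "\<exists>\<delta>>0. \<forall>\<^sub>F i in grid_filter. \<forall>\<omega>\<in>space M. \<forall>w. norm w \<le> \<delta> \<longrightarrow>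
      (\<Sum>p\<in>grid i. \<bar>eps p \<omega> - h i p (what i \<omega>)\<bar> - \<bar>eps p \<omega>\<bar>) \<le> (\<Sum>p\<in>grid i. \<bar>eps p \<omega> - h i p w\<bar> - \<bar>eps p \<omega>\<bar>)"
      by (intro exI[of _ r] conjI r eventually_grid_filterI[of 1]) blast
    show "\<forall>\<^sub>F i in grid_filter. prob {\<omega> \<in> space M. \<delta> < norm (what i \<omega>)} \<le> q" if \<delta>: "0 < \<delta>" and q: "0 < q" for \<delta> q
    proof -
      have d4: "0 < \<delta> / 4" using \<delta> by simp
      have TS: "\<forall>\<^sub>F i in grid_filter. 1 \<le> fst i \<and> 1 \<le> snd i" by (rule eventually_grid_filterI[of 1]) simp
      show ?thesis
        using sinusoid_lad_consistent[OF l0 m0 AB k(3,1,2) d4 q] TS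
      proof eventually_elim
        case (elim i)
        obtain T S where i: "i = (T, S)" by (cases i)
        then have TS: "1 \<le> T" "1 \<le> S" using elim(2) by auto
        obtain E where E: "E \<in> events" "1 - q \<le> prob E"
          and small: "\<And>\<omega> A B l m. \<omega> \<in> E \<Longrightarrow> \<bar>A\<bar> \<le> k \<Longrightarrow> \<bar>B\<bar> \<le> k \<Longrightarrow> l \<in> {0..pi} \<Longrightarrow> m \<in> {0..pi} \<Longrightarrow>
            (\<Sum>p\<in>grid (T, S). \<bar>eps p \<omega> - (sinusoid A B l m p - sinusoid A0 B0 l0 m0 p)\<bar> - \<bar>eps p \<omega>\<bar>) \<le> 0 \<Longrightarrow>
            \<bar>A - A0\<bar> < \<delta> / 4 \<and> \<bar>B - B0\<bar> < \<delta> / 4 \<and> real T * \<bar>l - l0\<bar> < \<delta> / 4 \<and> real S * \<bar>m - m0\<bar> < \<delta> / 4"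
          using elim(1) unfolding i fst_conv snd_conv by blast
        have "norm (what i \<omega>) \<le> \<delta>" if \<omega>: "\<omega> \<in> E" for \<omega>
        proof -
          have sp: "\<omega> \<in> space M" using \<omega> sets.sets_into_space[OF E(1)] by blast
          note bd = \<Theta>_bounded[OF mem[OF TS sp]]
          have "\<bar>Ahat T S \<omega> - A0\<bar> < \<delta> / 4 \<and> \<bar>Bhat T S \<omega> - B0\<bar> < \<delta> / 4 \<and> real T * \<bar>lhat T S \<omega> - l0\<bar> < \<delta> / 4 \<and> real S * \<bar>mhat T S \<omega> - m0\<bar> < \<delta> / 4"
          proof (rule small[OF \<omega>])
            show "(\<Sum>p\<in>grid (T, S). \<bar>eps p \<omega> - (sinusoid (Ahat T S \<omega>) (Bhat T S \<omega>) (lhat T S \<omega>) (mhat T S \<omega>) p - sinusoid A0 B0 l0 m0 p)\<bar> - \<bar>eps p \<omega>\<bar>) \<le> 0"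
              using lad[OF TS sp near0] unfolding sum_subtractf by simp
          qed (use bd in auto)
          then show ?thesis
            using norm_4_le[of "what i \<omega>"] unfolding what_def i vector_4 fst_conv snd_conv abs_mult abs_of_nat by linarith
        qed
        then have sub: "{\<omega> \<in> space M. \<delta> < norm (what i \<omega>)} \<subseteq> space M - E" by force
        have "prob {\<omega> \<in> space M. \<delta> < norm (what i \<omega>)} \<le> prob (space M - E)"
          by (rule finite_measure_mono[OF sub]) (use E in auto)
        then show ?case using E by (simp add: prob_compl)
      qed
    qed
  qed
  have X_eq: "\<forall>\<^sub>F i in grid_filter. X i = (\<lambda>\<omega>. sqrt (N i) *\<^sub>R what i \<omega>)"
  proof (rule eventually_grid_filterI[of 1])
    fix T S :: nat assume TS: "1 \<le> T" "1 \<le> S"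
    have p: "real n powr (3 / 2) = real n * sqrt (real n)" "real n powr (1 / 2) = sqrt (real n)" if "1 \<le> n" for n
    proof -
      show "real n powr (1 / 2) = sqrt (real n)" by (simp add: powr_half_sqrt)
      then show "real n powr (3 / 2) = real n * sqrt (real n)" using powr_add[of "real n" 1 "1 / 2"] that by simp
    qed
    show "X (T, S) = (\<lambda>\<omega>. sqrt (N (T, S)) *\<^sub>R what (T, S) \<omega>)"
      using TS by (simp add: X_def what_def fun_eq_iff vec_eq_iff forall_4 vector_4 card_grid p real_sqrt_mult mult_ac)
  qed
  have Sig: "lad_Sigma A0 B0 = transpose L ** L" by (simp add: L_def lad_Sigma_root)
  have "2 * \<gamma> \<noteq> 0" using \<gamma>_pos by simp
  note normal = normal_covariance_root[OF invL this, folded Sig]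
  let ?V = "(1 / (2 * \<gamma>)\<^sup>2) *\<^sub>R matrix_inv (lad_Sigma A0 B0)"
  have "converges_in_distribution X (multivariate_normal 0 ?V) grid_filter"
  proof (rule weak_convergence_of_cos)
    show "prob_space M" by (rule prob_space_axioms)
    show "prob_space (multivariate_normal 0 ?V)" by (rule prob_space_multivariate_normal[OF normal])
    show "sets (multivariate_normal 0 ?V) = sets borel" by (simp add: multivariate_normal_def)
    show "X i \<in> borel_measurable M" for i
      using meas by (cases i) (simp add: X_def vector_4_measurable)
    show "\<exists>R. \<forall>\<^sub>F i in grid_filter. prob {\<omega> \<in> space M. R < norm (X i \<omega>)} \<le> q" if q: "0 < q" for q
    proof -
      obtain R where R: "\<forall>\<^sub>F i in grid_filter. prob {\<omega> \<in> space M. R < norm (sqrt (N i) *\<^sub>R what i \<omega>)} \<le> q"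
        using estimator_tight'[OF q] by blast
      have "\<forall>\<^sub>F i in grid_filter. prob {\<omega> \<in> space M. R < norm (X i \<omega>)} \<le> q"
        using R X_eq by eventually_elim simp
      then show ?thesis by blast
    qed
    show "((\<lambda>i. expectation (\<lambda>\<omega>. cos (u \<bullet> X i \<omega> + b))) \<longlongrightarrow> (\<integral>x. cos (u \<bullet> x + b) \<partial>multivariate_normal 0 ?V)) grid_filter" for u b
    proof -
      \<comment> \<open>\<open>L\<close> cancels one of the two inverse factors of
        \<open>z u\<close>, leaving the transpose of the root \<open>P\<close> of the covariance;
        this matches the limit variance with that of the normal law.\<close>
      have "L *v z u = transpose ((1 / (2 * \<gamma>)) *\<^sub>R matrix_inv L) *v u"
        unfolding z_def matrix_vector_mult_scaleR transpose_scaleR matrix_vector_mul_assoc matrix_mul_assoc matrix_inv_mult(1)[OF invL]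
        by (simp only: matrix_mul_lid scaleR_matrix_vector_assoc)
      then have lim: "(\<integral>x. cos (u \<bullet> x + b) \<partial>multivariate_normal 0 ?V) = cos b * exp (- (norm (L *v z u))\<^sup>2 / 2)"
        using multivariate_normal_cos[OF normal, of u b] by simp
      have "u \<bullet> x = 2 * \<gamma> * ((L *v x) \<bullet> (L *v z u))" for x using z[of u x] by (simp add: inner_commute)
      from estimator_cos_limit[OF this, of b]
      have "((\<lambda>i. expectation (\<lambda>\<omega>. cos (u \<bullet> (sqrt (N i) *\<^sub>R what i \<omega>) + b))) \<longlongrightarrow> cos b * exp (- (norm (L *v z u))\<^sup>2 / 2)) grid_filter" .
      then show ?thesis
        unfolding lim
      proof (rule Lim_transform_eventually)
        show "\<forall>\<^sub>F i in grid_filter. expectation (\<lambda>\<omega>. cos (u \<bullet> (sqrt (N i) *\<^sub>R what i \<omega>) + b)) = expectation (\<lambda>\<omega>. cos (u \<bullet> X i \<omega> + b))"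
          using X_eq by eventually_elim simp
      qed
    qed
  qed
  then show ?thesis unfolding X_def .
qed

section \<open>Translation of the stated model\<close>

lemma lad_objective_grid:
  fixes e :: "nat \<Rightarrow> nat \<Rightarrow> real"
  assumes "\<And>t s. 1 \<le> t \<Longrightarrow> 1 \<le> s \<Longrightarrow> y t s = A0 * cos (l0 * real t + m0 * real s) + B0 * sin (l0 * real t + m0 * real s) + e t s"
  shows "lad_objective y T S (A, B, l, m)
    = (\<Sum>p\<in>grid (T, S). \<bar>(case p of (t, s) \<Rightarrow> e t s) - (sinusoid A B l m p - sinusoid A0 B0 l0 m0 p)\<bar>) / (real T * real S)"
proof -
  have "(\<Sum>t = 1..T. \<Sum>s = 1..S. \<bar>y t s - A * cos (l * real t + m * real s) - B * sin (l * real t + m * real s)\<bar>)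
    = (\<Sum>p\<in>grid (T, S). \<bar>(case p of (t, s) \<Rightarrow> e t s) - (sinusoid A B l m p - sinusoid A0 B0 l0 m0 p)\<bar>)"
    unfolding grid_def sum.cartesian_product by (intro sum.cong) (auto simp: assms sinusoid_def algebra_simps)
  then show ?thesis by (simp add: lad_objective_def)
qed

lemma interior_quadruple:
  fixes a b c d :: real
  assumes "(a, b, c, d) \<in> interior X"
  obtains r where "0 < r" "\<And>a' b' c' d'. \<bar>a'\<bar> \<le> r \<Longrightarrow> \<bar>b'\<bar> \<le> r \<Longrightarrow> \<bar>c'\<bar> \<le> r \<Longrightarrow> \<bar>d'\<bar> \<le> r \<Longrightarrow> (a + a', b + b', c + c', d + d') \<in> X"
proof -
  obtain e where e: "0 < e" "cball (a, b, c, d) e \<subseteq> X" using assms unfolding mem_interior_cball by blast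
  show thesis
  proof (rule that[of "e / 4"])
    show "0 < e / 4" using e by simp
    fix a' b' c' d' :: real assume le: "\<bar>a'\<bar> \<le> e / 4" "\<bar>b'\<bar> \<le> e / 4" "\<bar>c'\<bar> \<le> e / 4" "\<bar>d'\<bar> \<le> e / 4"
    have "norm (a', b', c', d') \<le> \<bar>a'\<bar> + (\<bar>b'\<bar> + (\<bar>c'\<bar> + \<bar>d'\<bar>))"
      by (intro order_trans[OF norm_Pair_le] add_mono) simp_all
    then have "norm (a', b', c', d') \<le> e" using le by linarith
    then have "(a + a', b + b', c + c', d + d') \<in> cball (a, b, c, d) e"
      unfolding mem_cball dist_norm by (subst norm_minus_commute) simp
    then show "(a + a', b + b', c + c', d + d') \<in> X" using e by blast
  qed
qed

theorem theorem3p3: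
  fixes M :: "'a measure"
    and A0 B0 lambda0 mu0 :: real
    and K :: "real set"
    and Theta :: "(real \<times> real \<times> real \<times> real) set"
    and eps y :: "nat \<Rightarrow> nat \<Rightarrow> 'a \<Rightarrow> real"
    and G g :: "real \<Rightarrow> real"
    and Ahat Bhat lambdahat muhat :: "nat \<Rightarrow> nat \<Rightarrow> 'a \<Rightarrow> real"
  assumes "prob_space M"
    and model: "\<And>t s \<omega>. t \<ge> 1 \<Longrightarrow> s \<ge> 1 \<Longrightarrow> \<omega> \<in> space M \<Longrightarrow>
      y t s \<omega> = A0 * cos (lambda0 * real t + mu0 * real s)
             + B0 * sin (lambda0 * real t + mu0 * real s) + eps t s \<omega>"
    and "compact K"
    and Theta: "Theta = K \<times> K \<times> {0..pi} \<times> {0..pi}"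
    and interior: "(A0, B0, lambda0, mu0) \<in> interior Theta"
    and indep: "prob_space.indep_vars M (\<lambda>_. borel) (\<lambda>(t, s). eps t s) ({1..} \<times> {1..})"
    and distribution: "\<And>t s. t \<ge> 1 \<Longrightarrow> s \<ge> 1 \<Longrightarrow> cdf (distr M borel (eps t s)) = G"
    and g_nonneg: "\<And>x. 0 \<le> g x"
    and density: "\<And>t s. t \<ge> 1 \<Longrightarrow> s \<ge> 1 \<Longrightarrow>
      distributed M lborel (eps t s) (\<lambda>x. ennreal (g x))"
    and "continuous_on UNIV g"
    and unique_median: "\<And>x. G x = 1 / 2 \<longleftrightarrow> x = 0"
    and "\<And>x. g differentiable (at x)"
    and "bounded (range (deriv g))"
    and second_moment: "\<And>t s. t \<ge> 1 \<Longrightarrow> s \<ge> 1 \<Longrightarrow> integrable M (\<lambda>\<omega>. (eps t s \<omega>)\<^sup>2)"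
    and g0: "g 0 \<noteq> 0"
    and "invertible (lad_Sigma A0 B0)"
    and measurable: "\<And>T S. Ahat T S \<in> borel_measurable M" "\<And>T S. Bhat T S \<in> borel_measurable M"
      "\<And>T S. lambdahat T S \<in> borel_measurable M" "\<And>T S. muhat T S \<in> borel_measurable M"
    and lad: "\<And>T S \<omega>. T \<ge> 1 \<Longrightarrow> S \<ge> 1 \<Longrightarrow> \<omega> \<in> space M \<Longrightarrow>
      is_arg_min (lad_objective (\<lambda>t s. y t s \<omega>) T S) (\<lambda>\<theta>. \<theta> \<in> Theta)
        (Ahat T S \<omega>, Bhat T S \<omega>, lambdahat T S \<omega>, muhat T S \<omega>)"
  shows "prob_space.converges_in_distribution M
    (\<lambda>(T, S) \<omega>. vector
      [sqrt (real T * real S) * (Ahat T S \<omega> - A0),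
       sqrt (real T * real S) * (Bhat T S \<omega> - B0),
       real T powr (3 / 2) * real S powr (1 / 2) * (lambdahat T S \<omega> - lambda0),
       real S powr (3 / 2) * real T powr (1 / 2) * (muhat T S \<omega> - mu0)] :: real ^ 4)
    (multivariate_normal 0 ((1 / (4 * (g 0)\<^sup>2)) *\<^sub>R matrix_inv (lad_Sigma A0 B0)))
    (filtercomap (\<lambda>(T, S). min T S) at_top)"
proof -
  interpret prob_space M by fact
  define eps2 where "eps2 = (\<lambda>(t, s). eps t s)"
  obtain D where D: "\<And>x. \<bar>deriv g x\<bar> \<le> D"
    using \<open>bounded (range (deriv g))\<close> unfolding bounded_iff by auto
  have D0: "0 \<le> D" using D[of 0] by linarith
  have lip: "\<bar>g x - g 0\<bar> \<le> D * \<bar>x\<bar>" for x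
  proof -
    have "norm (g x - g 0) \<le> D * norm (x - 0)"
    proof (rule field_differentiable_bound[of UNIV])
      show "(g has_field_derivative deriv g z) (at z within UNIV)" for z
        using \<open>\<And>x. g differentiable (at x)\<close> by (simp add: DERIV_deriv_iff_real_differentiable)
    qed (use D in auto)
    then show ?thesis by simp
  qed
  have g0_pos: "0 < g 0" using g0 g_nonneg[of 0] by linarith
  have G0: "G 0 = 1 / 2" using unique_median by blast
  have J: "distributed M lborel (eps2 p) (\<lambda>x. ennreal (g x))" "cdf (distr M borel (eps2 p)) 0 = 1 / 2"
    if "p \<in> {1..} \<times> {1..}" for p
    using that density distribution G0 by (auto simp: eps2_def)
  have ball: "0 \<le> x \<Longrightarrow> prob {\<omega> \<in> space M. \<bar>eps2 p \<omega>\<bar> \<le> x} \<le> (2 * (g 0 + D) + 1) * x"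
    and curv: "\<bar>expectation (\<lambda>\<omega>. lad_excess (eps2 p \<omega>) h) - g 0 * h\<^sup>2\<bar> \<le> D * \<bar>h\<bar> ^ 3"
    if "p \<in> {1..} \<times> {1..}" for p x h
    using density_small_ball_curvature[OF \<open>prob_space M\<close> J(1)[OF that] g_nonneg \<open>continuous_on UNIV g\<close> lip D0] by blast+
  \<comment> \<open>The median condition makes the signs centred, and \<open>\<gamma>\<close>
    becomes \<open>g 0\<close>, positive by \<open>g0\<close>; one constant dominates both the
    small-ball and the curvature bounds.\<close>
  interpret grid_noise M eps2 "{1..} \<times> {1..}" "2 * (g 0 + D) + 1" "g 0"
  proof (intro grid_noise.intro median_noise.intro median_noise_axioms.intro grid_noise_axioms.intro)
    show "prob_space M" by fact
    show "indep_vars (\<lambda>_. borel) eps2 ({1..} \<times> {1..})" unfolding eps2_def by (rule indep)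
    show "0 < 2 * (g 0 + D) + 1" "0 < g 0" using D0 g0_pos by auto
    show "grid i \<subseteq> {1..} \<times> {1..}" for i by (auto simp: grid_def)
    fix p :: "nat \<times> nat" assume p: "p \<in> {1..} \<times> {1..}"
    have "eps2 p \<in> borel_measurable M" using distributed_measurable[OF J(1)[OF p]] by simp
    note med = median_zero_sgn[OF \<open>prob_space M\<close> this _ J(2)[OF p]]
    have "prob {\<omega> \<in> space M. \<bar>eps2 p \<omega>\<bar> \<le> 0} \<le> 0" using ball[OF p, of 0] by simp
    from med[OF this] show "expectation (\<lambda>\<omega>. sgn (eps2 p \<omega>)) = 0" "AE \<omega> in M. eps2 p \<omega> \<noteq> 0" by auto
    show "prob {\<omega> \<in> space M. \<bar>eps2 p \<omega>\<bar> \<le> x} \<le> (2 * (g 0 + D) + 1) * x" if "0 \<le> x" for x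
      by (rule ball[OF p that])
    show "\<bar>expectation (\<lambda>\<omega>. lad_excess (eps2 p \<omega>) h) - g 0 * h\<^sup>2\<bar> \<le> (2 * (g 0 + D) + 1) * \<bar>h\<bar> ^ 3" for h
      by (rule order_trans[OF curv[OF p] mult_right_mono]) (use D0 g0_pos in auto)
  qed
  obtain k where k: "\<And>x. x \<in> K \<Longrightarrow> \<bar>x\<bar> \<le> k"
    using compact_imp_bounded[OF \<open>compact K\<close>] unfolding bounded_iff by auto
  obtain r where r: "0 < r" and near: "\<And>a b c d. \<bar>a\<bar> \<le> r \<Longrightarrow> \<bar>b\<bar> \<le> r \<Longrightarrow> \<bar>c\<bar> \<le> r \<Longrightarrow> \<bar>d\<bar> \<le> r \<Longrightarrow>
      (A0 + a, B0 + b, lambda0 + c, mu0 + d) \<in> Theta"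
    by (rule interior_quadruple[OF interior]) blast
  \<comment> \<open>Interiority keeps the frequencies off the ends of \<open>[0, pi]\<close>: shifts
    by \<open>r\<close> in either direction remain admissible.\<close>
  have freq: "0 < lambda0" "lambda0 < pi" "0 < mu0" "mu0 < pi"
    using near[of 0 0 r r] near[of 0 0 "- r" "- r"] r unfolding Theta by auto
  have objective: "lad_objective (\<lambda>t s. y t s \<omega>) T S (A, B, l, m)
      = (\<Sum>p\<in>grid (T, S). \<bar>eps2 p \<omega> - (sinusoid A B l m p - sinusoid A0 B0 lambda0 mu0 p)\<bar>) / (real T * real S)"
    if "\<omega> \<in> space M" for \<omega> T S A B l m
    using lad_objective_grid[of "\<lambda>t s. y t s \<omega>" A0 lambda0 mu0 B0 "\<lambda>t s. eps t s \<omega>", OF model[OF _ _ that]]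
    by (simp add: eps2_def case_prod_beta)
  have hat: "(Ahat T S \<omega>, Bhat T S \<omega>, lambdahat T S \<omega>, muhat T S \<omega>) \<in> Theta"
    "(A, B, l, m) \<in> Theta \<Longrightarrow>
      (\<Sum>p\<in>grid (T, S). \<bar>eps2 p \<omega> - (sinusoid (Ahat T S \<omega>) (Bhat T S \<omega>) (lambdahat T S \<omega>) (muhat T S \<omega>) p - sinusoid A0 B0 lambda0 mu0 p)\<bar>)
      \<le> (\<Sum>p\<in>grid (T, S). \<bar>eps2 p \<omega> - (sinusoid A B l m p - sinusoid A0 B0 lambda0 mu0 p)\<bar>)"
    if "1 \<le> T" "1 \<le> S" "\<omega> \<in> space M" for T S \<omega> A B l m
    using lad[OF that] that unfolding is_arg_min_linorder
    by (auto simp: objective[OF that(3)] divide_le_cancel dest!: spec[of _ "(A, B, l, m)"])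
  have "4 * (g 0)\<^sup>2 = (2 * g 0)\<^sup>2" by (simp add: power_mult_distrib)
  then show ?thesis
    using sinusoid_lad_normal[OF freq \<open>invertible (lad_Sigma A0 B0)\<close> _ r near measurable hat, of k]
      k unfolding Theta by auto
qed

end
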